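(* Let $\mathcal{F}$ be a simply generated family of trees (with weight sequence $(\phi_m)_{m\ge 0}$ and $\tau$ as in the context), together with a partition, for every $k$, of the trees of size $k$ in $\mathcal{F}$ into a set $\mathcal{I}_k$ of isomorphism classes, such that: (C1) $\limsup_{k\to\infty}\frac{\log|\mathcal{I}_k|}{k}=C_1<\infty$; (C2) there exist subsets $\mathcal{J}_k\subseteq\mathcal{I}_k$ and a constant $C_2>0$ such that (C2a) a random tree of $\mathcal{F}$ with $k$ vertices belongs to a class in $\mathcal{J}_k$ with probability $1-o(1)$ as $k\to\infty$, and (C2b) the probability that a random tree of $\mathcal{F}$ with $k$ vertices lies in any fixed class $I\in\mathcal{J}_k$ is at most $e^{-C_2k+o(k)}$. Let $\xi$ be the offspring distribution of the Galton--Watson process corresponding to $\mathcal{F}$, which satisfies $\mathbb{E}(\xi)=1$ and $\mathbb{V}(\xi)=\sigma^2<\infty$. Let $A_n$ be the number of distinct isomorphism classes represented by the fringe subtrees of a random tree $T_n$ of size $n$ from $\mathcal{F}$, and set $\kappa=\sqrt{2/(\pi\sigma^2)}$. Then (i) $\frac{\kappa\sqrt{C_2}\,n}{\sqrt{\log n}}(1+o(1))\le\mathbb{E}(A_n)\le\frac{\kappa\sqrt{C_1}\,n}{\sqrt{\log n}}(1+o(1))$; (ii) with probability tending to $1$ as $n\to\infty$, $\frac{\kappa\sqrt{C_2}\,n}{\sqrt{\log n}}(1+o(1))\le A_n\le\frac{\kappa\sqrt{C_1}\,n}{\sqrt{\log n}}(1+o(1))$.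
   Context: Trees are rooted; the size of a tree is its number of vertices; $\deg(v)$ is the number of children of $v$. A fringe subtree of a tree $t$ is the subtree consisting of a vertex and all its descendants. A simply generated family is given by a weight sequence $(\phi_m)_{m\ge0}$ of nonnegative reals with $\Phi(x)=\sum_m\phi_mx^m$ of radius of convergence $R$; a plane (ordered rooted) tree $t$ gets weight $w(t)=\prod_{v\in t}\phi_{\deg(v)}$, and a random tree of size $n$ from the family is a random plane tree of size $n$ chosen with probability proportional to $w(t)$ (members of the family may carry extra structure, e.g. $d$-ary trees, whose underlying plane tree is then distributed in this way; a fringe subtree of a tree of the family is again a member of the family). It is assumed that there is $\tau\in(0,R]$ with $\tau\Phi'(\tau)=\Phi(\tau)$; the corresponding Galton--Watson process has offspring distribution $\mathbb{P}(\xi=m)=\phi_m\tau^m/\Phi(\tau)$, and the random tree of size $n$ has the law of the Galton--Watson tree with this offspring distribution conditioned to have $n$ vertices. *)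

theory Defs
  imports "HOL-Probability.Probability"
begin

datatype plane_tree = PNode "plane_tree list"

primrec vertices :: "plane_tree \<Rightarrow> nat" where
  "vertices (PNode ts) = Suc (sum_list (map vertices ts))"

primrec plane_weight :: "(nat \<Rightarrow> real) \<Rightarrow> plane_tree \<Rightarrow> real" where
  "plane_weight \<phi> (PNode ts) = \<phi> (length ts) * prod_list (map (plane_weight \<phi>) ts)"

text \<open>
  The members of a family may carry structure beyond their underlying plane tree (for
  instance the positions of the children in a \<open>d\<close>-ary tree). A family therefore comes with
  maps giving the underlying plane tree and the list of root branches of a member; the
  branches are the fringe subtrees rooted at the children of the root.
\<close>

record 'a tree_family =
  members :: "'a set"
  shape :: "'a \<Rightarrow> plane_tree"
  branches :: "'a \<Rightarrow> 'a list"
  weight :: "'a \<Rightarrow> real"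

definition members_of_size :: "('a, 'm) tree_family_scheme \<Rightarrow> nat \<Rightarrow> 'a set" where
  "members_of_size \<F> n = {t \<in> members \<F>. vertices (shape \<F> t) = n}"

text \<open>
  Several members may have the same list \<open>ts\<close> of root branches; \<open>weight_branches\<close> says that
  together they have the weight \<open>\<phi> (length ts) * (\<Prod>t\<leftarrow>ts. w t)\<close> that a plane tree with
  branches \<open>ts\<close> has. In the random tree of size \<open>n\<close> the additional structure at the root is
  thus irrelevant for the branches: given their sizes, the branches are independent random
  members of the family. For \<open>d\<close>-ary trees all weights are 1 and
  \<open>\<phi> m = d choose m\<close> counts the sets of positions of \<open>m\<close> children. Summing over all members
  with a given plane tree gives the weight of this plane tree
  (lemma \<open>sum_weight_shape\<close>).
\<close>

definition simply_generated :: "(nat \<Rightarrow> real) \<Rightarrow> ('a, 'm) tree_family_scheme \<Rightarrow> bool" where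
  "simply_generated \<phi> \<F> \<longleftrightarrow>
     (\<forall>m. 0 \<le> \<phi> m) \<and>
     (\<forall>n. finite (members_of_size \<F> n)) \<and>
     (\<forall>t\<in>members \<F>. 0 \<le> weight \<F> t) \<and>
     (\<forall>t\<in>members \<F>. set (branches \<F> t) \<subseteq> members \<F>) \<and>
     (\<forall>t\<in>members \<F>. shape \<F> t = PNode (map (shape \<F>) (branches \<F> t))) \<and>
     (\<forall>ts\<in>lists (members \<F>).
        (\<Sum>t | t \<in> members \<F> \<and> branches \<F> t = ts. weight \<F> t) =
          \<phi> (length ts) * prod_list (map (weight \<F>) ts))"

definition total_weight :: "('a, 'm) tree_family_scheme \<Rightarrow> nat \<Rightarrow> real" where
  "total_weight \<F> n = (\<Sum>t\<in>members_of_size \<F> n. weight \<F> t)"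

text \<open>Only meaningful if \<open>total_weight \<F> n > 0\<close>, i.e. if there is a random tree of size \<open>n\<close>.\<close>

definition random_tree :: "('a, 'm) tree_family_scheme \<Rightarrow> nat \<Rightarrow> 'a pmf" where
  "random_tree \<F> n =
     embed_pmf (\<lambda>t. if t \<in> members_of_size \<F> n then weight \<F> t / total_weight \<F> n else 0)"

text \<open>
  Limits for \<open>n \<longlonglongrightarrow> \<infinity>\<close> are taken through those \<open>n\<close> for which there is a random tree of
  size \<open>n\<close> (for complete binary trees, the odd \<open>n\<close>).
\<close>

definition at_infinite_size :: "('a, 'm) tree_family_scheme \<Rightarrow> nat filter" where
  "at_infinite_size \<F> = inf at_top (principal {n. total_weight \<F> n > 0})"

inductive_set fringe_subtrees :: "('a, 'm) tree_family_scheme \<Rightarrow> 'a \<Rightarrow> 'a set"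
  for \<F> :: "('a, 'm) tree_family_scheme" and t :: 'a where
  self: "t \<in> fringe_subtrees \<F> t"
| branch: "s \<in> fringe_subtrees \<F> t \<Longrightarrow> u \<in> set (branches \<F> s) \<Longrightarrow> u \<in> fringe_subtrees \<F> t"

definition num_fringe_classes ::
    "('a, 'm) tree_family_scheme \<Rightarrow> (nat \<Rightarrow> 'a set set) \<Rightarrow> 'a \<Rightarrow> nat" where
  "num_fringe_classes \<F> \<I> t = card {C. C \<in> (\<Union>k. \<I> k) \<and> C \<inter> fringe_subtrees \<F> t \<noteq> {}}"

definition gen_fun :: "(nat \<Rightarrow> real) \<Rightarrow> real \<Rightarrow> real" where
  "gen_fun \<phi> x = (\<Sum>m. \<phi> m * x ^ m)"

text \<open>
  The derivative is taken termwise, so that it is also defined at the radius of convergence;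
  there its convergence has to be required.
\<close>

definition gen_fun_deriv :: "(nat \<Rightarrow> real) \<Rightarrow> real \<Rightarrow> real" where
  "gen_fun_deriv \<phi> x = (\<Sum>m. diffs \<phi> m * x ^ m)"

definition is_critical :: "(nat \<Rightarrow> real) \<Rightarrow> real \<Rightarrow> bool" where
  "is_critical \<phi> \<tau> \<longleftrightarrow>
     0 < \<tau> \<and> ereal \<tau> \<le> conv_radius \<phi> \<and>
     summable (\<lambda>m. \<phi> m * \<tau> ^ m) \<and> summable (\<lambda>m. diffs \<phi> m * \<tau> ^ m) \<and>
     \<tau> * gen_fun_deriv \<phi> \<tau> = gen_fun \<phi> \<tau>"

lemma sum_prod_list_listset:
  fixes w :: "'a \<Rightarrow> real"
  assumes "\<forall>A\<in>set As. finite A"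
  shows "(\<Sum>ts\<in>listset As. prod_list (map w ts)) = prod_list (map (sum w) As)
           \<and> finite (listset As)"
  using assms
proof (induction As)
  case (Cons A As)
  have img: "listset (A # As) = (\<lambda>(t, ts). t # ts) ` (A \<times> listset As)"
    by (auto simp: set_Cons_def)
  have inj: "inj_on (\<lambda>(t, ts). t # ts) (A \<times> listset As)"
    by (auto simp: inj_on_def)
  have "(\<Sum>ts\<in>listset (A # As). prod_list (map w ts)) =
        (\<Sum>(t, ts)\<in>A \<times> listset As. w t * prod_list (map w ts))"
    unfolding img by (subst sum.reindex[OF inj]) (simp add: case_prod_unfold)
  also have "\<dots> = sum w A * (\<Sum>ts\<in>listset As. prod_list (map w ts))"
    by (simp add: sum_product sum.cartesian_product)
  finally show ?case
    unfolding img using Cons by auto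
qed simp

lemma sum_weight_shape:
  assumes "simply_generated \<phi> \<F>"
  shows "(\<Sum>t | t \<in> members \<F> \<and> shape \<F> t = p. weight \<F> t) = plane_weight \<phi> p"
proof (induction p)
  case (PNode ps)
  define S where "S q = {t \<in> members \<F>. shape \<F> t = q}" for q
  have fin: "finite (S q)" for q
    by (rule finite_subset[of _ "members_of_size \<F> (vertices q)"])
       (use assms in \<open>auto simp: S_def members_of_size_def simply_generated_def\<close>)
  define L where "L = listset (map S ps)"
  have "ts \<in> listset (map S qs) \<longleftrightarrow> ts \<in> lists (members \<F>) \<and> map (shape \<F>) ts = qs" for ts qs
  proof (induction qs arbitrary: ts)
    case (Cons q qs)
    then show ?case by (cases ts) (auto simp: S_def set_Cons_def)
  qed auto
  then have L: "ts \<in> L \<longleftrightarrow> ts \<in> lists (members \<F>) \<and> map (shape \<F>) ts = ps" for ts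
    unfolding L_def by blast
  have listset: "(\<Sum>ts\<in>L. prod_list (map (weight \<F>) ts)) =
      prod_list (map (sum (weight \<F>)) (map S ps)) \<and> finite L"
    unfolding L_def by (rule sum_prod_list_listset) (auto simp: fin)
  have shape: "shape \<F> t = PNode ps \<longleftrightarrow> branches \<F> t \<in> L" if "t \<in> members \<F>" for t
  proof -
    have "shape \<F> t = PNode (map (shape \<F>) (branches \<F> t))"
      "set (branches \<F> t) \<subseteq> members \<F>"
      using assms that by (auto simp: simply_generated_def)
    then show ?thesis by (auto simp: L)
  qed
  have "sum (weight \<F>) (S (PNode ps)) =
        (\<Sum>ts\<in>L. sum (weight \<F>) {t \<in> S (PNode ps). branches \<F> t = ts})"
    by (rule sum.group[symmetric]) (use listset fin shape in \<open>auto simp: S_def\<close>)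
  also have "\<dots> = (\<Sum>ts\<in>L. \<phi> (length ps) * prod_list (map (weight \<F>) ts))"
  proof (rule sum.cong[OF refl])
    fix ts assume ts: "ts \<in> L"
    have "{t \<in> S (PNode ps). branches \<F> t = ts} = {t. t \<in> members \<F> \<and> branches \<F> t = ts}"
      using ts shape by (auto simp: S_def)
    moreover have "ts \<in> lists (members \<F>)" "length ts = length ps"
      using ts L by auto
    ultimately show "sum (weight \<F>) {t \<in> S (PNode ps). branches \<F> t = ts} =
        \<phi> (length ps) * prod_list (map (weight \<F>) ts)"
      using assms by (auto simp: simply_generated_def)
  qed
  also have "\<dots> = \<phi> (length ps) * prod_list (map (\<lambda>p. sum (weight \<F>) (S p)) ps)"
    using listset by (simp add: sum_distrib_left[symmetric] o_def)
  also have "map (\<lambda>p. sum (weight \<F>) (S p)) ps = map (plane_weight \<phi>) ps"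
    using PNode by (auto simp: S_def)
  finally show ?case by (simp add: S_def)
qed

text \<open>The plane trees themselves form a simply generated family.\<close>

definition plane_trees :: "(nat \<Rightarrow> real) \<Rightarrow> plane_tree tree_family" where
  "plane_trees \<phi> = \<lparr>members = UNIV, shape = id, branches = (\<lambda>t. case t of PNode ts \<Rightarrow> ts),
     weight = plane_weight \<phi>\<rparr>"

lemma length_le_vertices: "length ts \<le> sum_list (map vertices ts)"
proof (induction ts)
  case (Cons t ts)
  then show ?case by (cases t) auto
qed simp

lemma finite_vertices_le: "finite {t. vertices t \<le> n}"
proof (induction n)
  case 0
  have "{t. vertices t \<le> 0} = {}"
  proof -
    have "vertices t \<noteq> 0" for t by (cases t) auto
    then show ?thesis by simp
  qed
  then show ?case by (simp only: finite.emptyI)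
next
  case (Suc n)
  have "{t. vertices t \<le> Suc n} \<subseteq> PNode ` {ts. set ts \<subseteq> {t. vertices t \<le> n} \<and> length ts \<le> n}"
  proof
    fix t assume t: "t \<in> {t. vertices t \<le> Suc n}"
    obtain ts where ts: "t = PNode ts" by (cases t)
    have "sum_list (map vertices ts) \<le> n" using t ts by simp
    moreover have "vertices s \<le> sum_list (map vertices ts)" if "s \<in> set ts" for s
      using that by (auto intro: member_le_sum_list)
    ultimately show "t \<in> PNode ` {ts. set ts \<subseteq> {t. vertices t \<le> n} \<and> length ts \<le> n}"
      using length_le_vertices[of ts] order_trans unfolding ts by blast
  qed
  then show ?case
    by (rule finite_subset) (intro finite_imageI finite_lists_length_le Suc)
qed

lemma simply_generated_plane_trees:
  assumes "\<And>m. 0 \<le> \<phi> m"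
  shows "simply_generated \<phi> (plane_trees \<phi>)"
proof -
  have nonneg: "0 \<le> plane_weight \<phi> t" for t
    by (induction t) (auto intro!: mult_nonneg_nonneg prod_list_nonneg assms)
  have "{t. (case t of PNode ts \<Rightarrow> ts) = us} = {PNode us}" for us
    by (auto split: plane_tree.splits) (metis plane_tree.exhaust)
  moreover have "finite {t. vertices t = n}" for n
    by (rule finite_subset[OF _ finite_vertices_le[of n]]) auto
  ultimately show ?thesis
    using assms nonneg
    by (simp add: simply_generated_def plane_trees_def members_of_size_def split: plane_tree.splits)
qed

end

theory Submission
  imports Defs "HOL-Real_Asymp.Real_Asymp"
begin

text \<open>
  A fringe subtree of size \<open>k\<close> is, given its size, a random member of size \<open>k\<close>, and removing
  the root of the first tree of a forest yields exact formulas for the mean number of (pairs of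
  disjoint) fringe subtrees of given sizes in terms of \<open>[x\<^sup>s] \<Phi>(x)\<^sup>n\<close>, that is, of the point
  probabilities of the random walk with step distribution \<open>\<xi>\<close>. The local limit theorem then gives
  that the number \<open>Y\<close> of fringe subtrees of size between \<open>\<alpha> log n\<close> and \<open>\<surd>n\<close> has mean
  \<open>\<sim> \<kappa> n / \<surd>(\<alpha> log n)\<close> and a second moment asymptotic to the square of the mean, while larger
  fringe subtrees are negligible.

  If \<open>\<alpha> C1 < 1\<close>, there are only \<open>o(n / \<surd>(log n))\<close> classes of trees of size less than \<open>\<alpha> log n\<close>, so
  \<open>A\<^sub>n \<le> Y + o(n / \<surd>(log n))\<close>. If \<open>\<alpha> C2 > 1\<close>, the mean number of pairs of fringe subtrees counted
  by \<open>Y\<close> that lie in the same class of some \<open>\<J>\<^sub>k\<close> is at most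
  \<open>n\<^sup>2 \<Sum>\<^sub>k exp (- C2 k + o(k)) = o(n / \<surd>(log n))\<close>, so \<open>A\<^sub>n \<ge> Y - o(n / \<surd>(log n))\<close>. Now let \<open>\<alpha>\<close>
  tend to \<open>1 / C1\<close> and \<open>1 / C2\<close>, respectively.
\<close>

section \<open>Forests\<close>

text \<open>The formulas are proved for forests because removing a root leaves the world of trees: a
  root with m branches turns j trees with n + 1 vertices into j - 1 + m trees with n vertices, so an
  induction on n with j arbitrary closes. The probability q k that the Galton-Watson tree has k
  vertices is of order k^(-3/2); its tail beyond \<open>\<alpha> log n\<close> is of order 1 / sqrt
  (\<alpha> log n), which is where the square roots of C1 and C2 come from. Two obstacles shape the
  proof. Tree sizes may be confined to the residue class 1 modulo the span d of the offspring law,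
  so the local limit theorem and the sums of q are taken on a lattice; d cancels in kappa. And a
  vertex and its descendant are far from independent: the cutoff at sqrt n leaves each subtree at
  most about sqrt n such partners, which is negligible against the square of the mean. Both bounds
  on the number of classes are kept as pointwise inequalities with a nonnegative error variable of
  vanishing mean. Averaging then gives the expectation, Markov's inequality the probability.\<close>

definition tree_size :: "('a, 'm) tree_family_scheme \<Rightarrow> 'a \<Rightarrow> nat" where
  "tree_size \<F> t = vertices (shape \<F> t)"

definition forest_size :: "('a, 'm) tree_family_scheme \<Rightarrow> 'a list \<Rightarrow> nat" where
  "forest_size \<F> f = sum_list (map (tree_size \<F>) f)"

definition forest_weight :: "('a, 'm) tree_family_scheme \<Rightarrow> 'a list \<Rightarrow> real" where
  "forest_weight \<F> f = prod_list (map (weight \<F>) f)"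

definition forests :: "('a, 'm) tree_family_scheme \<Rightarrow> nat \<Rightarrow> nat \<Rightarrow> 'a list set" where
  "forests \<F> j n = {f \<in> lists (members \<F>). length f = j \<and> forest_size \<F> f = n}"

definition wsum :: "('a, 'm) tree_family_scheme \<Rightarrow> nat \<Rightarrow> ('a \<Rightarrow> real) \<Rightarrow> real" where
  "wsum \<F> k h = (\<Sum>t\<in>members_of_size \<F> k. weight \<F> t * h t)"

text \<open>
  The fringe subtrees of a forest with \<open>n\<close> vertices in preorder, with multiplicity. The first
  argument makes the recursion terminate; it has to be the number of vertices.
\<close>

primrec fringe_list :: "('a, 'm) tree_family_scheme \<Rightarrow> nat \<Rightarrow> 'a list \<Rightarrow> 'a list" where
  "fringe_list \<F> 0 f = []"
| "fringe_list \<F> (Suc n) f =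
     (case f of [] \<Rightarrow> [] | t # ts \<Rightarrow> t # fringe_list \<F> n (branches \<F> t @ ts))"

primrec pair_sum :: "('a \<Rightarrow> 'a \<Rightarrow> real) \<Rightarrow> 'a list \<Rightarrow> real" where
  "pair_sum g [] = 0"
| "pair_sum g (x # xs) = (\<Sum>y\<leftarrow>xs. g x y) + pair_sum g xs"

text \<open>The part of \<open>pair_sum g (fringe_list \<F> n f)\<close> that comes from disjoint fringe subtrees.\<close>

primrec disjoint_pair_sum ::
    "('a, 'm) tree_family_scheme \<Rightarrow> ('a \<Rightarrow> 'a \<Rightarrow> real) \<Rightarrow> nat \<Rightarrow> 'a list \<Rightarrow> real" where
  "disjoint_pair_sum \<F> g 0 f = 0"
| "disjoint_pair_sum \<F> g (Suc n) f =
     (case f of [] \<Rightarrow> 0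
      | t # ts \<Rightarrow> (\<Sum>s\<leftarrow>fringe_list \<F> (Suc n - tree_size \<F> t) ts. g t s) +
          disjoint_pair_sum \<F> g n (branches \<F> t @ ts))"

lemma tree_size_pos: "tree_size \<F> t > 0"
  by (cases "shape \<F> t") (auto simp: tree_size_def)

lemma forest_size_simps [simp]:
  "forest_size \<F> [] = 0"
  "forest_size \<F> (t # ts) = tree_size \<F> t + forest_size \<F> ts"
  "forest_size \<F> (ts @ us) = forest_size \<F> ts + forest_size \<F> us"
  by (auto simp: forest_size_def)

lemma forest_weight_simps [simp]:
  "forest_weight \<F> [] = 1"
  "forest_weight \<F> (t # ts) = weight \<F> t * forest_weight \<F> ts"
  "forest_weight \<F> (ts @ us) = forest_weight \<F> ts * forest_weight \<F> us"
  by (auto simp: forest_weight_def)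

lemma length_le_forest_size: "length f \<le> forest_size \<F> f"
proof (induction f)
  case (Cons t f)
  then show ?case using tree_size_pos[of \<F> t] by simp
qed simp

lemma forest_size_eq_0_iff [simp]: "forest_size \<F> f = 0 \<longleftrightarrow> f = []"
  using length_le_forest_size[of f \<F>] by (cases f) auto

lemma forests_0_right: "forests \<F> j 0 = (if j = 0 then {[]} else {})"
  by (auto simp: forests_def)

lemma forests_0_left: "forests \<F> 0 n = (if n = 0 then {[]} else {})"
  by (auto simp: forests_def)

lemma members_of_size_0 [simp]: "members_of_size \<F> 0 = {}"
  using tree_size_pos[of \<F>] by (auto simp: members_of_size_def tree_size_def)

lemma wsum_0 [simp]: "wsum \<F> 0 h = 0"
  by (simp add: wsum_def)

section \<open>Decompositions of sums over weighted forests\<close>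

locale sg_family =
  fixes \<phi> :: "nat \<Rightarrow> real" and \<F> :: "('a, 'm) tree_family_scheme"
  assumes family: "simply_generated \<phi> \<F>"
begin

lemma phi_nonneg: "0 \<le> \<phi> m"
  and finite_members_of_size: "finite (members_of_size \<F> n)"
  and weight_nonneg: "t \<in> members \<F> \<Longrightarrow> 0 \<le> weight \<F> t"
  and branches_members: "t \<in> members \<F> \<Longrightarrow> set (branches \<F> t) \<subseteq> members \<F>"
  and shape_branches: "t \<in> members \<F> \<Longrightarrow> shape \<F> t = PNode (map (shape \<F>) (branches \<F> t))"
  using family by (auto simp: simply_generated_def)

lemma weight_branches:
  "ts \<in> lists (members \<F>) \<Longrightarrow>
     (\<Sum>t | t \<in> members \<F> \<and> branches \<F> t = ts. weight \<F> t) =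
       \<phi> (length ts) * forest_weight \<F> ts"
  using family by (auto simp: simply_generated_def forest_weight_def)

lemma tree_size_branches:
  "t \<in> members \<F> \<Longrightarrow> tree_size \<F> t = Suc (forest_size \<F> (branches \<F> t))"
  by (simp add: tree_size_def[abs_def] forest_size_def shape_branches o_def)

lemma members_of_size_iff: "t \<in> members_of_size \<F> k \<longleftrightarrow> t \<in> members \<F> \<and> tree_size \<F> t = k"
  by (simp add: members_of_size_def tree_size_def)

lemma finite_forests: "finite (forests \<F> j n)"
proof (rule finite_subset)
  show "forests \<F> j n \<subseteq> {f. set f \<subseteq> (\<Union>k\<le>n. members_of_size \<F> k) \<and> length f = j}"
    by (force simp: forests_def members_of_size_iff forest_size_def intro: member_le_sum_list)
  show "finite {f. set f \<subseteq> (\<Union>k\<le>n. members_of_size \<F> k) \<and> length f = j}"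
    by (intro finite_lists_length_eq finite_UN_I finite_members_of_size) auto
qed

text \<open>The variant that keeps the first tree whole, for summands that mark its root;
  \<open>sum_forests_peel\<close> opens this tree instead.\<close>

lemma sum_forests_Suc:
  "(\<Sum>f\<in>forests \<F> (Suc j) n. forest_weight \<F> f * G (hd f) (tl f)) =
   (\<Sum>k\<le>n. \<Sum>t\<in>members_of_size \<F> k.
      weight \<F> t * (\<Sum>ts\<in>forests \<F> j (n - k). forest_weight \<F> ts * G t ts))"
proof -
  define D where "D = (SIGMA k:{..n}. members_of_size \<F> k \<times> forests \<F> j (n - k))"
  have "(\<Sum>f\<in>forests \<F> (Suc j) n. forest_weight \<F> f * G (hd f) (tl f)) =
      (\<Sum>(k, t, ts)\<in>D. weight \<F> t * (forest_weight \<F> ts * G t ts))"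
    by (rule sum.reindex_bij_witness[of _ "\<lambda>(k, t, ts). t # ts"
          "\<lambda>f. (tree_size \<F> (hd f), hd f, tl f)"])
       (auto simp: D_def forests_def members_of_size_iff length_Suc_conv)
  also have "\<dots> = (\<Sum>k\<le>n. \<Sum>(t, ts)\<in>members_of_size \<F> k \<times> forests \<F> j (n - k).
      weight \<F> t * (forest_weight \<F> ts * G t ts))"
    unfolding D_def
    by (subst sum.Sigma[symmetric]) (auto simp: finite_members_of_size finite_forests)
  finally show ?thesis
    by (simp add: sum.cartesian_product[symmetric] sum_distrib_left)
qed

text \<open>Forests with the same number m of first branches and the same forest after removal of
  the root differ only in their first member, and \<open>weight_branches\<close> sums their weights
  to \<open>\<phi> m\<close> times the weight of what remains. More than n branches cannot occur;
  the cutoff M is left free because the coefficient recursions need a larger one.\<close>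

lemma sum_forests_peel:
  assumes "n \<le> M"
  shows "(\<Sum>f\<in>forests \<F> (Suc j) (Suc n). forest_weight \<F> f * G (branches \<F> (hd f) @ tl f)) =
    (\<Sum>m\<le>M. \<phi> m * (\<Sum>f\<in>forests \<F> (j + m) n. forest_weight \<F> f * G f))"
proof -
  define D where "D = (SIGMA m:{..M}. forests \<F> (j + m) n)"
  \<comment> \<open>The concatenated forest does not show where the branches of the removed root
    end, so their number is recorded with it.\<close>
  define \<beta> where "\<beta> f = (length (branches \<F> (hd f)), branches \<F> (hd f) @ tl f)" for f
  have \<beta>: "\<beta> f \<in> D" if f: "f \<in> forests \<F> (Suc j) (Suc n)" for f
  proof -
    obtain t ts where f_eq: "f = t # ts"
      using f by (auto simp: forests_def length_Suc_conv)
    with f have t: "f = t # ts" "t \<in> members \<F>" "ts \<in> lists (members \<F>)" "length ts = j"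
      "tree_size \<F> t + forest_size \<F> ts = Suc n"
      by (auto simp: forests_def)
    have "forest_size \<F> (branches \<F> t) \<le> n"
      using t tree_size_branches[of t] by simp
    then have "length (branches \<F> t) \<le> M"
      using length_le_forest_size[of "branches \<F> t" \<F>] assms by linarith
    then show ?thesis
      using t branches_members[of t] tree_size_branches[of t]
      by (auto simp: D_def \<beta>_def forests_def)
  qed
  have "(\<Sum>f\<in>forests \<F> (Suc j) (Suc n). forest_weight \<F> f * G (branches \<F> (hd f) @ tl f)) =
     (\<Sum>d\<in>D. \<Sum>f | f \<in> forests \<F> (Suc j) (Suc n) \<and> \<beta> f = d.
        forest_weight \<F> f * G (branches \<F> (hd f) @ tl f))"
  proof (rule sum.group[symmetric])
    show "finite D" by (simp add: D_def finite_forests)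
    show "\<beta> ` forests \<F> (Suc j) (Suc n) \<subseteq> D" using \<beta> by blast
  qed (rule finite_forests)
  also have "\<dots> = (\<Sum>(m, f)\<in>D. \<phi> m * (forest_weight \<F> f * G f))"
  proof (rule sum.cong[OF refl])
    fix d assume d: "d \<in> D"
    obtain m f where mf: "d = (m, f)" "f \<in> forests \<F> (j + m) n"
      using d by (auto simp: D_def)
    have len: "length f = j + m" and mem: "f \<in> lists (members \<F>)" and sz: "forest_size \<F> f = n"
      using mf by (auto simp: forests_def)
    have td: "forest_size \<F> (take m f) + forest_size \<F> (drop m f) = n"
      using sz forest_size_simps(3)[of \<F> "take m f" "drop m f"] by simp
    have mem': "take m f \<in> lists (members \<F>)" "drop m f \<in> lists (members \<F>)"
      using mem by (auto dest: in_set_takeD in_set_dropD)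
    have "(\<Sum>f' | f' \<in> forests \<F> (Suc j) (Suc n) \<and> \<beta> f' = d.
        forest_weight \<F> f' * G (branches \<F> (hd f') @ tl f')) =
      (\<Sum>t | t \<in> members \<F> \<and> branches \<F> t = take m f.
        weight \<F> t * (forest_weight \<F> (drop m f) * G f))"
    proof (rule sum.reindex_bij_witness[of _ "\<lambda>t. t # drop m f" hd])
      fix t assume t: "t \<in> {t. t \<in> members \<F> \<and> branches \<F> t = take m f}"
      show "t # drop m f \<in> {f'. f' \<in> forests \<F> (Suc j) (Suc n) \<and> \<beta> f' = d}"
        using t mem' len td tree_size_branches[of t] by (auto simp: forests_def \<beta>_def mf)
    next
      fix f' assume f': "f' \<in> {f'. f' \<in> forests \<F> (Suc j) (Suc n) \<and> \<beta> f' = d}"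
      then obtain t ts where t: "f' = t # ts" "t \<in> members \<F>"
        by (auto simp: forests_def length_Suc_conv)
      with f' have *: "m = length (branches \<F> t)" "f = branches \<F> t @ ts"
        by (auto simp: \<beta>_def mf)
      show "hd f' # drop m f = f'"
        "hd f' \<in> {t. t \<in> members \<F> \<and> branches \<F> t = take m f}"
        "weight \<F> (hd f') * (forest_weight \<F> (drop m f) * G f) =
           forest_weight \<F> f' * G (branches \<F> (hd f') @ tl f')"
        using t * by auto
    qed auto
    also have "\<dots> = (\<Sum>t | t \<in> members \<F> \<and> branches \<F> t = take m f. weight \<F> t) *
        (forest_weight \<F> (drop m f) * G f)"
      by (simp add: sum_distrib_right)
    also have "\<dots> = \<phi> m * (forest_weight \<F> (take m f @ drop m f) * G f)"
      unfolding weight_branches[OF mem'(1)] forest_weight_simps(3) using len by simp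
    finally show "(\<Sum>f' | f' \<in> forests \<F> (Suc j) (Suc n) \<and> \<beta> f' = d.
        forest_weight \<F> f' * G (branches \<F> (hd f') @ tl f')) =
      (case d of (m, f) \<Rightarrow> \<phi> m * (forest_weight \<F> f * G f))"
      by (simp add: mf)
  qed
  also have "\<dots> = (\<Sum>m\<le>M. \<phi> m * (\<Sum>f\<in>forests \<F> (j + m) n. forest_weight \<F> f * G f))"
    unfolding D_def
    by (subst sum.Sigma[symmetric]) (auto simp: finite_forests sum_distrib_left)
  finally show ?thesis .
qed

end

section \<open>Coefficients of powers of the weight generating function\<close>

text \<open>
  The coefficient of \<open>x\<close> to the power \<open>N + a - j\<close> in the \<open>N\<close>-th power of the generating function,
  written such that no truncated subtraction occurs.
\<close>

definition cf :: "(nat \<Rightarrow> real) \<Rightarrow> nat \<Rightarrow> nat \<Rightarrow> nat \<Rightarrow> real" where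
  "cf \<phi> a j N = fps_nth (fps_X ^ j * Abs_fps \<phi> ^ N) (N + a)"

lemma cf_Suc: "cf \<phi> (Suc a) (Suc j) N = cf \<phi> a j N"
  by (simp add: cf_def fps_X_power_mult_nth mult.assoc)

lemma cf_0: "cf \<phi> a j 0 = (if j = a then 1 else 0)"
  by (simp add: cf_def fps_X_power_nth)

lemma fps_nth_weighted_sum:
  fixes G :: "real fps"
  assumes "N \<le> M"
  shows "(\<Sum>m\<le>M. c m * fps_nth (fps_X ^ m * G) N) = fps_nth (Abs_fps c * G) N"
proof -
  have "(\<Sum>m\<le>M. c m * fps_nth (fps_X ^ m * G) N) = (\<Sum>m\<le>N. c m * fps_nth (fps_X ^ m * G) N)"
    by (rule sum.mono_neutral_right) (use assms in \<open>auto simp: fps_X_power_mult_nth\<close>)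
  also have "\<dots> = (\<Sum>m\<le>N. c m * fps_nth G (N - m))"
    by (intro sum.cong) (auto simp: fps_X_power_mult_nth)
  also have "\<dots> = fps_nth (Abs_fps c * G) N"
    by (simp add: fps_mult_nth atLeast0AtMost)
  finally show ?thesis .
qed

text \<open>The operator x d/dx multiplies each coefficient by its index. The subtraction is real,
  so that the case N < j, where both sides vanish, is included.\<close>

lemma fps_nth_X_power_deriv:
  fixes G :: "real fps"
  shows "fps_nth (fps_X ^ j * (fps_X * fps_deriv G)) N = (real N - real j) * fps_nth (fps_X ^ j * G) N"
proof (cases "N \<le> j")
  case True
  then show ?thesis by (cases "N = j") (auto simp: fps_X_power_mult_nth)
next
  case False
  then have "Suc (N - Suc j) = N - j" by simp
  with False show ?thesis by (auto simp: fps_X_power_mult_nth of_nat_diff)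
qed

text \<open>Summing over the offspring of a removed root contributes one more factor of the
  generating function.\<close>

lemma cf_step:
  assumes "N + a \<le> M"
  shows "(\<Sum>m\<le>M. \<phi> m * cf \<phi> a (j + m) N) = cf \<phi> a (Suc j) (Suc N)"
proof -
  have "(\<Sum>m\<le>M. \<phi> m * cf \<phi> a (j + m) N) =
      (\<Sum>m\<le>M. \<phi> m * fps_nth (fps_X ^ m * (fps_X ^ j * Abs_fps \<phi> ^ N)) (N + a))"
    by (simp add: cf_def power_add mult_ac)
  also have "\<dots> = fps_nth (Abs_fps \<phi> * (fps_X ^ j * Abs_fps \<phi> ^ N)) (N + a)"
    by (rule fps_nth_weighted_sum) fact
  also have "Abs_fps \<phi> * (fps_X ^ j * Abs_fps \<phi> ^ N) = fps_X ^ j * Abs_fps \<phi> ^ Suc N"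
    by (simp add: mult_ac)
  finally show ?thesis
    by (simp add: cf_def fps_X_power_mult_nth del: power_Suc)
qed

text \<open>The numbers m * \<phi> m are the coefficients of x Phi', and x Phi' Phi^N is x times the
  derivative of Phi^(N + 1), divided by N + 1. This identity takes the place of the cycle lemma in
  the inductions below.\<close>

lemma cf_step_weighted:
  assumes "N + a \<le> M"
  shows "(\<Sum>m\<le>M. real m * \<phi> m * cf \<phi> a (j + m) N) =
    (real (N + a) - real j) / real (Suc N) * cf \<phi> a (Suc j) (Suc N)"
proof -
  let ?P = "Abs_fps \<phi>"
  have XD: "Abs_fps (\<lambda>m. real m * \<phi> m) = fps_X * fps_deriv ?P"
    by (rule fps_ext) simp
  have "(\<Sum>m\<le>M. real m * \<phi> m * cf \<phi> a (j + m) N) =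
      (\<Sum>m\<le>M. (real m * \<phi> m) * fps_nth (fps_X ^ m * (fps_X ^ j * ?P ^ N)) (N + a))"
    by (simp add: cf_def power_add mult_ac)
  also have "\<dots> = fps_nth (Abs_fps (\<lambda>m. real m * \<phi> m) * (fps_X ^ j * ?P ^ N)) (N + a)"
    by (rule fps_nth_weighted_sum) fact
  also have "Abs_fps (\<lambda>m. real m * \<phi> m) * (fps_X ^ j * ?P ^ N) =
      fps_const (1 / real (Suc N)) * (fps_X ^ j * (fps_X * fps_deriv (?P ^ Suc N)))"
  proof -
    have "fps_const (1 / real (Suc N)) * fps_const (real (Suc N)) = 1"
      by (simp add: fps_const_mult[symmetric] del: of_nat_Suc)
    moreover have "fps_deriv (?P ^ Suc N) = fps_const (real (Suc N)) * fps_deriv ?P * ?P ^ N"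
      using fps_deriv_power[of ?P "Suc N"] by (simp del: power_Suc of_nat_Suc)
    ultimately show ?thesis
      unfolding XD by (simp del: power_Suc of_nat_Suc fps_const_mult add: mult_ac)
  qed
  also have "fps_nth \<dots> (N + a) =
      (real (N + a) - real j) / real (Suc N) * fps_nth (fps_X ^ j * ?P ^ Suc N) (N + a)"
    by (simp only: fps_mult_left_const_nth fps_nth_X_power_deriv) simp
  finally show ?thesis
    by (simp add: cf_def fps_X_power_mult_nth del: power_Suc)
qed

text \<open>The combination that these inductions meet: removing a root leaves j + m trees, and
  every closed formula carries the number of trees as a factor.\<close>

lemma cf_step_affine:
  assumes "N + a \<le> M"
  shows "(\<Sum>m\<le>M. \<phi> m * (real (j + m) * cf \<phi> a (j + m) N)) =
    (real j + (real (N + a) - real j) / real (Suc N)) * cf \<phi> a (Suc j) (Suc N)"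
proof -
  have "(\<Sum>m\<le>M. \<phi> m * (real (j + m) * cf \<phi> a (j + m) N)) =
     real j * (\<Sum>m\<le>M. \<phi> m * cf \<phi> a (j + m) N) + (\<Sum>m\<le>M. real m * \<phi> m * cf \<phi> a (j + m) N)"
    by (simp add: sum_distrib_left sum.distrib[symmetric] algebra_simps)
  then show ?thesis
    unfolding cf_step[OF assms] cf_step_weighted[OF assms] by (simp add: algebra_simps)
qed

section \<open>Counting marked fringe subtrees\<close>

context sg_family
begin

text \<open>The weighted form of the Otter-Dwass formula, with the coefficient of x^(n - j) in
  Phi^n.\<close>

lemma sum_forest_weight:
  "real n * (\<Sum>f\<in>forests \<F> j n. forest_weight \<F> f) = real j * cf \<phi> 0 j n"
proof (induction n arbitrary: j)
  case 0
  then show ?case by (auto simp: cf_0)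
next
  case (Suc n)
  show ?case
  proof (cases j)
    case 0
    then show ?thesis by (simp add: forests_0_left)
  next
    case (Suc i)
    have peel: "(\<Sum>f\<in>forests \<F> (Suc i) (Suc n). forest_weight \<F> f) =
        (\<Sum>m\<le>n. \<phi> m * (\<Sum>f\<in>forests \<F> (i + m) n. forest_weight \<F> f))"
      using sum_forests_peel[where M = n and n = n and j = i and G = "\<lambda>_. 1"] by simp
    \<comment> \<open>The induction hypothesis is multiplied by n and says nothing for n =
      0.\<close>
    show ?thesis
    proof (cases "n = 0")
      case True
      then show ?thesis
        unfolding Suc peel
        by (auto simp: forests_0_right cf_def fps_X_power_mult_nth)
    next
      case False
      have "real n * (\<Sum>f\<in>forests \<F> (Suc i) (Suc n). forest_weight \<F> f) =
          (\<Sum>m\<le>n. \<phi> m * (real n * (\<Sum>f\<in>forests \<F> (i + m) n. forest_weight \<F> f)))"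
        unfolding peel sum_distrib_left by (intro sum.cong) (auto simp: mult_ac)
      also have "\<dots> = (\<Sum>m\<le>n. \<phi> m * (real (i + m) * cf \<phi> 0 (i + m) n))"
        unfolding Suc.IH ..
      also have "\<dots> = (real i + (real n - real i) / real (Suc n)) * cf \<phi> 0 (Suc i) (Suc n)"
        by (subst cf_step_affine) auto
      also have "real i + (real n - real i) / real (Suc n) = real n * real (Suc i) / real (Suc n)"
        by (simp add: field_simps)
      finally show ?thesis
        using False unfolding Suc by (simp add: field_simps del: of_nat_Suc)
    qed
  qed
qed

text \<open>With N = n - k, cutting out the marked subtree leaves N vertices and a hole. In preorder
  this is a word of N degrees and one hole; the hole has N + 1 possible positions, and by the cycle
  lemma a proportion j / (N + 1) of the words codes a forest of j trees. Hence the factor j. The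
  induction asks whether the first root is the marked vertex.\<close>

lemma sum_fringe_list:
  "(\<Sum>f\<in>forests \<F> j n. forest_weight \<F> f * (\<Sum>s\<leftarrow>fringe_list \<F> n f. h s)) =
   (\<Sum>k\<le>n. wsum \<F> k h * (real j * cf \<phi> 1 j (n - k)))"
proof (induction n arbitrary: j)
  case 0
  then show ?case by (auto simp: forests_0_right)
next
  case (Suc n)
  show ?case
  proof (cases j)
    case 0
    then show ?thesis by (simp add: forests_0_left)
  next
    case (Suc i)
    let ?H = "\<lambda>n f. \<Sum>s\<leftarrow>fringe_list \<F> n f. h s"
    let ?M = "Suc n"
    have "(\<Sum>f\<in>forests \<F> (Suc i) (Suc n). forest_weight \<F> f * ?H (Suc n) f) =
        (\<Sum>f\<in>forests \<F> (Suc i) (Suc n). forest_weight \<F> f * h (hd f)) +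
        (\<Sum>f\<in>forests \<F> (Suc i) (Suc n). forest_weight \<F> f * ?H n (branches \<F> (hd f) @ tl f))"
      unfolding sum.distrib[symmetric]
      by (intro sum.cong) (auto simp: forests_def length_Suc_conv algebra_simps)
    also have "(\<Sum>f\<in>forests \<F> (Suc i) (Suc n). forest_weight \<F> f * h (hd f)) =
        (\<Sum>k\<le>Suc n. wsum \<F> k h * (\<Sum>f\<in>forests \<F> i (Suc n - k). forest_weight \<F> f))"
      unfolding sum_forests_Suc[where G = "\<lambda>t ts. h t"]
    proof (intro sum.cong refl)
      fix k
      have "(\<Sum>t\<in>members_of_size \<F> k. weight \<F> t * (\<Sum>ts\<in>forests \<F> i (Suc n - k). forest_weight \<F> ts * h t)) =
          (\<Sum>t\<in>members_of_size \<F> k. weight \<F> t * h t * (\<Sum>ts\<in>forests \<F> i (Suc n - k). forest_weight \<F> ts))"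
        by (simp add: sum_distrib_left mult_ac)
      then show "(\<Sum>t\<in>members_of_size \<F> k. weight \<F> t * (\<Sum>ts\<in>forests \<F> i (Suc n - k). forest_weight \<F> ts * h t)) =
          wsum \<F> k h * (\<Sum>f\<in>forests \<F> i (Suc n - k). forest_weight \<F> f)"
        by (simp add: wsum_def sum_distrib_right)
    qed
    also have "(\<Sum>f\<in>forests \<F> (Suc i) (Suc n). forest_weight \<F> f * ?H n (branches \<F> (hd f) @ tl f)) =
        (\<Sum>m\<le>?M. \<phi> m * (\<Sum>k\<le>n. wsum \<F> k h * (real (i + m) * cf \<phi> 1 (i + m) (n - k))))"
      unfolding sum_forests_peel[OF le_SucI[OF order_refl], where G = "?H n"] Suc.IH ..
    also have "\<dots> = (\<Sum>k\<le>n. wsum \<F> k h *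
        (\<Sum>m\<le>?M. \<phi> m * (real (i + m) * cf \<phi> 1 (i + m) (n - k))))"
      unfolding sum_distrib_left by (subst sum.swap) (simp add: mult_ac)
    also have "\<dots> = (\<Sum>k\<le>n. wsum \<F> k h *
        ((real i + (real (n - k + 1) - real i) / real (Suc (n - k))) * cf \<phi> 1 (Suc i) (Suc (n - k))))"
      by (intro sum.cong refl arg_cong2[of _ _ _ _ "(*)"] cf_step_affine) auto
    finally have *: "(\<Sum>f\<in>forests \<F> (Suc i) (Suc n). forest_weight \<F> f * ?H (Suc n) f) =
       (\<Sum>k\<le>Suc n. wsum \<F> k h * (\<Sum>f\<in>forests \<F> i (Suc n - k). forest_weight \<F> f)) +
       (\<Sum>k\<le>n. wsum \<F> k h *
        ((real i + (real (n - k + 1) - real i) / real (Suc (n - k))) * cf \<phi> 1 (Suc i) (Suc (n - k))))" .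
    \<comment> \<open>If the first root is marked, the other i trees form a forest of their own;
      \<open>cf_Suc\<close> moves its coefficient to the indices of the claim.\<close>
    have **: "(\<Sum>f\<in>forests \<F> i (Suc n - k). forest_weight \<F> f) =
       real i / real (Suc (n - k)) * cf \<phi> 1 (Suc i) (Suc (n - k))" if "k \<le> n" for k
      using sum_forest_weight[of "Suc (n - k)" i] that
      by (simp add: Suc_diff_le cf_Suc[of _ 0, simplified] field_simps del: of_nat_Suc)
    \<comment> \<open>The term \<open>k = Suc n\<close>, where the marked subtree is the whole
      forest, has no counterpart in the peeled sum and must agree with the claim by itself.\<close>
    have "(\<Sum>k\<le>Suc n. wsum \<F> k h * (\<Sum>f\<in>forests \<F> i (Suc n - k). forest_weight \<F> f)) =
       (\<Sum>k\<le>n. wsum \<F> k h * (real i / real (Suc (n - k)) * cf \<phi> 1 (Suc i) (Suc (n - k)))) +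
       wsum \<F> (Suc n) h * (real (Suc i) * cf \<phi> 1 (Suc i) 0)"
      using ** by (simp add: forests_0_right cf_0)
    moreover have "(\<Sum>k\<le>n. wsum \<F> k h * (real i / real (Suc (n - k)) * cf \<phi> 1 (Suc i) (Suc (n - k)))) +
       (\<Sum>k\<le>n. wsum \<F> k h * ((real i + (real (n - k + 1) - real i) / real (Suc (n - k))) *
          cf \<phi> 1 (Suc i) (Suc (n - k)))) =
       (\<Sum>k\<le>n. wsum \<F> k h * (real (Suc i) * cf \<phi> 1 (Suc i) (Suc n - k)))"
    proof -
      have alg: "real i / real (Suc N) + (real i + (real (N + 1) - real i) / real (Suc N)) = real (Suc i)"
        for N by (simp add: diff_divide_distrib del: of_nat_Suc)
      show ?thesis
        unfolding sum.distrib[symmetric] distrib_left[symmetric] distrib_right[symmetric] alg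
        by (intro sum.cong) (auto simp: Suc_diff_le)
    qed
    ultimately show ?thesis
      unfolding Suc * by simp
  qed
qed

text \<open>The same count with two holes: if N vertices are left, there are (N + 2) (N + 1) / 2
  positions for the holes, and the proportion j / (N + 2) leaves the factor j (N + 1) / 2. Either
  the first root is the earlier vertex of the pair, and \<open>sum_fringe_list\<close> counts its
  partner in the other trees, or the root is removed.\<close>

lemma sum_disjoint_pair_sum:
  "(\<Sum>f\<in>forests \<F> j n. forest_weight \<F> f * disjoint_pair_sum \<F> g n f) =
   (\<Sum>k\<le>n. \<Sum>l\<le>n - k. wsum \<F> k (\<lambda>u. wsum \<F> l (g u)) *
      (real j * real (Suc (n - k - l)) / 2 * cf \<phi> 2 j (n - k - l)))"
proof (induction n arbitrary: j)
  case 0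
  then show ?case by (auto simp: forests_0_right)
next
  case (Suc n)
  show ?case
  proof (cases j)
    case 0
    then show ?thesis by (simp add: forests_0_left)
  next
    case (Suc i)
    let ?D = "disjoint_pair_sum \<F> g"
    let ?M = "Suc (Suc n)"
    define W where "W k l = wsum \<F> k (\<lambda>u. wsum \<F> l (g u))" for k l
    have "(\<Sum>f\<in>forests \<F> (Suc i) (Suc n). forest_weight \<F> f * ?D (Suc n) f) =
        (\<Sum>f\<in>forests \<F> (Suc i) (Suc n). forest_weight \<F> f *
           (\<Sum>s\<leftarrow>fringe_list \<F> (Suc n - tree_size \<F> (hd f)) (tl f). g (hd f) s)) +
        (\<Sum>f\<in>forests \<F> (Suc i) (Suc n). forest_weight \<F> f * ?D n (branches \<F> (hd f) @ tl f))"
      unfolding sum.distrib[symmetric]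
      by (intro sum.cong) (auto simp: forests_def length_Suc_conv algebra_simps)
    also have "(\<Sum>f\<in>forests \<F> (Suc i) (Suc n). forest_weight \<F> f *
           (\<Sum>s\<leftarrow>fringe_list \<F> (Suc n - tree_size \<F> (hd f)) (tl f). g (hd f) s)) =
        (\<Sum>k\<le>Suc n. \<Sum>t\<in>members_of_size \<F> k. weight \<F> t *
          (\<Sum>l\<le>Suc n - k. wsum \<F> l (g t) * (real i * cf \<phi> 1 i (Suc n - k - l))))"
      unfolding sum_forests_Suc[where G = "\<lambda>t ts. \<Sum>s\<leftarrow>fringe_list \<F> (Suc n - tree_size \<F> t) ts. g t s"]
      by (intro sum.cong refl) (auto simp: members_of_size_iff sum_fringe_list simp del: One_nat_def)
    also have "\<dots> = (\<Sum>k\<le>Suc n. \<Sum>l\<le>Suc n - k. W k l * (real i * cf \<phi> 1 i (Suc n - k - l)))"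
      unfolding sum_distrib_left W_def wsum_def[of _ _ "\<lambda>u. wsum \<F> _ (g u)"] sum_distrib_right
      by (intro sum.cong refl, subst sum.swap) (simp add: mult_ac)
    also have "(\<Sum>f\<in>forests \<F> (Suc i) (Suc n). forest_weight \<F> f * ?D n (branches \<F> (hd f) @ tl f)) =
        (\<Sum>m\<le>?M. \<phi> m * (\<Sum>k\<le>n. \<Sum>l\<le>n - k. W k l *
          (real (i + m) * real (Suc (n - k - l)) / 2 * cf \<phi> 2 (i + m) (n - k - l))))"
      unfolding W_def
      by (subst sum_forests_peel[where M = ?M and G = "?D n"]) (auto simp: Suc.IH)
    also have "\<dots> = (\<Sum>k\<le>n. \<Sum>l\<le>n - k. W k l * (real (Suc (n - k - l)) / 2 *
        (\<Sum>m\<le>?M. \<phi> m * (real (i + m) * cf \<phi> 2 (i + m) (n - k - l)))))"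
      unfolding sum_distrib_left
      by (subst sum.swap[where A = "{..?M}"], rule sum.cong[OF refl],
          subst sum.swap[where A = "{..?M}"]) (simp add: mult_ac)
    also have "\<dots> = (\<Sum>k\<le>n. \<Sum>l\<le>n - k. W k l * (real (Suc (n - k - l)) / 2 *
        ((real i + (real (n - k - l + 2) - real i) / real (Suc (n - k - l))) *
          cf \<phi> 2 (Suc i) (Suc (n - k - l)))))"
      by (intro sum.cong refl arg_cong2[of _ _ _ _ "(*)"] cf_step_affine) auto
    finally have *: "(\<Sum>f\<in>forests \<F> (Suc i) (Suc n). forest_weight \<F> f * ?D (Suc n) f) =
        (\<Sum>k\<le>Suc n. \<Sum>l\<le>Suc n - k. W k l * (real i * cf \<phi> 1 i (Suc n - k - l))) +
        (\<Sum>k\<le>n. \<Sum>l\<le>n - k. W k l * (real (Suc (n - k - l)) / 2 *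
        ((real i + (real (n - k - l + 2) - real i) / real (Suc (n - k - l))) *
          cf \<phi> 2 (Suc i) (Suc (n - k - l)))))" .
    \<comment> \<open>If the two subtrees use up all vertices, the first root belongs to the pair.
      Such terms do not occur after the removal of a root and are split off.\<close>
    have split: "(\<Sum>k\<le>Suc n. \<Sum>l\<le>Suc n - k. W k l * c (Suc n - k - l)) =
        (\<Sum>k\<le>n. \<Sum>l\<le>n - k. W k l * c (Suc (n - k - l))) +
        (\<Sum>k\<le>Suc n. W k (Suc n - k) * c 0)" for c :: "nat \<Rightarrow> real"
    proof -
      have "(\<Sum>l\<le>Suc n - k. W k l * c (Suc n - k - l)) =
          (\<Sum>l\<le>n - k. W k l * c (Suc (n - k - l))) + W k (Suc n - k) * c 0" if "k \<le> n" for k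
        using that by (simp add: Suc_diff_le)
      then show ?thesis by (simp add: sum.distrib)
    qed
    have c0: "real i * cf \<phi> 1 i 0 = real (Suc i) * real (Suc 0) / 2 * cf \<phi> 2 (Suc i) 0"
      by (simp add: cf_0)
    have "(\<Sum>k\<le>n. \<Sum>l\<le>n - k. W k l * (real i * cf \<phi> 1 i (Suc (n - k - l)))) +
        (\<Sum>k\<le>n. \<Sum>l\<le>n - k. W k l * (real (Suc (n - k - l)) / 2 *
        ((real i + (real (n - k - l + 2) - real i) / real (Suc (n - k - l))) *
          cf \<phi> 2 (Suc i) (Suc (n - k - l))))) =
        (\<Sum>k\<le>n. \<Sum>l\<le>n - k. W k l *
        (real (Suc i) * real (Suc (Suc (n - k - l))) / 2 * cf \<phi> 2 (Suc i) (Suc (n - k - l))))"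
    proof -
      have cf: "cf \<phi> 1 i N = cf \<phi> 2 (Suc i) N" for N
        using cf_Suc[of \<phi> 1 i N] by (simp add: numeral_2_eq_2)
      have alg: "W' * (real i * c) + W' * (real (Suc N) / 2 *
          ((real i + (real (N + 2) - real i) / real (Suc N)) * c)) =
          W' * (real (Suc i) * real (Suc (Suc N)) / 2 * c)" for W' c N
      proof -
        have "real (Suc N) / 2 * (real i + (real (N + 2) - real i) / real (Suc N)) =
            (real (Suc N) * real i + (real (N + 2) - real i)) / 2"
          by (simp add: field_simps)
        then have "real i * c + real (Suc N) / 2 *
            ((real i + (real (N + 2) - real i) / real (Suc N)) * c) =
            (real i + (real (Suc N) * real i + (real (N + 2) - real i)) / 2) * c"
          unfolding mult.assoc[symmetric] by (simp only: distrib_right[symmetric])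
        also have "real i + (real (Suc N) * real i + (real (N + 2) - real i)) / 2 =
            real (Suc i) * real (Suc (Suc N)) / 2"
          by (simp add: field_simps)
        finally show ?thesis by (simp only: distrib_left[symmetric])
      qed
      show ?thesis
        unfolding sum.distrib[symmetric] cf alg ..
    qed
    then show ?thesis
      unfolding Suc * W_def[symmetric] split[of "\<lambda>N. real i * cf \<phi> 1 i N"]
        split[of "\<lambda>N. real (Suc i) * real (Suc N) / 2 * cf \<phi> 2 (Suc i) N"] c0
      by simp
  qed
qed

end

section \<open>A local limit theorem\<close>

text \<open>The probability that n independent copies of \<open>\<xi>\<close> have sum s; as a
  coefficient it compares directly with \<open>cf\<close>.\<close>

definition walk_prob :: "nat pmf \<Rightarrow> nat \<Rightarrow> nat \<Rightarrow> real" where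
  "walk_prob \<xi> n s = fps_nth (Abs_fps (pmf \<xi>) ^ n) s"

text \<open>Since 0 lies in the support of a critical offspring law (\<open>zero_in_set\<close>),
  this is the lattice span; it may exceed 1, as for complete binary trees.\<close>

definition max_span :: "nat pmf \<Rightarrow> nat" where
  "max_span \<xi> = Gcd (set_pmf \<xi>)"

lemma walk_prob_0: "walk_prob \<xi> 0 s = (if s = 0 then 1 else 0)"
  by (simp add: walk_prob_def)

lemma walk_prob_Suc:
  "walk_prob \<xi> (Suc n) s = (\<Sum>m\<le>s. pmf \<xi> m * walk_prob \<xi> n (s - m))"
  by (simp add: walk_prob_def fps_mult_nth atLeast0AtMost)

lemma walk_prob_nonneg: "0 \<le> walk_prob \<xi> n s"
  by (induction n arbitrary: s) (auto simp: walk_prob_0 walk_prob_Suc intro!: sum_nonneg)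

lemma walk_prob_eq_0: "\<not> max_span \<xi> dvd s \<Longrightarrow> walk_prob \<xi> n s = 0"
proof (induction n arbitrary: s)
  case 0
  then show ?case by (cases "s = 0") (auto simp: walk_prob_0)
next
  case (Suc n)
  have "pmf \<xi> m * walk_prob \<xi> n (s - m) = 0" if "m \<le> s" for m
  proof (cases "m \<in> set_pmf \<xi>")
    case True
    then have "max_span \<xi> dvd m" unfolding max_span_def by (rule Gcd_dvd)
    then have "\<not> max_span \<xi> dvd s - m" using Suc.prems that
      by (metis dvd_diffD)
    then show ?thesis using Suc.IH by simp
  qed (simp add: set_pmf_iff)
  then show ?case unfolding walk_prob_Suc by (intro sum.neutral) auto
qed

section \<open>Fourier inversion on the multiples of the span\<close>

lemma sums_pmf_nat:
  fixes f :: "nat \<Rightarrow> 'b :: {banach, second_countable_topology}"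
  assumes "integrable (measure_pmf p) f"
  shows "(\<lambda>m. pmf p m *\<^sub>R f m) sums measure_pmf.expectation p f"
proof -
  have "integrable (count_space UNIV) (\<lambda>m. pmf p m *\<^sub>R f m)"
    using assms unfolding measure_pmf_eq_density by (subst (asm) integrable_density) auto
  then have "(\<lambda>m. pmf p m *\<^sub>R f m) sums integral\<^sup>L (count_space UNIV) (\<lambda>m. pmf p m *\<^sub>R f m)"
    by (rule sums_integral_count_space_nat)
  then show ?thesis
    unfolding measure_pmf_eq_density by (subst integral_density) auto
qed

lemma pmf_nat_sums_1: "pmf p sums (1 :: real)" for p :: "nat pmf"
  using sums_pmf_nat[of p "\<lambda>_. 1 :: real"] by (simp add: measure_pmf.prob_space)

definition pmf_char :: "nat pmf \<Rightarrow> real \<Rightarrow> complex" where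
  "pmf_char \<xi> t = measure_pmf.expectation \<xi> (\<lambda>m. cis (t * real m))"

lemma integrable_cis_pmf: "integrable (measure_pmf p) (\<lambda>m. cis (f m))"
  by (rule measure_pmf.integrable_const_bound[where B = 1]) auto

text \<open>The two parts share one induction because the Cauchy product with one more step needs
  absolute convergence of the series for n steps.\<close>

lemma sums_walk_prob:
  "summable (walk_prob \<xi> n) \<and>
   (\<lambda>s. of_real (walk_prob \<xi> n s) * cis (t * real s)) sums (pmf_char \<xi> t ^ n)"
proof (induction n)
  case 0
  have "(\<lambda>s. of_real (walk_prob \<xi> 0 s) * cis (t * real s)) = (\<lambda>s. if s = 0 then 1 else 0)"
    "walk_prob \<xi> 0 = (\<lambda>s. if s = 0 then 1 else 0)"
    by (auto simp: walk_prob_0)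
  then show ?case using sums_single[of 0 "\<lambda>_. 1 :: complex"] sums_single[of 0 "\<lambda>_. 1 :: real"]
    by (auto simp: sums_iff)
next
  case (Suc n)
  let ?a = "\<lambda>m. of_real (pmf \<xi> m) * cis (t * real m)"
  let ?b = "\<lambda>s. of_real (walk_prob \<xi> n s) * cis (t * real s)"
  have a: "summable (\<lambda>m. norm (?a m))" and a': "summable (\<lambda>m. norm (pmf \<xi> m))"
    using pmf_nat_sums_1[of \<xi>] by (auto simp: norm_mult sums_iff)
  have b: "summable (\<lambda>m. norm (?b m))" and b': "summable (\<lambda>m. norm (walk_prob \<xi> n m))"
    using Suc by (auto simp: norm_mult walk_prob_nonneg)
  have "summable (walk_prob \<xi> (Suc n))"
    using summable_Cauchy_product[OF a' b'] by (simp add: walk_prob_Suc[abs_def])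
  moreover have "(\<lambda>s. \<Sum>i\<le>s. ?a i * ?b (s - i)) sums ((\<Sum>m. ?a m) * (\<Sum>s. ?b s))"
    by (rule Cauchy_product_sums[OF a b])
  moreover have "(\<Sum>i\<le>s. ?a i * ?b (s - i)) =
      of_real (walk_prob \<xi> (Suc n) s) * cis (t * real s)" for s
  proof -
    have "?a i * ?b (s - i) = of_real (pmf \<xi> i * walk_prob \<xi> n (s - i)) * cis (t * real s)"
      if "i \<le> s" for i
    proof -
      have "t * real s = t * real i + t * real (s - i)"
        using that by (simp add: of_nat_diff algebra_simps)
      then have *: "cis (t * real s) = cis (t * real i) * cis (t * real (s - i))"
        by (simp only: cis_mult)
      show ?thesis unfolding * of_real_mult by (simp only: mult_ac)
    qed
    then have "(\<Sum>i\<le>s. ?a i * ?b (s - i)) =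
        (\<Sum>i\<le>s. of_real (pmf \<xi> i * walk_prob \<xi> n (s - i)) * cis (t * real s))"
      by (intro sum.cong) auto
    then show ?thesis by (simp add: walk_prob_Suc sum_distrib_right)
  qed
  moreover have "(\<Sum>m. ?a m) = pmf_char \<xi> t"
    using sums_pmf_nat[OF integrable_cis_pmf, of \<xi> "\<lambda>m. t * real m"]
    by (simp add: pmf_char_def sums_iff scaleR_conv_of_real)
  moreover have "(\<Sum>s. ?b s) = pmf_char \<xi> t ^ n"
    using Suc by (simp add: sums_iff)
  ultimately show ?case by simp
qed

text \<open>The antiderivative takes equal values at both ends, as c * pi / d is a multiple of
  pi.\<close>

lemma integral_cis_eq_0:
  assumes "d > 0" "int d dvd c" "c \<noteq> 0"
  shows "(\<integral>t. indicator {- (pi / d)..pi / d} t *\<^sub>R cis (t * of_int c) \<partial>lborel) = 0"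
proof -
  obtain k where k: "c = int d * k" using assms by blast
  define F where "F t = Complex (sin (t * of_int c) / of_int c) (- cos (t * of_int c) / of_int c)" for t :: real
  have "(F has_vector_derivative cis (x * of_int c)) (at x within A)" for x A
    unfolding F_def has_vector_derivative_complex_iff
    using assms(3) by (auto intro!: derivative_eq_intros)
  then have "(\<integral>t. indicator {- (pi / d)..pi / d} t *\<^sub>R cis (t * of_int c) \<partial>lborel) =
      F (pi / d) - F (- (pi / d))"
    using assms(1) by (intro integral_FTC_Icc) (auto intro!: continuous_intros)
  also have "\<dots> = 0"
  proof -
    have "pi / d * of_int c = of_int k * pi"
      using assms(1) k by simp
    moreover have "sin (of_int k * pi) = 0" by (auto simp: sin_zero_iff_int2)
    ultimately show ?thesis by (simp add: F_def complex_eq_iff)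
  qed
  finally show ?thesis .
qed

text \<open>The walk stays on multiples of d, so its characteristic function has period 2 pi / d and
  one period suffices. A longer interval would contain further points at which the modulus is 1,
  which would spoil the Gaussian bound.\<close>

lemma walk_prob_inversion:
  assumes d: "d = max_span \<xi>" "d > 0" and s: "d dvd s"
  shows "(\<integral>t. indicator {- (pi / d)..pi / d} t *\<^sub>R (pmf_char \<xi> t ^ n * cis (- t * real s)) \<partial>lborel) =
      2 * pi / d * walk_prob \<xi> n s"
proof -
  let ?I = "{- (pi / d)..pi / d}"
  define f where "f m t = indicator ?I t *\<^sub>R
    (of_real (walk_prob \<xi> n m) * cis (t * real m) * cis (- t * real s))" for m t
  have f_eq: "f m t = of_real (walk_prob \<xi> n m) *
      (indicator ?I t *\<^sub>R cis (t * of_int (int m - int s)))" for m t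
    unfolding f_def by (simp add: cis_mult algebra_simps)
  have int: "integrable lborel (\<lambda>t. indicator ?I t *\<^sub>R cis (t * of_int (int m - int s)))" for m
  proof -
    have "set_integrable lborel ?I (\<lambda>t. cis (t * of_int (int m - int s)))"
      by (intro borel_integrable_atLeastAtMost' continuous_intros)
    then show ?thesis by (simp only: set_integrable_def)
  qed
  have norm: "norm (f m t) = walk_prob \<xi> n m * indicator ?I t" for m t
    by (simp add: f_def norm_mult walk_prob_nonneg)
  have summ: "summable (walk_prob \<xi> n)"
    using sums_walk_prob[of \<xi> n] by blast
  have "(\<integral>t. (\<Sum>m. f m t) \<partial>lborel) = (\<Sum>m. \<integral>t. f m t \<partial>lborel)"
  proof (rule integral_suminf)
    show "integrable lborel (f m)" for m
      unfolding f_eq by (rule integrable_mult_right[OF int])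
    show "AE t in lborel. summable (\<lambda>m. norm (f m t))"
      unfolding norm using summ by (auto intro: summable_mult2)
    show "summable (\<lambda>m. \<integral>t. norm (f m t) \<partial>lborel)"
      unfolding norm using summ by (auto intro: summable_mult2)
  qed
  moreover have int_f: "(\<integral>t. f m t \<partial>lborel) = (if m = s then of_real (2 * pi / d * walk_prob \<xi> n s) else 0)" for m
  proof (cases "m = s")
    case True
    have "(\<integral>t. f s t \<partial>lborel) = (\<integral>t. of_real (walk_prob \<xi> n s * indicator ?I t) \<partial>lborel)"
      by (intro Bochner_Integration.integral_cong) (simp_all add: f_eq scaleR_conv_of_real)
    also have "\<dots> = of_real (\<integral>t. walk_prob \<xi> n s * indicator ?I t \<partial>lborel)"
      by (rule integral_complex_of_real)
    finally show ?thesis using d True by (simp add: mult_ac)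
  next
    case False
    show ?thesis
    proof (cases "d dvd m")
      case True
      then have "int d dvd int m - int s" using s by (auto intro: dvd_diff)
      then have "(\<integral>t. indicator ?I t *\<^sub>R cis (t * of_int (int m - int s)) \<partial>lborel) = 0"
        using False by (intro integral_cis_eq_0[OF d(2)]) auto
      then show ?thesis
        unfolding f_eq integral_mult_right_zero using False by simp
    next
      case False
      then show ?thesis using s d by (auto simp: f_eq walk_prob_eq_0)
    qed
  qed
  moreover have "(\<lambda>t. \<Sum>m. f m t) = (\<lambda>t. indicator ?I t *\<^sub>R (pmf_char \<xi> t ^ n * cis (- t * real s)))"
  proof
    fix t
    have "(\<lambda>m. f m t) sums (indicator ?I t *\<^sub>R (pmf_char \<xi> t ^ n * cis (- t * real s)))"
      unfolding f_def using sums_walk_prob[of \<xi> n t]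
      by (intro sums_scaleR_right sums_mult2) auto
    then show "(\<Sum>m. f m t) = indicator ?I t *\<^sub>R (pmf_char \<xi> t ^ n * cis (- t * real s))"
      by (simp add: sums_iff)
  qed
  moreover have "(\<Sum>m. if m = s then complex_of_real (2 * pi / d * walk_prob \<xi> n s) else 0) =
      of_real (2 * pi / d * walk_prob \<xi> n s)"
    using sums_single[of s "\<lambda>_. complex_of_real (2 * pi / d * walk_prob \<xi> n s)"]
    by (simp add: sums_iff)
  ultimately show ?thesis by (simp only: int_f)
qed

text \<open>One positive element of the support makes t / (2 pi) rational. If it is a / b in lowest
  terms, b divides every element of the support and hence their greatest common divisor.\<close>

lemma max_span_dvd_of_cis_eq_1:
  assumes t: "\<And>m. m \<in> set_pmf \<xi> \<Longrightarrow> cis (t * real m) = 1"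
    and pos: "\<exists>m\<in>set_pmf \<xi>. m > 0"
  shows "\<exists>k::int. t * real (max_span \<xi>) = 2 * pi * of_int k"
proof -
  have k: "\<exists>k::int. t / (2 * pi) * real m = of_int k" if m: "m \<in> set_pmf \<xi>" for m
  proof -
    have "cos (t * real m) = 1"
      using t[OF m] by (simp add: complex_eq_iff)
    then obtain k :: int where "t * real m = of_int k * 2 * pi"
      using cos_one_2pi_int by auto
    then show ?thesis by (auto simp: field_simps)
  qed
  obtain m0 where m0: "m0 \<in> set_pmf \<xi>" "m0 > 0" using pos by blast
  from k[OF m0(1)] obtain k0 :: int where k0: "t / (2 * pi) * real m0 = of_int k0" by blast
  have "t / (2 * pi) = of_int k0 / real m0"
    using k0 m0 by (simp add: field_simps)
  then have "t / (2 * pi) \<in> \<rat>" by simp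
  then obtain a b :: int where ab: "t / (2 * pi) = of_int a / of_int b" "b > 0" "coprime a b"
    by (rule Rats_cases')
  have "nat b dvd m" if m: "m \<in> set_pmf \<xi>" for m
  proof -
    obtain k :: int where "t / (2 * pi) * real m = of_int k" using k[OF m] by blast
    then have "real_of_int a / of_int b * real m = of_int k"
      unfolding ab(1) .
    then have "real_of_int (a * int m) = real_of_int (k * b)"
      using ab(2) by (simp add: field_simps)
    then have "a * int m = k * b" by (simp only: of_int_eq_iff)
    then have "b dvd a * int m" by simp
    then have "b dvd int m" using ab(3)
      by (simp add: coprime_commute coprime_dvd_mult_right_iff)
    then show ?thesis using ab(2) by (simp add: nat_dvd_iff)
  qed
  then have "nat b dvd max_span \<xi>" by (auto simp: max_span_def intro: Gcd_greatest)
  then obtain c where c: "max_span \<xi> = nat b * c" by blast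
  have "t * real (max_span \<xi>) = 2 * pi * (t / (2 * pi)) * (of_int b * real c)"
    using ab(2) c by simp
  also have "\<dots> = 2 * pi * of_int (a * int c)"
    unfolding ab(1) using ab(2) by simp
  finally show ?thesis by blast
qed

section \<open>Characteristic function of a critical offspring law and the local limit
  theorem\<close>

locale critical_offspring =
  fixes \<xi> :: "nat pmf" and \<sigma>2 :: real
  assumes mean: "measure_pmf.expectation \<xi> real = 1"
    and square_integrable: "integrable (measure_pmf \<xi>) (\<lambda>m. (real m)\<^sup>2)"
    and variance: "measure_pmf.variance \<xi> real = \<sigma>2"
    and variance_pos: "\<sigma>2 > 0"
begin

lemma integrable_real: "integrable (measure_pmf \<xi>) real"
  by (rule measure_pmf.square_integrable_imp_integrable[OF _ square_integrable]) simp

lemma zero_in_set: "0 \<in> set_pmf \<xi>"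
proof (rule ccontr)
  assume 0: "0 \<notin> set_pmf \<xi>"
  have "AE m in measure_pmf \<xi>. real m - 1 = 0"
  proof (subst integral_nonneg_eq_0_iff_AE[symmetric])
    show "AE m in measure_pmf \<xi>. 0 \<le> real m - 1"
      using 0 by (auto simp: AE_measure_pmf_iff) (metis Suc_leI gr0I)
    show "integral\<^sup>L (measure_pmf \<xi>) (\<lambda>m. real m - 1) = 0"
      using integrable_real mean by (simp add: measure_pmf.prob_space)
  qed (use integrable_real in auto)
  then have "measure_pmf.expectation \<xi> (\<lambda>m. (real m - 1)\<^sup>2) = measure_pmf.expectation \<xi> (\<lambda>m. 0)"
    by (intro integral_cong_AE) auto
  then show False using variance variance_pos mean by simp
qed

lemma ex_pos_in_set: "\<exists>m\<in>set_pmf \<xi>. m > 0"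
proof (rule ccontr)
  assume "\<not> ?thesis"
  then have "measure_pmf.expectation \<xi> real = measure_pmf.expectation \<xi> (\<lambda>_. 0)"
    by (intro integral_cong_AE) (auto simp: AE_measure_pmf_iff)
  then show False using mean by simp
qed

abbreviation "d \<equiv> max_span \<xi>"

lemma span_pos: "d > 0"
  using ex_pos_in_set by (auto simp: max_span_def intro!: Nat.gr0I)

definition centred_char :: "real \<Rightarrow> complex" where
  "centred_char t = char (distr (measure_pmf \<xi>) borel (\<lambda>m. real m - 1)) t"

lemma real_distribution_centred: "real_distribution (distr (measure_pmf \<xi>) borel (\<lambda>m. real m - 1))"
  by (rule prob_space.real_distribution_distr[OF prob_space_measure_pmf]) simp

lemma centred_char_eq: "centred_char t = pmf_char \<xi> t * cis (- t)"
proof -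
  have "centred_char t = measure_pmf.expectation \<xi> (\<lambda>m. cis (t * (real m - 1)))"
    unfolding centred_char_def char_def cis_conv_exp by (subst integral_distr) auto
  also have "(\<lambda>m. cis (t * (real m - 1))) = (\<lambda>m. cis (t * real m) * cis (- t))"
    by (simp add: cis_mult algebra_simps)
  finally show ?thesis by (simp add: pmf_char_def)
qed

lemma norm_centred_char_le_1: "norm (centred_char t) \<le> 1"
  unfolding centred_char_def by (rule real_distribution.cmod_char_le_1[OF real_distribution_centred])

lemma continuous_centred_char: "continuous_on A centred_char"
  unfolding centred_char_def
  by (rule continuous_at_imp_continuous_on) (auto intro: real_distribution.isCont_char[OF real_distribution_centred])

lemma measurable_centred_char [measurable]: "centred_char \<in> borel_measurable borel"
  by (rule borel_measurable_continuous_onI) (rule continuous_centred_char)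

text \<open>Bounds the remainder of the second-order Taylor expansion, divided by t^2. The minimum
  keeps it finite under a second moment alone and lets dominated convergence show that it vanishes
  as t tends to 0.\<close>

definition err :: "real \<Rightarrow> real" where
  "err t = measure_pmf.expectation \<xi> (\<lambda>m. min (6 * (real m - 1)\<^sup>2) (\<bar>t\<bar> * \<bar>real m - 1\<bar> ^ 3)) / 6"

lemma square_integrable': "integrable (measure_pmf \<xi>) (\<lambda>m. (real m - 1)\<^sup>2)"
  using square_integrable integrable_real by (simp add: power2_diff)

lemma centred_char_approx: "norm (centred_char t - (1 - t\<^sup>2 * \<sigma>2 / 2)) \<le> t\<^sup>2 * err t"
proof -
  have "norm (centred_char t - (1 - t\<^sup>2 * \<sigma>2 / 2)) \<le> (t\<^sup>2 / 6) *
      measure_pmf.expectation \<xi> (\<lambda>m. min (6 * (real m - 1)\<^sup>2) (\<bar>t\<bar> * \<bar>real m - 1\<bar> ^ 3))"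
    unfolding centred_char_def
  proof (rule prob_space.char_approx3'[OF prob_space_measure_pmf])
    show mean0: "measure_pmf.expectation \<xi> (\<lambda>m. real m - 1) = 0"
      using integrable_real mean by (simp add: measure_pmf.prob_space)
    show "measure_pmf.variance \<xi> (\<lambda>m. real m - 1) = \<sigma>2"
      unfolding mean0 using variance mean by simp
  qed (use integrable_real square_integrable' in simp_all)
  then show ?thesis by (simp add: err_def)
qed

lemma err_tendsto_0:
  assumes "t \<longlonglongrightarrow> 0"
  shows "(\<lambda>n. err (t n)) \<longlonglongrightarrow> 0"
proof -
  have "(\<lambda>n. min (6 * (real m - 1)\<^sup>2) (\<bar>t n\<bar> * \<bar>real m - 1\<bar> ^ 3)) \<longlonglongrightarrow> 0" for m
  proof -
    have "(\<lambda>n. min (6 * (real m - 1)\<^sup>2) (\<bar>t n\<bar> * \<bar>real m - 1\<bar> ^ 3)) \<longlonglongrightarrow> min (6 * (real m - 1)\<^sup>2) (\<bar>0\<bar> * \<bar>real m - 1\<bar> ^ 3)"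
      by (intro tendsto_intros assms)
    then show ?thesis by (simp add: min_absorb2)
  qed
  then have "(\<lambda>n. measure_pmf.expectation \<xi> (\<lambda>m. min (6 * (real m - 1)\<^sup>2) (\<bar>t n\<bar> * \<bar>real m - 1\<bar> ^ 3)))
      \<longlonglongrightarrow> measure_pmf.expectation \<xi> (\<lambda>m. 0)"
    by (intro integral_dominated_convergence[where w = "\<lambda>m. 6 * (real m - 1)\<^sup>2"])
       (auto intro!: square_integrable' integrable_mult_right simp: min_le_iff_disj)
  then have "(\<lambda>n. measure_pmf.expectation \<xi> (\<lambda>m. min (6 * (real m - 1)\<^sup>2) (\<bar>t n\<bar> * \<bar>real m - 1\<bar> ^ 3)) / 6)
      \<longlonglongrightarrow> 0 / 6"
    by (intro tendsto_divide) auto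
  then show ?thesis by (simp add: err_def[abs_def])
qed

text \<open>The central limit theorem on the level of characteristic functions: on the unit disc
  n-th powers differ by at most n times the difference of the bases, so the power may be compared
  with (1 - \<sigma>2 u^2 / (2 n))^n.\<close>

lemma centred_char_power_tendsto:
  "(\<lambda>n. centred_char (u / sqrt n) ^ n) \<longlonglongrightarrow> of_real (exp (- (\<sigma>2 * u\<^sup>2 / 2)))"
proof -
  define w where "w n = complex_of_real (1 + (- (\<sigma>2 * u\<^sup>2 / 2)) / real n)" for n
  have lim0: "(\<lambda>n. u / sqrt (real n)) \<longlonglongrightarrow> 0"
    by real_asymp
  have bound: "\<forall>\<^sub>F n in sequentially. norm (centred_char (u / sqrt n) ^ n - w n ^ n) \<le> u\<^sup>2 * err (u / sqrt n)"
  proof (rule eventually_sequentiallyI)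
    fix n :: nat
    \<comment> \<open>For these n the real number \<open>w n\<close> lies between 0 and 1, hence in
      the unit disc.\<close>
    assume n: "n \<ge> nat \<lceil>\<sigma>2 * u\<^sup>2 / 2\<rceil> + 1"
    then have n1: "n > 0" and n2: "\<sigma>2 * u\<^sup>2 / 2 \<le> real n" by linarith+
    have nn: "n * (u / sqrt n)\<^sup>2 = u\<^sup>2" using n1 by (simp add: power_divide)
    have w: "w n = 1 - (u / sqrt n)\<^sup>2 * \<sigma>2 / 2"
      using n1 by (simp add: w_def power_divide mult_ac)
    have "norm (w n) \<le> 1"
    proof -
      have "0 \<le> \<sigma>2 * u\<^sup>2 / 2 / real n" "\<sigma>2 * u\<^sup>2 / 2 / real n \<le> 1"
        using n1 n2 variance_pos by (auto simp: divide_le_eq)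
      then show ?thesis unfolding w_def norm_of_real by (simp add: abs_le_iff)
    qed
    then have "norm (centred_char (u / sqrt n) ^ n - w n ^ n) \<le> n * norm (centred_char (u / sqrt n) - w n)"
      by (intro norm_power_diff norm_centred_char_le_1)
    also have "\<dots> \<le> n * ((u / sqrt n)\<^sup>2 * err (u / sqrt n))"
      unfolding w using centred_char_approx[of "u / sqrt n"] by (intro mult_left_mono) auto
    also have "\<dots> = u\<^sup>2 * err (u / sqrt n)"
      using nn by (simp only: mult.assoc[symmetric])
    finally show "norm (centred_char (u / sqrt n) ^ n - w n ^ n) \<le> u\<^sup>2 * err (u / sqrt n)" .
  qed
  have "(\<lambda>n. u\<^sup>2 * err (u / sqrt n)) \<longlonglongrightarrow> u\<^sup>2 * 0"
    by (intro tendsto_intros err_tendsto_0 lim0)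
  then have "(\<lambda>n. centred_char (u / sqrt n) ^ n - w n ^ n) \<longlonglongrightarrow> 0"
    by (intro Lim_null_comparison[OF bound]) auto
  moreover have "(\<lambda>n. w n ^ n) \<longlonglongrightarrow> of_real (exp (- (\<sigma>2 * u\<^sup>2 / 2)))"
    unfolding w_def of_real_power[symmetric]
    by (intro tendsto_of_real tendsto_exp_limit_sequentially)
  ultimately show ?thesis
    by (rule Lim_transform[rotated])
qed

text \<open>Modulus 1 is equality in the triangle inequality: \<open>cis (t * m)\<close> is then
  constant on the support, with value 1 because 0 belongs to the support. So t * d is a multiple of
  2 pi, which is impossible for 0 < |t| \<le> pi / d.\<close>

lemma norm_centred_char_less_1:
  assumes "t \<noteq> 0" "\<bar>t\<bar> \<le> pi / d"
  shows "norm (centred_char t) < 1"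
proof (rule ccontr)
  assume "\<not> ?thesis"
  then have 1: "norm (pmf_char \<xi> t) = 1"
    using norm_centred_char_le_1[of t] by (simp add: centred_char_eq norm_mult)
  let ?z = "pmf_char \<xi> t"
  have zz: "cnj ?z * ?z = 1"
    using 1 by (simp add: complex_norm_square[symmetric] mult.commute[of "cnj _"])
  have int: "integrable (measure_pmf \<xi>) (\<lambda>m. cnj ?z * cis (t * real m))"
    by (intro integrable_mult_right integrable_cis_pmf)
  have E: "measure_pmf.expectation \<xi> (\<lambda>m. Re (cnj ?z * cis (t * real m))) = 1"
    using zz int by (subst integral_Re) (auto simp: pmf_char_def[symmetric])
  have le: "Re (cnj ?z * cis (t * real m)) \<le> 1" for m
    using complex_Re_le_cmod[of "cnj ?z * cis (t * real m)"] 1 by (simp add: norm_mult)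
  have "AE m in measure_pmf \<xi>. 1 - Re (cnj ?z * cis (t * real m)) = 0"
  proof (subst integral_nonneg_eq_0_iff_AE[symmetric])
    show "AE m in measure_pmf \<xi>. 0 \<le> 1 - Re (cnj ?z * cis (t * real m))"
      using le by simp
    show "integral\<^sup>L (measure_pmf \<xi>) (\<lambda>m. 1 - Re (cnj ?z * cis (t * real m))) = 0"
      using E integrable_Re[OF int]
      by (subst Bochner_Integration.integral_diff) (auto simp: measure_pmf.prob_space)
  qed (use integrable_Re[OF int] in auto)
  then have Re1: "Re (cnj ?z * cis (t * real m)) = 1" if "m \<in> set_pmf \<xi>" for m
    using that by (auto simp: AE_measure_pmf_iff)
  have eq: "cis (t * real m) = ?z" if "m \<in> set_pmf \<xi>" for m
  proof -
    have n1: "norm (cnj ?z * cis (t * real m)) = 1" using 1 by (simp add: norm_mult)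
    then have "(Re (cnj ?z * cis (t * real m)))\<^sup>2 + (Im (cnj ?z * cis (t * real m)))\<^sup>2 = 1"
      by (metis cmod_power2 one_power2)
    then have "cnj ?z * cis (t * real m) = 1"
      using Re1[OF that] by (auto simp: complex_eq_iff)
    then have "?z * (cnj ?z * cis (t * real m)) = ?z" by simp
    then have "(cnj ?z * ?z) * cis (t * real m) = ?z" by (simp only: mult_ac)
    then show ?thesis unfolding zz by simp
  qed
  have "?z = 1" using eq[OF zero_in_set] by simp
  with eq have "cis (t * real m) = 1" if "m \<in> set_pmf \<xi>" for m using that by auto
  from max_span_dvd_of_cis_eq_1[OF this ex_pos_in_set]
  obtain k :: int where k: "t * real d = 2 * pi * of_int k" by auto
  have "k \<noteq> 0" using k assms(1) span_pos by auto
  then have "1 \<le> \<bar>real_of_int k\<bar>" by linarith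
  then have "2 * pi \<le> \<bar>2 * pi * of_int k\<bar>" by (simp add: abs_mult)
  also have "\<dots> = \<bar>t\<bar> * real d" unfolding k[symmetric] by (simp add: abs_mult)
  also have "\<dots> \<le> pi" using assms(2) span_pos by (simp add: field_simps)
  finally show False using pi_gt_zero by linarith
qed

text \<open>Near 0 this follows from the Taylor expansion; on the compact rest of the interval the
  modulus stays away from 1. The bound supplies the dominating function in the local limit
  theorem.\<close>

lemma centred_char_gaussian_bound:
  "\<exists>c>0. \<forall>t. \<bar>t\<bar> \<le> pi / d \<longrightarrow> norm (centred_char t) \<le> exp (- c * t\<^sup>2)"
proof -
  have "\<exists>\<delta>>0. \<forall>t. \<bar>t\<bar> < \<delta> \<longrightarrow> err t < \<sigma>2 / 4 \<and> t\<^sup>2 * \<sigma>2 / 2 < 1"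
  proof -
    have "(err \<longlongrightarrow> 0) (at 0)"
      by (subst tendsto_at_iff_sequentially) (auto simp: o_def intro!: err_tendsto_0)
    then have "\<forall>\<^sub>F t in at 0. err t < \<sigma>2 / 4"
      by (rule order_tendstoD) (use variance_pos in auto)
    moreover have "((\<lambda>t. t\<^sup>2 * \<sigma>2 / 2) \<longlongrightarrow> 0\<^sup>2 * \<sigma>2 / 2) (at (0 :: real))"
      by (intro tendsto_intros) simp
    then have "\<forall>\<^sub>F t in at (0 :: real). t\<^sup>2 * \<sigma>2 / 2 < 1"
      by (rule order_tendstoD) auto
    ultimately have "\<forall>\<^sub>F t in at 0. err t < \<sigma>2 / 4 \<and> t\<^sup>2 * \<sigma>2 / 2 < 1"
      by eventually_elim auto
    then obtain \<delta> where "\<delta> > 0" "\<And>t. t \<noteq> 0 \<Longrightarrow> \<bar>t\<bar> < \<delta> \<Longrightarrow> err t < \<sigma>2 / 4 \<and> t\<^sup>2 * \<sigma>2 / 2 < 1"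
      by (auto simp: eventually_at dist_real_def)
    moreover have "err 0 = 0" by (simp add: err_def min_absorb2)
    ultimately have "err t < \<sigma>2 / 4 \<and> t\<^sup>2 * \<sigma>2 / 2 < 1" if "\<bar>t\<bar> < \<delta>" for t
      using variance_pos that by (cases "t = 0") auto
    then show ?thesis using \<open>\<delta> > 0\<close> by blast
  qed
  then obtain \<delta> where \<delta>: "\<delta> > 0" "\<And>t. \<bar>t\<bar> < \<delta> \<Longrightarrow> err t < \<sigma>2 / 4" "\<And>t. \<bar>t\<bar> < \<delta> \<Longrightarrow> t\<^sup>2 * \<sigma>2 / 2 < 1"
    by blast
  have near: "norm (centred_char t) \<le> exp (- (\<sigma>2 / 4) * t\<^sup>2)" if t: "\<bar>t\<bar> < \<delta>" for t
  proof -
    have "norm (centred_char t) \<le> norm (of_real (1 - t\<^sup>2 * \<sigma>2 / 2) :: complex) + t\<^sup>2 * err t"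
      using centred_char_approx[of t] norm_triangle_sub[of "centred_char t" "of_real (1 - t\<^sup>2 * \<sigma>2 / 2)"]
      by simp
    also have "norm (of_real (1 - t\<^sup>2 * \<sigma>2 / 2) :: complex) = 1 - t\<^sup>2 * \<sigma>2 / 2"
      unfolding norm_of_real using \<delta>(3)[OF t] by simp
    also have "t\<^sup>2 * err t \<le> t\<^sup>2 * (\<sigma>2 / 4)"
      using \<delta>(2)[OF t] by (intro mult_left_mono) auto
    finally have "norm (centred_char t) \<le> 1 + (- (\<sigma>2 / 4) * t\<^sup>2)" by (simp add: field_simps)
    also have "\<dots> \<le> exp (- (\<sigma>2 / 4) * t\<^sup>2)" by (rule exp_ge_add_one_self)
    finally show ?thesis .
  qed
  define K where "K = {t. \<delta> \<le> \<bar>t\<bar> \<and> \<bar>t\<bar> \<le> pi / d}"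
  have "compact K"
  proof -
    have "K = {t. \<delta> \<le> \<bar>t\<bar>} \<inter> {- (pi / d)..pi / d}" by (auto simp: K_def)
    moreover have "closed {t::real. \<delta> \<le> \<bar>t\<bar>}" by (intro closed_Collect_le continuous_intros)
    ultimately show ?thesis by (simp add: closed_Int_compact)
  qed
  have "\<exists>\<rho><1. 0 < \<rho> \<and> (\<forall>t\<in>K. norm (centred_char t) \<le> \<rho>)"
  proof (cases "K = {}")
    case True
    then show ?thesis by (intro exI[of _ "1/2"]) auto
  next
    case False
    obtain t0 where t0: "t0 \<in> K" "\<And>t. t \<in> K \<Longrightarrow> norm (centred_char t) \<le> norm (centred_char t0)"
      using continuous_attains_sup[OF \<open>compact K\<close> False, of "\<lambda>t. norm (centred_char t)"]
      by (auto intro: continuous_on_norm continuous_centred_char)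
    have "norm (centred_char t0) < 1"
      using t0(1) \<delta>(1) by (intro norm_centred_char_less_1) (auto simp: K_def)
    then show ?thesis
      using t0(2) by (intro exI[of _ "max (1/2) (norm (centred_char t0))"]) (auto simp: le_max_iff_disj)
  qed
  then obtain \<rho> where \<rho>: "\<rho> < 1" "0 < \<rho>" "\<And>t. t \<in> K \<Longrightarrow> norm (centred_char t) \<le> \<rho>" by blast
  define b where "b = (pi / d)\<^sup>2"
  have b: "b > 0" using span_pos by (simp add: b_def)
  \<comment> \<open>The second entry makes \<open>exp (- c * t\<^sup>2)\<close> at least
    \<open>\<rho>\<close> on the whole interval.\<close>
  define c where "c = min (\<sigma>2 / 4) (- ln \<rho> / b)"
  have "c > 0" using \<rho> b variance_pos by (simp add: c_def divide_neg_pos)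
  moreover have "norm (centred_char t) \<le> exp (- c * t\<^sup>2)" if t: "\<bar>t\<bar> \<le> pi / d" for t
  proof (cases "\<bar>t\<bar> < \<delta>")
    case True
    have "norm (centred_char t) \<le> exp (- (\<sigma>2 / 4) * t\<^sup>2)" by (rule near[OF True])
    also have "\<dots> \<le> exp (- c * t\<^sup>2)"
    proof -
      have "c * t\<^sup>2 \<le> (\<sigma>2 / 4) * t\<^sup>2" unfolding c_def by (intro mult_right_mono min.cobounded1) simp
      then show ?thesis by simp
    qed
    finally show ?thesis .
  next
    case False
    have t2: "t\<^sup>2 \<le> b" unfolding b_def using t abs_le_square_iff[of t "pi / d"] by simp
    have "norm (centred_char t) \<le> \<rho>" using False t by (intro \<rho>) (auto simp: K_def)
    also have "\<rho> = exp (ln \<rho>)" using \<rho> by simp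
    also have "\<dots> \<le> exp (- c * t\<^sup>2)"
    proof -
      have "c * t\<^sup>2 \<le> c * b" using t2 \<open>c > 0\<close> by (intro mult_left_mono) auto
      also have "\<dots> \<le> (- ln \<rho> / b) * b" using b by (intro mult_right_mono) (auto simp: c_def)
      also have "\<dots> = - ln \<rho>" using b by simp
      finally show ?thesis by simp
    qed
    finally show ?thesis .
  qed
  ultimately show ?thesis by blast
qed

lemma integral_gaussian:
  assumes "c > 0"
  shows "integrable lborel (\<lambda>u. exp (- c * u\<^sup>2))" "(\<integral>u. exp (- c * u\<^sup>2) \<partial>lborel) = sqrt (pi / c)"
proof -
  define s where "s = sqrt (1 / (2 * c))"
  have s2: "s\<^sup>2 = 1 / (2 * c)" and s: "s > 0" using assms by (simp_all add: s_def)
  have eq: "exp (- c * u\<^sup>2) = sqrt (pi / c) * normal_density 0 s u" for u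
  proof -
    have "sqrt (pi / c) * (1 / sqrt (pi / c)) = 1" using assms by simp
    moreover have "2 * pi * s\<^sup>2 = pi / c" using assms by (simp add: s2)
    moreover have "- (u - 0)\<^sup>2 / (2 * s\<^sup>2) = - c * u\<^sup>2" using assms by (simp add: s2)
    ultimately show ?thesis unfolding normal_density_def by (simp only: mult.assoc[symmetric] mult_1)
  qed
  show "integrable lborel (\<lambda>u. exp (- c * u\<^sup>2))" "(\<integral>u. exp (- c * u\<^sup>2) \<partial>lborel) = sqrt (pi / c)"
    unfolding eq using s by auto
qed

text \<open>The span times the density at 0 of the centred normal law with variance
  \<open>\<sigma>2\<close>: only every d-th integer carries mass.\<close>

definition llt_const :: real where
  "llt_const = d / sqrt (2 * pi * \<sigma>2)"

lemma llt_const_pos: "llt_const > 0"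
  using span_pos variance_pos by (simp add: llt_const_def)

text \<open>Substituting t = u / sqrt n in the inversion formula gives integrands that are dominated
  by exp (- c u^2) for all n and converge to a Gaussian. The distance a of s from the mean is fixed,
  so its phase factor tends to 1; as an integer it allows s = n - 1 without truncation.\<close>

theorem local_limit:
  fixes a :: int
  assumes "e > 0"
  shows "\<exists>M. \<forall>n\<ge>M. \<forall>s. int s = int n + a \<longrightarrow> d dvd s \<longrightarrow> \<bar>sqrt n * walk_prob \<xi> n s - llt_const\<bar> < e"
proof -
  let ?I = "{- (pi / d)..pi / d}"
  obtain c where c: "c > 0" "\<And>t. \<bar>t\<bar> \<le> pi / d \<Longrightarrow> norm (centred_char t) \<le> exp (- c * t\<^sup>2)"
    using centred_char_gaussian_bound by blast
  \<comment> \<open>For n = 0 the formula would give the constant 1, since u / 0 = 0, and this is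
    not integrable.\<close>
  define g where "g n u = (if n = 0 then 0 else indicator ?I (u / sqrt n) *\<^sub>R (centred_char (u / sqrt n) ^ n * cis (- (u / sqrt n) * a)))"
    for n :: nat and u :: real
  have g_eq: "g n = (\<lambda>u. indicator ?I (u / sqrt n) *\<^sub>R
      (centred_char (u / sqrt n) ^ n * cis (- (u / sqrt n) * a)))" if "n > 0" for n
    using that by (simp add: g_def fun_eq_iff)
  have eq: "(\<integral>u. g n u \<partial>lborel) = of_real (2 * pi / d * (sqrt n * walk_prob \<xi> n s))"
    if n: "n > 0" and s: "int s = int n + a" "d dvd s" for n s
  proof -
    have sn: "sqrt n > 0" using n by simp
    have "complex_of_real (2 * pi / d * walk_prob \<xi> n s) =
      (\<integral>t. indicator ?I t *\<^sub>R (pmf_char \<xi> t ^ n * cis (- t * real s)) \<partial>lborel)"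
      using walk_prob_inversion[OF refl span_pos s(2), of n] by simp
    also have "\<dots> = (\<integral>t. indicator ?I t *\<^sub>R (centred_char t ^ n * cis (- t * a)) \<partial>lborel)"
    proof -
      have "pmf_char \<xi> t ^ n * cis (- t * real s) = centred_char t ^ n * cis (- t * a)" for t
      proof -
        have "real s = real n + real_of_int a" using s(1) by (metis of_int_add of_int_of_nat_eq)
        then have "cis (- t * real s) = cis (- t) ^ n * cis (- t * a)"
          by (simp add: Complex.DeMoivre cis_mult algebra_simps)
        then show ?thesis by (simp add: centred_char_eq power_mult_distrib mult.assoc)
      qed
      then show ?thesis by simp
    qed
    also have "\<dots> = (1 / sqrt n) *\<^sub>R (\<integral>u. g n u \<partial>lborel)"
      using sn n by (subst lborel_integral_real_affine[where c = "1 / sqrt n" and t = 0]) (simp_all add: g_eq)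
    finally have *: "(1 / sqrt n) *\<^sub>R (\<integral>u. g n u \<partial>lborel) = of_real (2 * pi / d * walk_prob \<xi> n s)" ..
    have "(\<integral>u. g n u \<partial>lborel) = sqrt n *\<^sub>R (1 / sqrt n) *\<^sub>R (\<integral>u. g n u \<partial>lborel)"
      using sn by simp
    then show ?thesis
      unfolding * by (simp add: scaleR_conv_of_real)
  qed
  have "(\<lambda>n. \<integral>u. g n u \<partial>lborel) \<longlonglongrightarrow> (\<integral>u. complex_of_real (exp (- (\<sigma>2 / 2) * u\<^sup>2)) \<partial>lborel)"
  proof (rule integral_dominated_convergence[where w = "\<lambda>u. exp (- c * u\<^sup>2)"])
    show "integrable lborel (\<lambda>u. exp (- c * u\<^sup>2))" by (rule integral_gaussian[OF c(1)])
    show "g n \<in> borel_measurable lborel" for n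
    proof (cases "n = 0")
      case False
      have [measurable]: "(\<lambda>x. cis (- (x / sqrt n) * a)) \<in> borel_measurable borel"
        using False by (intro borel_measurable_continuous_onI continuous_intros) auto
      have "(\<lambda>u. indicator ?I (u / sqrt n) *\<^sub>R (centred_char (u / sqrt n) ^ n * cis (- (u / sqrt n) * a)))
          \<in> borel_measurable lborel"
        by measurable
      then show ?thesis using False by (simp add: g_eq)
    qed (simp add: g_def[abs_def])
    show "AE u in lborel. (\<lambda>n. g n u) \<longlonglongrightarrow> complex_of_real (exp (- (\<sigma>2 / 2) * u\<^sup>2))"
    proof (rule AE_I2)
      fix u :: real
      have lim0: "(\<lambda>n. u / sqrt (real n)) \<longlonglongrightarrow> 0" by real_asymp
      have "\<forall>\<^sub>F n in sequentially. \<bar>u / sqrt (real n)\<bar> < pi / d"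
        using tendsto_rabs[OF lim0] by (rule order_tendstoD) (use span_pos in auto)
      then have ev: "\<forall>\<^sub>F n in sequentially. centred_char (u / sqrt n) ^ n * cis (- (u / sqrt n) * a) = g n u"
        using eventually_gt_at_top[of 0]
      proof eventually_elim
        case (elim n)
        then have "u / sqrt n \<in> ?I" unfolding abs_less_iff by simp
        then show ?case using elim(2) by (simp add: g_eq)
      qed
      have "(\<lambda>n. centred_char (u / sqrt n) ^ n * cis (- (u / sqrt n) * a)) \<longlonglongrightarrow>
          of_real (exp (- (\<sigma>2 * u\<^sup>2 / 2))) * cis (- (0 :: real) * a)"
        by (intro tendsto_mult centred_char_power_tendsto tendsto_cis tendsto_minus lim0 tendsto_const)
      then show "(\<lambda>n. g n u) \<longlonglongrightarrow> complex_of_real (exp (- (\<sigma>2 / 2) * u\<^sup>2))"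
        by (rule Lim_transform_eventually[OF _ ev, THEN tendsto_eq_rhs]) simp
    qed
    show "AE u in lborel. norm (g n u) \<le> exp (- c * u\<^sup>2)" for n
    proof (rule AE_I2)
      fix u :: real
      show "norm (g n u) \<le> exp (- c * u\<^sup>2)"
      proof (cases "u / sqrt n \<in> ?I")
        case True
        show ?thesis
        proof (cases "n = 0")
          case False
          have "norm (g n u) = norm (centred_char (u / sqrt n)) ^ n"
            using True False by (simp add: g_eq norm_mult norm_power)
          also have "\<dots> \<le> exp (- c * (u / sqrt n)\<^sup>2) ^ n"
            using True by (intro power_mono c(2)) (auto simp: abs_le_iff)
          also have "\<dots> = exp (- c * u\<^sup>2)"
            using False by (simp add: exp_of_nat_mult[symmetric] power_divide)
          finally show ?thesis .
        next
          case n0: True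
          show ?thesis by (simp add: g_def n0)
        qed
      qed (auto simp: g_def)
    qed
  qed measurable
  also have "(\<integral>u. complex_of_real (exp (- (\<sigma>2 / 2) * u\<^sup>2)) \<partial>lborel) = of_real (2 * pi / d * llt_const)"
  proof -
    have "2 * pi / d * llt_const = 2 * pi / sqrt (2 * pi * \<sigma>2)"
      using span_pos by (simp add: llt_const_def)
    also have "\<dots> = sqrt (pi / (\<sigma>2 / 2))"
    proof (rule power2_eq_imp_eq)
      show "(2 * pi / sqrt (2 * pi * \<sigma>2))\<^sup>2 = (sqrt (pi / (\<sigma>2 / 2)))\<^sup>2"
        using variance_pos by (simp add: power_divide power2_eq_square)
    qed (use variance_pos in auto)
    also have "\<dots> = (\<integral>u. exp (- (\<sigma>2 / 2) * u\<^sup>2) \<partial>lborel)"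
      using integral_gaussian(2)[of "\<sigma>2 / 2"] variance_pos by simp
    finally show ?thesis by (simp only: integral_complex_of_real)
  qed
  finally have "(\<lambda>n. \<integral>u. g n u \<partial>lborel) \<longlonglongrightarrow> of_real (2 * pi / d * llt_const)" .
  then have "(\<lambda>n. Re (of_real (d / (2 * pi)) * (\<integral>u. g n u \<partial>lborel))) \<longlonglongrightarrow>
      Re (of_real (d / (2 * pi)) * of_real (2 * pi / d * llt_const))"
    by (intro tendsto_Re tendsto_mult_left)
  also have "Re (of_real (d / (2 * pi)) * of_real (2 * pi / d * llt_const)) = llt_const"
    using span_pos by simp
  finally have "\<forall>\<^sub>F n in sequentially. dist (Re (of_real (d / (2 * pi)) * (\<integral>u. g n u \<partial>lborel))) llt_const < e"
    using assms by (rule tendstoD)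
  then have "\<forall>\<^sub>F n in sequentially. n > 0 \<and>
      dist (Re (of_real (d / (2 * pi)) * (\<integral>u. g n u \<partial>lborel))) llt_const < e"
    using eventually_gt_at_top[of 0] by eventually_elim auto
  then obtain M where M: "\<And>n. n \<ge> M \<Longrightarrow> n > 0 \<and>
      dist (Re (of_real (d / (2 * pi)) * (\<integral>u. g n u \<partial>lborel))) llt_const < e"
    by (auto simp: eventually_sequentially)
  have "\<bar>sqrt n * walk_prob \<xi> n s - llt_const\<bar> < e" if n: "n \<ge> M" and s: "int s = int n + a" "d dvd s" for n s
  proof -
    have "Re (of_real (d / (2 * pi)) * (\<integral>u. g n u \<partial>lborel)) = sqrt n * walk_prob \<xi> n s"
      using eq[OF _ s] M[OF n] span_pos by simp
    then show ?thesis using M[OF n] by (simp add: dist_real_def)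
  qed
  then show ?thesis by blast
qed

end

section \<open>Tree size probabilities and quotients of walk probabilities\<close>

context critical_offspring
begin

abbreviation "p \<equiv> walk_prob \<xi>"

text \<open>The probability that the Galton-Watson tree has k vertices, by the Otter-Dwass formula;
  \<open>total_weight_q\<close> links it to the weights. Division by zero gives
  \<open>q 0 = 0\<close>.\<close>

definition q :: "nat \<Rightarrow> real" where
  "q k = p k (k - 1) / real k"

definition kappa :: real where
  "kappa = sqrt (2 / (pi * \<sigma>2))"

lemma kappa_pos: "kappa > 0"
  using variance_pos by (simp add: kappa_def)

text \<open>On one residue class modulo d, q k is about \<open>llt_const\<close> times k^(-3/2), so
  its tail from k on is about 2 * llt_const / (d sqrt k). The 2 comes from integrating the power,
  the 1 / d from the spacing.\<close>

lemma kappa_eq: "kappa = 2 * llt_const / d"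
proof -
  have "2 * llt_const / d = 2 / sqrt (2 * pi * \<sigma>2)"
    using span_pos by (simp add: llt_const_def)
  also have "\<dots> = kappa"
  proof (rule power2_eq_imp_eq)
    show "(2 / sqrt (2 * pi * \<sigma>2))\<^sup>2 = kappa\<^sup>2"
      using variance_pos by (simp add: kappa_def power_divide field_simps)
  qed (use variance_pos in \<open>auto simp: kappa_def\<close>)
  finally show ?thesis ..
qed

lemma q_nonneg: "q k \<ge> 0"
  by (simp add: q_def walk_prob_nonneg)

lemma q_0 [simp]: "q 0 = 0"
  by (simp add: q_def)

lemma q_eq_0: "\<not> d dvd k - 1 \<Longrightarrow> q k = 0"
  by (simp add: q_def walk_prob_eq_0)

lemma walk_prob_le_1: "p n s \<le> 1"
proof -
  have "pmf_char \<xi> 0 = 1" by (simp add: pmf_char_def measure_pmf.prob_space)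
  then have "(\<lambda>s. complex_of_real (p n s)) sums 1"
    using sums_walk_prob[of \<xi> n 0] by simp
  then have "p n sums 1" by (metis of_real_1 sums_of_real_iff)
  then show ?thesis
    using sum_le_suminf[of "p n" "{s}"] by (simp add: sums_iff walk_prob_nonneg)
qed

text \<open>The summand 1 under the root admits n = 0. Below the threshold of the local limit
  theorem the trivial bound 1 suffices.\<close>

lemma walk_prob_bound:
  fixes a :: int
  shows "\<exists>C>0. \<forall>n s. int s = int n + a \<longrightarrow> p n s \<le> C / sqrt (real n + 1)"
proof -
  let ?L = llt_const
  obtain M where M: "\<And>n s. n \<ge> M \<Longrightarrow> int s = int n + a \<Longrightarrow> d dvd s \<Longrightarrow> \<bar>sqrt n * p n s - ?L\<bar> < 1"
    using local_limit[of 1 a] by auto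
  define C where "C = 2 * (?L + 1) + sqrt (real M + 2)"
  have C: "C > 0" using llt_const_pos by (simp add: C_def add_pos_nonneg)
  have "p n s \<le> C / sqrt (real n + 1)" if s: "int s = int n + a" for n s
  proof (cases "d dvd s")
    case False
    then show ?thesis using C by (simp add: walk_prob_eq_0)
  next
    case dvd: True
    show ?thesis
    proof (cases "n \<ge> M \<and> n \<ge> 1")
      case True
      then have "sqrt n * p n s \<le> ?L + 1" using M[of n s] s dvd by auto
      moreover have "sqrt (real n + 1) \<le> 2 * sqrt n"
        using True by (intro real_le_lsqrt) (auto simp: power_mult_distrib)
      ultimately have "sqrt (real n + 1) * p n s \<le> 2 * (?L + 1)"
        using mult_right_mono[of "sqrt (real n + 1)" "2 * sqrt n" "p n s"] walk_prob_nonneg[of \<xi> n s]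
        by (simp add: mult.assoc)
      also have "\<dots> \<le> C" by (simp add: C_def)
      finally show ?thesis by (simp add: field_simps)
    next
      case False
      then have "sqrt (real n + 1) \<le> sqrt (real M + 2)" by auto
      also have "\<dots> \<le> C" using llt_const_pos by (simp add: C_def)
      finally have "sqrt (real n + 1) * p n s \<le> C * 1"
        using C by (intro mult_mono walk_prob_le_1 walk_prob_nonneg) auto
      then show ?thesis by (simp add: field_simps)
    qed
  qed
  then show ?thesis using C by blast
qed

lemma walk_prob_excursion_lower:
  "\<exists>M. \<forall>n\<ge>M. d dvd n - 1 \<longrightarrow> p n (n - 1) \<ge> llt_const / (2 * sqrt n)"
proof -
  let ?L = llt_const
  obtain M where M: "\<And>n s. n \<ge> M \<Longrightarrow> int s = int n + (- 1) \<Longrightarrow> d dvd s \<Longrightarrow> \<bar>sqrt n * p n s - ?L\<bar> < ?L / 2"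
    using local_limit[of "?L / 2" "- 1"] llt_const_pos by (auto simp del: add_uminus_conv_diff)
  have "p n (n - 1) \<ge> ?L / (2 * sqrt n)" if n: "n \<ge> max M 1" "d dvd n - 1" for n
  proof -
    have "\<bar>sqrt n * p n (n - 1) - ?L\<bar> < ?L / 2" using n by (intro M) (auto simp: of_nat_diff)
    then have "sqrt n * p n (n - 1) \<ge> ?L / 2" by linarith
    moreover have "sqrt n > 0" using n by simp
    ultimately show ?thesis by (simp add: field_simps)
  qed
  then show ?thesis by blast
qed

text \<open>Cutting out subtrees with j vertices in all shortens the walk by j steps. Scaled by the
  square root of the number of steps, both probabilities are near \<open>llt_const\<close>, so their
  quotient is near sqrt (n / (n - j)), uniformly for all small proportions j / n.\<close>

lemma walk_prob_ratio:
  fixes a :: int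
  assumes "e > 0"
  shows "\<exists>M. \<exists>\<delta>>0 :: real. \<forall>n\<ge>M. \<forall>j s. d dvd n - 1 \<longrightarrow> real j \<le> \<delta> * n \<longrightarrow> int s = int n - int j + a \<longrightarrow>
    d dvd s \<longrightarrow> p n (n - 1) > 0 \<and> \<bar>p (n - j) s / p n (n - 1) - 1\<bar> \<le> e"
proof -
  let ?L = llt_const
  \<comment> \<open>With \<open>e' \<le> 1\<close> and \<open>\<delta> = e' / 6\<close>, both sqrt
    (n / m) and the quotient of the scaled probabilities are at most 1 + e' / 3, and the square of
    this is at most 1 + e'.\<close>
  define e' where "e' = min e 1"
  have e': "0 < e'" "e' \<le> 1" "e' \<le> e" using assms by (auto simp: e'_def)
  define \<eta> where "\<eta> = ?L * (e' / 8)"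
  have \<eta>: "\<eta> > 0" using e' llt_const_pos by (simp add: \<eta>_def)
  obtain M1 where M1: "\<And>n s. n \<ge> M1 \<Longrightarrow> int s = int n + a \<Longrightarrow> d dvd s \<Longrightarrow> \<bar>sqrt n * p n s - ?L\<bar> < \<eta>"
    using local_limit[OF \<eta>, of a] by auto
  obtain M2 where M2: "\<And>n s. n \<ge> M2 \<Longrightarrow> int s = int n + (- 1) \<Longrightarrow> d dvd s \<Longrightarrow> \<bar>sqrt n * p n s - ?L\<bar> < \<eta>"
    using local_limit[OF \<eta>, of "- 1"] by (auto simp del: add_uminus_conv_diff)
  define M where "M = max (2 * M1 + 2) (M2 + 1)"
  have *: "p n (n - 1) > 0 \<and> \<bar>p (n - j) s / p n (n - 1) - 1\<bar> \<le> e"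
    if n: "n \<ge> M" "d dvd n - 1" "real j \<le> e' / 6 * n" "int s = int n - int j + a" "d dvd s" for n j s
  proof -
    have "e' / 6 * n \<le> 1 / 6 * n" using e' by (intro mult_right_mono) auto
    with n(3) have "real j \<le> 1 / 6 * n" by (rule order_trans)
    then have j: "2 * j \<le> n" "j \<le> n" by linarith+
    define m where "m = n - j"
    have nm: "n = m + j" using j by (simp add: m_def)
    have m: "m \<ge> M1" "m > 0" using n(1) j by (auto simp: M_def m_def)
    define x where "x = sqrt m * p m s / ?L"
    define y where "y = sqrt n * p n (n - 1) / ?L"
    have "\<bar>sqrt m * p m s - ?L\<bar> < \<eta>" using m n j by (intro M1) (auto simp: m_def of_nat_diff)
    then have x: "1 - e' / 8 \<le> x" "x \<le> 1 + e' / 8"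
      using llt_const_pos unfolding x_def \<eta>_def pos_le_divide_eq[OF llt_const_pos]
        pos_divide_le_eq[OF llt_const_pos] abs_less_iff
      by (simp_all add: algebra_simps)
    have "\<bar>sqrt n * p n (n - 1) - ?L\<bar> < \<eta>" using n by (intro M2) (auto simp: M_def of_nat_diff)
    then have y: "1 - e' / 8 \<le> y" "y \<le> 1 + e' / 8"
      using llt_const_pos unfolding y_def \<eta>_def pos_le_divide_eq[OF llt_const_pos]
        pos_divide_le_eq[OF llt_const_pos] abs_less_iff
      by (simp_all add: algebra_simps)
    define z where "z = sqrt (real n / real m)"
    have n0: "n > 0" using m by (simp add: nm)
    have z1: "z \<ge> 1" unfolding z_def using m by (simp add: nm)
    have ypos: "y > 0" using y e' by linarith
    have pos: "p n (n - 1) > 0"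
      using ypos llt_const_pos n0 unfolding y_def by (simp add: zero_less_divide_iff zero_less_mult_iff)
    have ratio: "p m s / p n (n - 1) = x / y * z"
    proof -
      have alg: "A / B = (u * A / l) / (w * B / l) * (w / u)" if "u > 0" "w > 0" "l > 0" "B > 0"
        for A B u w l :: real
        using that by simp
      show ?thesis
        unfolding x_def y_def z_def real_sqrt_divide
        by (intro alg) (use m n0 llt_const_pos pos in auto)
    qed
    have z2: "z \<le> 1 + e' / 3"
    proof -
      define u where "u = e' / 6"
      have u: "0 < u" "u \<le> 1 / 6" "e' / 3 = 2 * u" using e' by (simp_all add: u_def)
      have "u * u \<le> (1 / 6) * u" using u by (intro mult_right_mono) auto
      moreover have "(1 - u) * (1 + 2 * u) = 1 + u - 2 * (u * u)"
        by (simp add: distrib_left left_diff_distrib)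
      ultimately have "1 \<le> (1 - u) * (1 + 2 * u)" using u by linarith
      then have "real n * 1 \<le> real n * ((1 - u) * (1 + 2 * u))" by (intro mult_left_mono) auto
      also have "\<dots> = (real n - u * real n) * (1 + 2 * u)" by (simp add: algebra_simps)
      also have "\<dots> \<le> real m * (1 + 2 * u)"
        using n(3) u unfolding u_def[symmetric] nm of_nat_add by (intro mult_right_mono) auto
      finally have "real n \<le> (1 + 2 * u) * real m" by (simp only: mult.commute mult_1)
      then have "real n / real m \<le> 1 + 2 * u" using m by (subst pos_divide_le_eq) auto
      also have "\<dots> \<le> (1 + 2 * u)\<^sup>2" using u by (intro self_le_power) auto
      finally have "z \<le> 1 + 2 * u" unfolding z_def using u by (intro real_le_lsqrt) auto
      then show ?thesis using u by simp
    qed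
    have xy1: "x / y \<le> 1 + e' / 3"
    proof -
      have "e' * e' \<le> e' * 1" using e' by (intro mult_left_mono) auto
      moreover have "(1 + e' / 3) * (1 - e' / 8) = 1 + e' / 3 - e' / 8 - e' * e' / 24"
        by (simp add: field_simps)
      ultimately have "1 + e' / 8 \<le> (1 + e' / 3) * (1 - e' / 8)" using e' by linarith
      also have "\<dots> \<le> (1 + e' / 3) * y" using y e' by (intro mult_left_mono) auto
      finally show ?thesis using x ypos by (simp add: field_simps)
    qed
    have xy2: "x / y \<ge> 1 - e' / 4"
    proof -
      have "(1 - e' / 4) * y \<le> (1 - e' / 4) * (1 + e' / 8)" using y e' by (intro mult_left_mono) auto
      also have "\<dots> \<le> 1 - e' / 8" using e' by (simp add: algebra_simps)
      finally show ?thesis using x ypos by (simp add: field_simps)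
    qed
    have "x / y * z \<le> (1 + e' / 3) * (1 + e' / 3)"
      using xy1 z1 z2 e' by (intro mult_mono) linarith+
    also have "\<dots> \<le> 1 + e'"
    proof -
      define u where "u = e' / 3"
      have "u * u \<le> u * 1" using e' unfolding u_def by (intro mult_left_mono) auto
      moreover have "(1 + u) * (1 + u) = 1 + 2 * u + u * u" by (simp add: distrib_left distrib_right)
      moreover have "e' = 3 * u" by (simp add: u_def)
      ultimately show ?thesis unfolding u_def[symmetric] by linarith
    qed
    finally have "x / y * z \<le> 1 + e'" .
    moreover have "(1 - e' / 4) * 1 \<le> x / y * z"
      using xy2 z1 e' by (intro mult_mono) linarith+
    ultimately have "\<bar>x / y * z - 1\<bar> \<le> e"
      unfolding mult_1_right using e' by linarith
    then have "\<bar>p m s / p n (n - 1) - 1\<bar> \<le> e"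
      unfolding ratio .
    with pos show ?thesis unfolding m_def by (rule conjI)
  qed
  have "e' / 6 > 0" using e' by simp
  then show ?thesis
    using * by blast
qed

text \<open>
  The least size \<open>\<ge> k\<close> that is congruent to 1 modulo \<open>d\<close>. Asymptotically, \<open>q k\<close> is \<open>kappa\<close> times a
  difference of consecutive values of \<open>v\<close>, also where both vanish, so sums of \<open>q\<close> telescope.
\<close>

definition next_size :: "nat \<Rightarrow> nat" where
  "next_size k = 1 + d * ((k + d - 2) div d)"

definition v :: "nat \<Rightarrow> real" where
  "v k = 1 / sqrt (next_size k)"

lemma next_size_bounds:
  assumes "k > 0"
  shows "k \<le> next_size k" "next_size k \<le> k + d"
proof -
  let ?x = "k + d - 2"
  have "d * (?x div d) + ?x mod d = ?x" by simp
  moreover have "?x mod d < d" using span_pos by simp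
  ultimately show "k \<le> next_size k" "next_size k \<le> k + d"
    using assms span_pos unfolding next_size_def by linarith+
qed

lemma next_size_eq:
  assumes "k > 0" "d dvd k - 1"
  shows "next_size k = k" "next_size (Suc k) = k + d"
proof -
  obtain c where c: "k - 1 = d * c" using assms(2) by blast
  have "k + d - 2 = d * c + (d - 1)" using c assms(1) span_pos by linarith
  moreover have "(d * c + (d - 1)) div d = c" using span_pos by (subst div_mult_self4) auto
  ultimately have "(k + d - 2) div d = c" by simp
  then show "next_size k = k" using c assms(1) by (simp add: next_size_def)
  have "Suc k + d - 2 = d * (c + 1)" using c assms(1) span_pos by (simp add: algebra_simps)
  then have "(Suc k + d - 2) div d = c + 1" using span_pos by (metis nonzero_mult_div_cancel_left neq0_conv)
  then show "next_size (Suc k) = k + d" using c assms(1) by (simp add: next_size_def algebra_simps)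
qed

lemma next_size_Suc_eq:
  assumes "k > 0" "\<not> d dvd k - 1"
  shows "next_size (Suc k) = next_size k"
proof -
  define c r where "c = (k - 1) div d" and "r = (k - 1) mod d"
  have k: "k = Suc (d * c + r)" using assms(1) by (simp add: c_def r_def)
  have r: "r < d" "r \<noteq> 0" using span_pos assms(2) by (auto simp: r_def dvd_eq_mod_eq_0)
  have "k + d - 2 = d * (c + 1) + (r - 1)" "Suc k + d - 2 = d * (c + 1) + r"
    using k r by (simp_all add: algebra_simps)
  moreover have "(d * (c + 1) + (r - 1)) div d = c + 1" "(d * (c + 1) + r) div d = c + 1"
    using r span_pos by (simp_all only: div_mult_self4 div_mult_self2 neq0_conv) auto
  ultimately show ?thesis unfolding next_size_def by metis
qed

lemma v_bounds:
  assumes "k > 0"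
  shows "v k \<le> 1 / sqrt k" "v k \<ge> 1 / sqrt (real k + d)"
  using next_size_bounds[OF assms] assms unfolding v_def
  by (auto intro!: divide_left_mono mult_pos_pos real_sqrt_le_mono simp flip: of_nat_add)

text \<open>For k congruent to 1 modulo d the difference of the values of v is 1 / sqrt k - 1 / sqrt
  (k + d). Multiplied by k sqrt k it tends to d / 2, while q k multiplied by k sqrt k tends to
  \<open>llt_const\<close>, which is kappa * d / 2.\<close>

lemma q_asymp:
  assumes "e > 0"
  shows "\<exists>M>0. \<forall>k\<ge>M. \<bar>q k - kappa * (v k - v (Suc k))\<bar> \<le> e * (v k - v (Suc k))"
proof -
  let ?L = llt_const
  \<comment> \<open>The entry d / 4 keeps the scaled difference B at least d / 4, so that an
    absolute error of e * d / 4 is a relative error of at most e.\<close>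
  define \<eta> where "\<eta> = min (e * d / (4 * (1 + kappa))) (d / 4)"
  have \<eta>: "\<eta> > 0" "\<eta> \<le> d / 4" "\<eta> * (1 + kappa) \<le> e * d / 4"
  proof -
    show "\<eta> > 0" using assms span_pos kappa_pos by (auto simp: \<eta>_def)
    show "\<eta> \<le> d / 4" unfolding \<eta>_def by (rule min.cobounded2)
    have "\<eta> * (1 + kappa) \<le> e * d / (4 * (1 + kappa)) * (1 + kappa)"
      using kappa_pos unfolding \<eta>_def by (intro mult_right_mono min.cobounded1) auto
    also have "\<dots> = e * d / 4" using kappa_pos by (simp add: divide_simps add_eq_0_iff)
    finally show "\<eta> * (1 + kappa) \<le> e * d / 4" .
  qed
  obtain M1 where M1: "\<And>n s. n \<ge> M1 \<Longrightarrow> int s = int n + (- 1) \<Longrightarrow> d dvd s \<Longrightarrow> \<bar>sqrt n * p n s - ?L\<bar> < \<eta>"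
    using local_limit[OF \<eta>(1), of "- 1"] by (auto simp del: add_uminus_conv_diff)
  define D where "D = real d"
  have "(\<lambda>k::nat. (1 / sqrt k - 1 / sqrt (real k + D)) * (k * sqrt k)) \<longlonglongrightarrow> D / 2"
    by real_asymp
  then have "\<forall>\<^sub>F k::nat in sequentially. dist ((1 / sqrt k - 1 / sqrt (real k + D)) * (k * sqrt k)) (D / 2) < \<eta>"
    using \<eta>(1) by (rule tendstoD)
  then obtain M2 where M2: "\<And>k::nat. k \<ge> M2 \<Longrightarrow> \<bar>(1 / sqrt k - 1 / sqrt (real k + D)) * (k * sqrt k) - D / 2\<bar> < \<eta>"
    by (auto simp: eventually_sequentially dist_real_def)
  have "\<bar>q k - kappa * (v k - v (Suc k))\<bar> \<le> e * (v k - v (Suc k))" if k: "k \<ge> max 1 (max M1 M2)" for k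
  proof (cases "d dvd k - 1")
    case False
    then show ?thesis using k by (simp add: q_eq_0 v_def next_size_Suc_eq)
  next
    case True
    define w where "w = v k - v (Suc k)"
    define B where "B = w * (k * sqrt k)"
    define A where "A = q k * (k * sqrt k)"
    have kk: "k * sqrt k > 0" using k by simp
    have w: "w = 1 / sqrt k - 1 / sqrt (real k + D)"
      using next_size_eq[OF _ True] k by (simp add: w_def v_def D_def)
    have B: "\<bar>B - D / 2\<bar> < \<eta>" using M2[of k] k by (simp add: B_def w)
    have "A = sqrt k * p k (k - 1)" using k by (simp add: A_def q_def)
    then have A: "\<bar>A - ?L\<bar> < \<eta>" using M1[of k "k - 1"] True k by (simp add: of_nat_diff)
    have L: "?L = kappa * (D / 2)" using kappa_eq span_pos by (simp add: D_def)
    have "\<bar>A - kappa * B\<bar> = \<bar>(A - ?L) - kappa * (B - D / 2)\<bar>" by (simp add: L algebra_simps)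
    also have "\<dots> \<le> \<bar>A - ?L\<bar> + \<bar>kappa * (B - D / 2)\<bar>" by (rule abs_triangle_ineq4)
    also have "\<dots> = \<bar>A - ?L\<bar> + kappa * \<bar>B - D / 2\<bar>" using kappa_pos by (simp add: abs_mult)
    also have "\<dots> \<le> \<eta> + kappa * \<eta>" using A B kappa_pos by (intro add_mono mult_left_mono) auto
    also have "\<dots> \<le> e * (D / 4)" using \<eta>(3) by (simp add: algebra_simps D_def)
    also have "\<dots> \<le> e * B" using B \<eta>(2) assms by (intro mult_left_mono) (auto simp: D_def abs_less_iff)
    finally have "\<bar>(q k - kappa * w) * (k * sqrt k)\<bar> \<le> (e * w) * (k * sqrt k)"
      by (simp add: A_def B_def algebra_simps)
    then have "\<bar>q k - kappa * w\<bar> * (k * sqrt k) \<le> (e * w) * (k * sqrt k)"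
      using kk by (simp add: abs_mult)
    then show ?thesis using kk unfolding w_def by (rule mult_right_le_imp_le)
  qed
  then show ?thesis by (intro exI[of _ "max 1 (max M1 M2)"]) auto
qed

text \<open>The error bounds telescope together with the main terms, so the relative error does not
  grow.\<close>

lemma sum_q_asymp:
  assumes "e > 0"
  shows "\<exists>M>0. \<forall>k K. M \<le> k \<longrightarrow> k \<le> K \<longrightarrow> \<bar>(\<Sum>i\<in>{k..<K}. q i) - kappa * (v k - v K)\<bar> \<le> e * (v k - v K)"
proof -
  obtain M where M: "M > 0" "\<And>k. k \<ge> M \<Longrightarrow> \<bar>q k - kappa * (v k - v (Suc k))\<bar> \<le> e * (v k - v (Suc k))"
    using q_asymp[OF assms] by blast
  have "\<bar>(\<Sum>i\<in>{k..<K}. q i) - kappa * (v k - v K)\<bar> \<le> e * (v k - v K)" if k: "M \<le> k" "k \<le> K" for k K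
  proof -
    have tele: "(\<Sum>i\<in>{k..<K}. v i - v (Suc i)) = v k - v K"
      using sum_Suc_diff'[OF k(2), of "\<lambda>i. - v i"] by simp
    have "(\<Sum>i\<in>{k..<K}. q i) - kappa * (v k - v K) = (\<Sum>i\<in>{k..<K}. q i - kappa * (v i - v (Suc i)))"
      unfolding tele[symmetric] by (simp only: sum_subtractf[symmetric] sum_distrib_left)
    also have "\<bar>\<dots>\<bar> \<le> (\<Sum>i\<in>{k..<K}. e * (v i - v (Suc i)))"
      using k M by (intro order_trans[OF sum_abs] sum_mono) auto
    also have "\<dots> = e * (v k - v K)"
      unfolding tele[symmetric] by (simp add: sum_distrib_left)
    finally show ?thesis .
  qed
  then show ?thesis using M(1) by blast
qed

section \<open>The band of sizes that carries the count\<close>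

definition lo :: "real \<Rightarrow> nat \<Rightarrow> nat" where
  "lo \<alpha> n = nat \<lceil>\<alpha> * ln n\<rceil>"

text \<open>The cutoff lies far above log n, so that larger subtrees are rare, and far below n /
  sqrt (log n), so that nested pairs are negligible and cutting out two subtrees hardly shortens the
  walk.\<close>

definition hi :: "nat \<Rightarrow> nat" where
  "hi n = nat \<lceil>sqrt n\<rceil>"

lemma lo_bounds:
  assumes "\<alpha> > 0" "n > 0"
  shows "\<alpha> * ln n \<le> lo \<alpha> n" "lo \<alpha> n \<le> \<alpha> * ln n + 1"
proof -
  have "0 \<le> \<alpha> * ln n" using assms by simp
  then show "\<alpha> * ln n \<le> lo \<alpha> n" "lo \<alpha> n \<le> \<alpha> * ln n + 1"
    unfolding lo_def by linarith+
qed

lemma hi_bounds: "sqrt n \<le> hi n" "hi n \<le> sqrt n + 1"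
proof -
  have "0 \<le> sqrt n" by simp
  then show "sqrt n \<le> hi n" "hi n \<le> sqrt n + 1"
    unfolding hi_def by linarith+
qed

lemma eventually_lo_hi:
  assumes "\<alpha> > 0"
  shows "\<forall>\<^sub>F n in sequentially. M \<le> lo \<alpha> n \<and> lo \<alpha> n \<le> hi n"
proof -
  have "\<forall>\<^sub>F n::nat in sequentially. real M \<le> \<alpha> * ln n" using assms by real_asymp
  moreover have "\<forall>\<^sub>F n::nat in sequentially. \<alpha> * ln n + 1 \<le> sqrt n" using assms by real_asymp
  ultimately show ?thesis using eventually_gt_at_top[of 0]
  proof eventually_elim
    case (elim n)
    then show ?case using lo_bounds[OF assms, of n] hi_bounds[of n] by linarith
  qed
qed

lemma v_lo_tendsto:
  assumes "\<alpha> > 0"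
  shows "(\<lambda>n. sqrt (ln n) * v (lo \<alpha> n)) \<longlonglongrightarrow> 1 / sqrt \<alpha>"
proof (rule tendsto_sandwich)
  define D where "D = real d"
  have "(\<lambda>n::nat. ln n / (\<alpha> * ln n + c)) \<longlonglongrightarrow> 1 / \<alpha>" for c
    using assms by real_asymp (simp add: field_simps)
  from tendsto_real_sqrt[OF this[of "1 + D"]] tendsto_real_sqrt[OF this[of 0]]
  show "(\<lambda>n::nat. sqrt (ln n) * (1 / sqrt (\<alpha> * ln n + 1 + D))) \<longlonglongrightarrow> 1 / sqrt \<alpha>"
    "(\<lambda>n::nat. sqrt (ln n) * (1 / sqrt (\<alpha> * ln n))) \<longlonglongrightarrow> 1 / sqrt \<alpha>"
    by (simp_all only: real_sqrt_divide add.assoc add_0_right real_sqrt_one times_divide_eq_right mult_1_right)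
  have ev: "\<forall>\<^sub>F n in sequentially. 1 \<le> lo \<alpha> n \<and> ln n > 0 \<and> n > 0"
    using eventually_lo_hi[OF assms, of 1] eventually_gt_at_top[of 1] by eventually_elim auto
  show "\<forall>\<^sub>F n in sequentially. sqrt (ln n) * (1 / sqrt (\<alpha> * ln n + 1 + D)) \<le> sqrt (ln n) * v (lo \<alpha> n)"
    using ev
  proof eventually_elim
    case (elim n)
    have "1 / sqrt (\<alpha> * ln n + 1 + D) \<le> 1 / sqrt (lo \<alpha> n + D)"
      using lo_bounds[OF assms, of n] elim assms
      by (intro divide_left_mono mult_pos_pos real_sqrt_le_mono) (auto simp: D_def add_pos_nonneg)
    also have "\<dots> \<le> v (lo \<alpha> n)" using elim v_bounds[of "lo \<alpha> n"] by (simp add: D_def)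
    finally show ?case using elim by (intro mult_left_mono) auto
  qed
  show "\<forall>\<^sub>F n in sequentially. sqrt (ln n) * v (lo \<alpha> n) \<le> sqrt (ln n) * (1 / sqrt (\<alpha> * ln n))"
    using ev
  proof eventually_elim
    case (elim n)
    have "v (lo \<alpha> n) \<le> 1 / sqrt (lo \<alpha> n)" using elim v_bounds[of "lo \<alpha> n"] by simp
    also have "\<dots> \<le> 1 / sqrt (\<alpha> * ln n)"
      using lo_bounds[OF assms, of n] elim assms
      by (intro divide_left_mono mult_pos_pos real_sqrt_le_mono) auto
    finally show ?case using elim by (intro mult_left_mono) auto
  qed
qed

lemma v_hi_tendsto: "(\<lambda>n. sqrt (ln n) * v (hi n)) \<longlonglongrightarrow> 0"
proof (rule tendsto_sandwich[where f = "\<lambda>_. 0"])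
  show "(\<lambda>n::nat. sqrt (ln n) * (1 / sqrt (sqrt n))) \<longlonglongrightarrow> 0" by real_asymp
  have ev: "\<forall>\<^sub>F n in sequentially. 1 \<le> hi n \<and> ln n > 0 \<and> n > 0"
    using eventually_lo_hi[OF zero_less_one, of 1] eventually_gt_at_top[of 1] by eventually_elim auto
  show "\<forall>\<^sub>F n in sequentially. 0 \<le> sqrt (ln n) * v (hi n)"
    using ev by eventually_elim (auto simp: v_def)
  show "\<forall>\<^sub>F n in sequentially. sqrt (ln n) * v (hi n) \<le> sqrt (ln n) * (1 / sqrt (sqrt n))"
    using ev
  proof eventually_elim
    case (elim n)
    have "v (hi n) \<le> 1 / sqrt (hi n)" using elim v_bounds[of "hi n"] by simp
    also have "\<dots> \<le> 1 / sqrt (sqrt n)"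
      using hi_bounds[of n] elim by (intro divide_left_mono mult_pos_pos real_sqrt_le_mono) auto
    finally show ?case using elim by (intro mult_left_mono) auto
  qed
qed (rule tendsto_const)

lemma sum_q_tendsto:
  assumes \<alpha>: "\<alpha> > 0"
  shows "(\<lambda>n. sqrt (ln n) * (\<Sum>i\<in>{lo \<alpha> n..<hi n}. q i)) \<longlonglongrightarrow> kappa / sqrt \<alpha>"
proof -
  define V where "V n = sqrt (ln n) * (v (lo \<alpha> n) - v (hi n))" for n :: nat
  have V: "V \<longlonglongrightarrow> 1 / sqrt \<alpha>"
    using tendsto_diff[OF v_lo_tendsto[OF \<alpha>] v_hi_tendsto]
    by (simp add: V_def[abs_def] algebra_simps)
  define S where "S n = sqrt (ln n) * (\<Sum>i\<in>{lo \<alpha> n..<hi n}. q i)" for n :: nat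
  have "(\<lambda>n. S n - kappa * V n) \<longlonglongrightarrow> 0"
  proof (rule tendstoI)
    fix e :: real assume e: "e > 0"
    define e' where "e' = e / (1 / sqrt \<alpha> + 1)"
    have pos: "1 / sqrt \<alpha> + 1 > 0" using \<alpha> by (simp add: add_pos_nonneg)
    have e': "e' > 0" using e pos by (simp add: e'_def)
    obtain M where M: "M > 0" "\<And>k K. M \<le> k \<Longrightarrow> k \<le> K \<Longrightarrow>
        \<bar>(\<Sum>i\<in>{k..<K}. q i) - kappa * (v k - v K)\<bar> \<le> e' * (v k - v K)"
      using sum_q_asymp[OF e'] by blast
    have "\<forall>\<^sub>F n in sequentially. V n < 1 / sqrt \<alpha> + 1"
      using V by (rule order_tendstoD) simp
    then show "\<forall>\<^sub>F n in sequentially. dist (S n - kappa * V n) 0 < e"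
      using eventually_lo_hi[OF \<alpha>, of M] eventually_gt_at_top[of 1]
    proof eventually_elim
      case (elim n)
      have "S n - kappa * V n = sqrt (ln n) * ((\<Sum>i\<in>{lo \<alpha> n..<hi n}. q i) - kappa * (v (lo \<alpha> n) - v (hi n)))"
        by (simp add: S_def V_def algebra_simps)
      also have "\<bar>\<dots>\<bar> \<le> sqrt (ln n) * (e' * (v (lo \<alpha> n) - v (hi n)))"
        unfolding abs_mult using elim M(2)[of "lo \<alpha> n" "hi n"] by (intro mult_mono) auto
      also have "\<dots> = e' * V n" by (simp add: V_def)
      also have "\<dots> < e' * (1 / sqrt \<alpha> + 1)" using elim e' by (intro mult_strict_left_mono) auto
      also have "\<dots> = e" using pos by (simp add: e'_def)
      finally show ?case by (simp add: dist_real_def)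
    qed
  qed
  from tendsto_add[OF this tendsto_mult_left[OF V, of kappa]]
  show ?thesis by (simp add: S_def)
qed

section \<open>Rarity of large fringe subtrees\<close>

lemma sum_inv_sqrt_le: "(\<Sum>i=1..n. 1 / sqrt (real i)) \<le> 2 * sqrt n"
proof (induction n)
  case (Suc n)
  have "1 / sqrt (Suc n) \<le> 2 * (sqrt (Suc n) - sqrt n)"
  proof -
    have "(sqrt (Suc n) - sqrt n) * (sqrt (Suc n) + sqrt n) = 1"
      by (simp add: algebra_simps)
    moreover have "(sqrt (Suc n) - sqrt n) * (sqrt (Suc n) + sqrt n) \<le> (sqrt (Suc n) - sqrt n) * (2 * sqrt (Suc n))"
      by (intro mult_left_mono) auto
    ultimately have "1 \<le> (sqrt (Suc n) - sqrt n) * (2 * sqrt (Suc n))" by simp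
    then show ?thesis by (simp add: field_simps)
  qed
  then show ?case using Suc by simp
qed simp

text \<open>A telescoping majorant. With x = sqrt k and y = sqrt (k + 1), the 6 is the product of
  the constants in y \<le> 2 x and y + x \<le> 3 x.\<close>

lemma inv_three_halves_le:
  assumes "k > 0"
  shows "1 / (real k * sqrt k) \<le> 6 * (1 / sqrt k - 1 / sqrt (Suc k))"
proof -
  define x y where "x = sqrt (real k)" and "y = sqrt (Suc k)"
  have x: "x > 0" "x * x = real k" and y: "y > 0" "y * y = real k + 1"
    using assms by (auto simp: x_def y_def)
  have yx: "y \<le> 2 * x" unfolding x_def y_def using assms by (intro real_le_lsqrt) (auto simp: power_mult_distrib)
  have "(y - x) * (y + x) = 1" using x y by (simp add: algebra_simps)
  moreover have xy: "x \<le> y" by (simp add: x_def y_def)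
  then have "(y - x) * (y + x) \<le> (y - x) * (3 * x)" using yx by (intro mult_left_mono) auto
  ultimately have "1 \<le> (y - x) * (3 * x)" by simp
  then have 1: "y * 1 \<le> (2 * x) * ((y - x) * (3 * x))" using yx x xy by (intro mult_mono) auto
  have "1 / (x * x * x) \<le> 6 * (1 / x - 1 / y)"
  proof -
    have "6 * (1 / x - 1 / y) = 6 * (y - x) / (x * y)" using x y by (simp add: field_simps)
    moreover have "1 / (x * x * x) \<le> 6 * (y - x) / (x * y)"
    proof -
      have "1 / (x * x * x) = y / ((x * x) * (x * y))" using x(1) y(1) by simp
      also have "\<dots> \<le> (2 * x) * ((y - x) * (3 * x)) / ((x * x) * (x * y))"
        using 1 x(1) y(1) by (intro divide_right_mono) auto
      also have "\<dots> = 6 * (y - x) / (x * y)" using x(1) y(1) by (simp add: field_simps)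
      finally show ?thesis .
    qed
    ultimately show ?thesis by simp
  qed
  then show ?thesis using x by (simp add: x_def y_def)
qed

lemma sum_inv_three_halves_le:
  assumes "k > 0" "k \<le> n"
  shows "(\<Sum>i=k..n. 1 / (real i * sqrt i)) \<le> 6 / sqrt k"
proof -
  have "(\<Sum>i=k..n. 1 / (real i * sqrt i)) \<le> (\<Sum>i=k..n. 6 * (1 / sqrt i - 1 / sqrt (Suc i)))"
    using assms by (intro sum_mono inv_three_halves_le) auto
  also have "\<dots> = 6 * (1 / sqrt k - 1 / sqrt (Suc n))"
  proof -
    have "(\<Sum>i=k..n. 1 / sqrt (real i) - 1 / sqrt (Suc i)) = 1 / sqrt k - 1 / sqrt (Suc n)"
      using sum_Suc_diff[of k n "\<lambda>i. - (1 / sqrt (real i))"] assms by (simp del: of_nat_Suc)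
    then show ?thesis by (simp only: sum_distrib_left[symmetric])
  qed
  also have "\<dots> \<le> 6 / sqrt k" by simp
  finally show ?thesis .
qed

lemma tail_bound:
  "\<exists>c M. c > 0 \<and> (\<forall>n\<ge>M. d dvd n - 1 \<longrightarrow>
     (\<Sum>k\<in>{hi n..n}. q k * p (n - k) (n - k) / p n (n - 1)) \<le> c / sqrt (sqrt n))"
proof -
  obtain Ca where Ca: "Ca > 0" "\<And>n s. int s = int n + (- 1) \<Longrightarrow> p n s \<le> Ca / sqrt (real n + 1)"
    using walk_prob_bound[of "- 1"] by blast
  obtain Cb where Cb: "Cb > 0" "\<And>n s. int s = int n + 0 \<Longrightarrow> p n s \<le> Cb / sqrt (real n + 1)"
    using walk_prob_bound[of 0] by blast
  obtain M where M: "\<And>n. n \<ge> M \<Longrightarrow> d dvd n - 1 \<Longrightarrow> p n (n - 1) \<ge> llt_const / (2 * sqrt n)"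
    using walk_prob_excursion_lower by blast
  define C where "C = Ca * Cb * (2 / llt_const)"
  have C: "C > 0" using Ca Cb llt_const_pos by (simp add: C_def)
  have "(\<Sum>k\<in>{hi n..n}. q k * p (n - k) (n - k) / p n (n - 1)) \<le> 30 * C / sqrt (sqrt n)"
    if n: "n \<ge> max M 1" "d dvd n - 1" for n
  proof -
    have n0: "n > 0" using n by simp
    have h: "hi n > 0" using hi_bounds(1)[of n] n0 by (simp add: hi_def)
    have term_le: "q k * p (n - k) (n - k) / p n (n - 1) \<le>
        3 * C * (1 / (real k * sqrt k)) + 3 * C / real n * (1 / sqrt (real (Suc n - k)))"
      if k: "k \<in> {hi n..n}" for k
    proof -
      have k0: "k > 0" "k \<le> n" using k h by auto
      define r where "r = real (Suc n - k)"
      have r: "r > 0" "r + real k = real n + 1" using k0 by (auto simp: r_def of_nat_diff)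
      have 1: "q k \<le> Ca * (1 / (real k * sqrt k))"
      proof -
        have "p k (k - 1) \<le> Ca / sqrt (real k + 1)" using k0 by (intro Ca) (auto simp: of_nat_diff)
        also have "\<dots> \<le> Ca / sqrt k" using k0 Ca by (intro divide_left_mono) auto
        finally show ?thesis using k0 by (simp add: q_def field_simps)
      qed
      have 2: "p (n - k) (n - k) \<le> Cb / sqrt r"
        using Cb(2)[of "n - k" "n - k"] k0 by (simp add: r_def of_nat_diff Suc_diff_le add.commute)
      have lpos: "llt_const / (2 * sqrt n) > 0" using llt_const_pos n0 by simp
      have 3: "1 / p n (n - 1) \<le> 2 / llt_const * sqrt n"
      proof -
        have "1 / p n (n - 1) \<le> 1 / (llt_const / (2 * sqrt n))"
          using M[of n] n lpos by (intro divide_left_mono mult_pos_pos) auto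
        then show ?thesis by simp
      qed
      have "q k * p (n - k) (n - k) * (1 / p n (n - 1)) \<le>
          Ca * (1 / (real k * sqrt k)) * (Cb / sqrt r) * (2 / llt_const * sqrt n)"
        using 1 2 3 Ca(1) Cb(1) lpos M[of n] n r k0
        by (intro mult_mono mult_nonneg_nonneg q_nonneg walk_prob_nonneg) auto
      also have "\<dots> = C * (1 / (real k * sqrt k) * (sqrt n / sqrt r))"
        by (simp add: C_def mult_ac)
      also have "1 / (real k * sqrt k) * (sqrt n / sqrt r) \<le>
          3 * (1 / (real k * sqrt k)) + 3 / real n * (1 / sqrt r)"
      proof (cases "real k \<le> real n / 2")
        case True
        have "real n \<le> 2 * r" using r True by linarith
        then have "sqrt n \<le> sqrt (2 * r)" by simp
        also have "\<dots> \<le> 3 * sqrt r" using r by (intro real_le_lsqrt) (auto simp: power_mult_distrib)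
        finally have "sqrt n / sqrt r \<le> 3" using r by (simp add: field_simps)
        then have "1 / (real k * sqrt k) * (sqrt n / sqrt r) \<le> 1 / (real k * sqrt k) * 3"
          by (intro mult_left_mono) auto
        also have "\<dots> \<le> 3 * (1 / (real k * sqrt k)) + 3 / real n * (1 / sqrt r)"
          using r by simp
        finally show ?thesis .
      next
        case False
        have "sqrt n \<le> sqrt (2 * real k)" using False by simp
        also have "\<dots> \<le> 3 / 2 * sqrt k" by (intro real_le_lsqrt) (auto simp: power_mult_distrib power2_eq_square)
        finally have "sqrt n \<le> 3 / 2 * sqrt k" .
        then have "real n * sqrt n \<le> (2 * real k) * (3 / 2 * sqrt k)"
          using False by (intro mult_mono) auto
        then have "sqrt n / (real k * sqrt k) \<le> 3 / real n" using k0 n0 by (simp add: field_simps)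
        then have "sqrt n / (real k * sqrt k) * (1 / sqrt r) \<le> 3 / real n * (1 / sqrt r)"
          by (intro mult_right_mono) (use r in auto)
        moreover have "0 \<le> 3 * (1 / (real k * sqrt k))" by simp
        moreover have "1 / (real k * sqrt k) * (sqrt n / sqrt r) = sqrt n / (real k * sqrt k) * (1 / sqrt r)"
          by simp
        ultimately show ?thesis by linarith
      qed
      also have "C * (3 * (1 / (real k * sqrt k)) + 3 / real n * (1 / sqrt r)) =
          3 * C * (1 / (real k * sqrt k)) + 3 * C / real n * (1 / sqrt (real (Suc n - k)))"
        by (simp add: r_def algebra_simps)
      finally show ?thesis using C by (simp add: mult_left_mono)
    qed
    have sn: "sqrt n \<ge> sqrt (sqrt n)"
      using n0 by (intro real_sqrt_le_mono) (auto intro!: real_le_lsqrt self_le_power)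
    have "(\<Sum>k\<in>{hi n..n}. q k * p (n - k) (n - k) / p n (n - 1)) \<le>
        (\<Sum>k\<in>{hi n..n}. 3 * C * (1 / (real k * sqrt k)) + 3 * C / real n * (1 / sqrt (real (Suc n - k))))"
      by (intro sum_mono term_le)
    also have "\<dots> = 3 * C * (\<Sum>k\<in>{hi n..n}. 1 / (real k * sqrt k)) +
        3 * C / real n * (\<Sum>k\<in>{hi n..n}. 1 / sqrt (real (Suc n - k)))"
      by (simp add: sum.distrib sum_distrib_left)
    also have "\<dots> \<le> 3 * C * (6 / sqrt (sqrt n)) + 3 * C / real n * (2 * sqrt n)"
    proof (intro add_mono mult_left_mono)
      show "(\<Sum>k\<in>{hi n..n}. 1 / (real k * sqrt k)) \<le> 6 / sqrt (sqrt n)"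
      proof (cases "hi n \<le> n")
        case True
        have "(\<Sum>k\<in>{hi n..n}. 1 / (real k * sqrt k)) \<le> 6 / sqrt (hi n)"
          by (rule sum_inv_three_halves_le[OF h True])
        also have "\<dots> \<le> 6 / sqrt (sqrt n)"
          using hi_bounds[of n] n0 h by (intro divide_left_mono mult_pos_pos real_sqrt_le_mono) auto
        finally show ?thesis .
      qed simp
      show "(\<Sum>k\<in>{hi n..n}. 1 / sqrt (real (Suc n - k))) \<le> 2 * sqrt n"
      proof -
        have "(\<Sum>k\<in>{hi n..n}. 1 / sqrt (real (Suc n - k))) \<le> (\<Sum>k\<in>{1..n}. 1 / sqrt (real (Suc n - k)))"
          using h by (intro sum_mono2) auto
        also have "\<dots> = (\<Sum>i=1..n. 1 / sqrt (real i))"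
          by (rule sum.reindex_bij_witness[of _ "\<lambda>i. Suc n - i" "\<lambda>i. Suc n - i"]) auto
        also have "\<dots> \<le> 2 * sqrt n" by (rule sum_inv_sqrt_le)
        finally show ?thesis .
      qed
    qed (use C in auto)
    also have "3 * C * (6 / sqrt (sqrt n)) + 3 * C / real n * (2 * sqrt n) \<le> 30 * C / sqrt (sqrt n)"
    proof -
      have "3 * C / real n * (2 * sqrt n) = 6 * C / sqrt n"
        using n0 by (simp add: field_simps)
      also have "\<dots> \<le> 6 * C / sqrt (sqrt n)"
        using sn C n0 by (intro divide_left_mono mult_pos_pos) auto
      finally show ?thesis using C n0 by (simp add: field_simps)
    qed
    finally show ?thesis .
  qed
  then show ?thesis using C by (intro exI[of _ "30 * C"] exI[of _ "max M 1"]) auto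
qed

end

section \<open>Moments of the numbers of fringe subtrees\<close>

lemma eventually_at_infinite_size:
  "eventually P (at_infinite_size \<F>) \<longleftrightarrow> (\<exists>M. \<forall>n\<ge>M. total_weight \<F> n > 0 \<longrightarrow> P n)"
  by (simp add: at_infinite_size_def eventually_inf_principal eventually_at_top_linorder)

lemma at_infinite_size_le: "at_infinite_size \<F> \<le> sequentially"
  by (simp add: at_infinite_size_def)

lemma eventually_at_infinite_sizeI:
  "eventually P sequentially \<Longrightarrow> eventually P (at_infinite_size \<F>)"
  using at_infinite_size_le[of \<F>] by (simp add: filter_leD)

lemma tendsto_at_infinite_sizeI:
  "f \<longlonglongrightarrow> c \<Longrightarrow> (f \<longlongrightarrow> c) (at_infinite_size \<F>)"
  by (rule tendsto_mono[OF at_infinite_size_le])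

text \<open>A finite sum instead of an expectation, because \<open>random_tree\<close> is meaningful
  only for sizes of positive total weight. For the other sizes division by zero gives 0, so that the
  linear identities hold for every size.\<close>

definition tree_mean :: "('a, 'm) tree_family_scheme \<Rightarrow> nat \<Rightarrow> ('a \<Rightarrow> real) \<Rightarrow> real" where
  "tree_mean \<F> n h = wsum \<F> n h / total_weight \<F> n"

text \<open>As in \<open>fringe_list\<close>, the argument n has to be the size of t.\<close>

definition fringe_sum :: "('a, 'm) tree_family_scheme \<Rightarrow> ('a \<Rightarrow> real) \<Rightarrow> nat \<Rightarrow> 'a \<Rightarrow> real" where
  "fringe_sum \<F> h n t = (\<Sum>s\<leftarrow>fringe_list \<F> n [t]. h s)"

lemma sum_list_square:
  fixes h :: "'a \<Rightarrow> real"
  shows "(\<Sum>x\<leftarrow>xs. h x)\<^sup>2 = (\<Sum>x\<leftarrow>xs. (h x)\<^sup>2) + 2 * pair_sum (\<lambda>x y. h x * h y) xs"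
  by (induction xs) (simp_all add: power2_sum sum_list_const_mult algebra_simps)

lemma length_fringe_list_le: "length (fringe_list \<F> n f) \<le> n"
  by (induction n arbitrary: f) (auto split: list.splits)

lemma fringe_sum_add:
  "fringe_sum \<F> (\<lambda>s. a s + b s) n t = fringe_sum \<F> a n t + fringe_sum \<F> b n t"
  by (simp add: fringe_sum_def sum_list_addf)

lemma sum_band_le:
  fixes f :: "nat \<Rightarrow> real"
  assumes "\<And>k. 0 \<le> f k"
  shows "(\<Sum>k\<le>m. of_bool (a \<le> k \<and> k < b) * f k) \<le> (\<Sum>k\<in>{a..<b}. f k)"
proof -
  have "(\<Sum>k\<le>m. of_bool (a \<le> k \<and> k < b) * f k) = (\<Sum>k\<in>{..m} \<inter> {a..<b}. f k)"
    by (intro sum.mono_neutral_cong_right) auto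
  also have "\<dots> \<le> (\<Sum>k\<in>{a..<b}. f k)"
    by (intro sum_mono2) (auto simp: assms)
  finally show ?thesis .
qed

lemma fringe_sum_nonneg: "(\<And>s. 0 \<le> h s) \<Longrightarrow> 0 \<le> fringe_sum \<F> h n t"
  unfolding fringe_sum_def by (rule sum_list_nonneg) auto

context sg_family
begin

lemma total_weight_eq: "total_weight \<F> n = wsum \<F> n (\<lambda>_. 1)"
  by (simp add: total_weight_def wsum_def)

lemma total_weight_nonneg: "total_weight \<F> n \<ge> 0"
  unfolding total_weight_def by (intro sum_nonneg weight_nonneg) (auto simp: members_of_size_iff)

text \<open>If the total weight is 0, all weights of this size vanish because they are
  nonnegative.\<close>

lemma wsum_eq: "wsum \<F> k h = total_weight \<F> k * tree_mean \<F> k h"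
proof (cases "total_weight \<F> k = 0")
  case True
  then have "\<forall>t\<in>members_of_size \<F> k. weight \<F> t = 0"
    unfolding total_weight_def
    by (subst (asm) sum_nonneg_eq_0_iff) (auto simp: finite_members_of_size members_of_size_iff weight_nonneg)
  then show ?thesis using True by (simp add: wsum_def)
qed (simp add: tree_mean_def)

lemma tree_mean_add: "tree_mean \<F> n (\<lambda>t. a t + b t) = tree_mean \<F> n a + tree_mean \<F> n b"
  by (simp add: tree_mean_def wsum_def distrib_left sum.distrib add_divide_distrib)

lemma tree_mean_cmult: "tree_mean \<F> n (\<lambda>t. c * a t) = c * tree_mean \<F> n a"
  by (simp add: tree_mean_def wsum_def sum_distrib_left mult_ac)

lemma tree_mean_divide: "tree_mean \<F> n (\<lambda>t. a t / c) = tree_mean \<F> n a / c"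
  using tree_mean_cmult[of n "1 / c" a] by simp

lemma tree_mean_const: "total_weight \<F> n > 0 \<Longrightarrow> tree_mean \<F> n (\<lambda>_. c) = c"
  using tree_mean_cmult[of n c "\<lambda>_. 1"] by (simp add: tree_mean_def total_weight_eq)

lemma tree_mean_mono:
  "(\<And>t. t \<in> members_of_size \<F> n \<Longrightarrow> a t \<le> b t) \<Longrightarrow> tree_mean \<F> n a \<le> tree_mean \<F> n b"
  unfolding tree_mean_def wsum_def
  by (intro divide_right_mono sum_mono mult_left_mono weight_nonneg total_weight_nonneg)
     (auto simp: members_of_size_iff)

lemma tree_mean_cong:
  "(\<And>t. t \<in> members_of_size \<F> n \<Longrightarrow> a t = b t) \<Longrightarrow> tree_mean \<F> n a = tree_mean \<F> n b"
  by (intro antisym tree_mean_mono) auto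

lemma tree_mean_nonneg:
  "(\<And>t. t \<in> members_of_size \<F> n \<Longrightarrow> 0 \<le> a t) \<Longrightarrow> 0 \<le> tree_mean \<F> n a"
  using tree_mean_mono[of n "\<lambda>_. 0" a] by (simp add: tree_mean_def wsum_def)

lemma tree_mean_zero:
  "(\<And>t. t \<in> members_of_size \<F> n \<Longrightarrow> a t = 0) \<Longrightarrow> tree_mean \<F> n a = 0"
  by (simp add: tree_mean_def wsum_def)

lemma pmf_random_tree:
  assumes "total_weight \<F> n > 0"
  shows "pmf (random_tree \<F> n) t =
    (if t \<in> members_of_size \<F> n then weight \<F> t / total_weight \<F> n else 0)"
  unfolding random_tree_def
proof (rule pmf_embed_pmf)
  show nonneg: "0 \<le> (if t \<in> members_of_size \<F> n then weight \<F> t / total_weight \<F> n else 0)" for t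
    using assms by (auto simp: members_of_size_iff weight_nonneg)
  have "(\<integral>\<^sup>+t. ennreal (if t \<in> members_of_size \<F> n then weight \<F> t / total_weight \<F> n else 0) \<partial>count_space UNIV) =
     (\<Sum>t\<in>members_of_size \<F> n. ennreal (if t \<in> members_of_size \<F> n then weight \<F> t / total_weight \<F> n else 0))"
    by (rule nn_integral_count_space') (auto simp: finite_members_of_size)
  also have "\<dots> = ennreal (\<Sum>t\<in>members_of_size \<F> n. weight \<F> t / total_weight \<F> n)"
    using nonneg by (subst sum_ennreal[symmetric]) (auto intro!: sum.cong simp: members_of_size_iff weight_nonneg total_weight_nonneg)
  also have "(\<Sum>t\<in>members_of_size \<F> n. weight \<F> t / total_weight \<F> n) = 1"
    using assms by (simp add: total_weight_def sum_divide_distrib[symmetric])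
  finally show "(\<integral>\<^sup>+t. ennreal (if t \<in> members_of_size \<F> n then weight \<F> t / total_weight \<F> n else 0) \<partial>count_space UNIV) = 1"
    by simp
qed

lemma expectation_random_tree:
  fixes h :: "'a \<Rightarrow> real"
  assumes "total_weight \<F> n > 0"
  shows "measure_pmf.expectation (random_tree \<F> n) h = tree_mean \<F> n h"
proof -
  have "measure_pmf.expectation (random_tree \<F> n) h =
      (\<Sum>t\<in>members_of_size \<F> n. pmf (random_tree \<F> n) t *\<^sub>R h t)"
    by (rule integral_measure_pmf[OF finite_members_of_size])
       (auto simp: set_pmf_iff pmf_random_tree[OF assms] split: if_splits)
  then show ?thesis
    by (simp add: pmf_random_tree[OF assms] tree_mean_def wsum_def sum_divide_distrib)
qed

lemma prob_random_tree:
  assumes "total_weight \<F> n > 0"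
  shows "measure_pmf.prob (random_tree \<F> n) E = tree_mean \<F> n (\<lambda>t. of_bool (t \<in> E))"
proof -
  have "measure_pmf.prob (random_tree \<F> n) E = measure_pmf.expectation (random_tree \<F> n) (indicator E)"
    by simp
  also have "(indicator E :: 'a \<Rightarrow> real) = (\<lambda>t. of_bool (t \<in> E))"
    by (auto simp: indicator_def)
  finally show ?thesis by (simp add: expectation_random_tree[OF assms])
qed

lemma sum_forests_single:
  "(\<Sum>f\<in>forests \<F> 1 n. forest_weight \<F> f * G f) = wsum \<F> n (\<lambda>t. G [t])"
  unfolding wsum_def
  by (rule sum.reindex_bij_witness[of _ "\<lambda>t. [t]" hd])
     (auto simp: forests_def members_of_size_iff length_Suc_conv)

lemma single_in_forests: "t \<in> members_of_size \<F> n \<Longrightarrow> [t] \<in> forests \<F> 1 n"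
  by (auto simp: forests_def members_of_size_iff)

lemma peel_in_forests:
  assumes "t # ts \<in> forests \<F> j (Suc n)"
  shows "branches \<F> t \<in> forests \<F> (length (branches \<F> t)) (tree_size \<F> t - 1)"
    "ts \<in> forests \<F> (length ts) (Suc n - tree_size \<F> t)"
    "branches \<F> t @ ts \<in> forests \<F> (length (branches \<F> t @ ts)) n"
    "(tree_size \<F> t - 1) + (Suc n - tree_size \<F> t) = n" "t \<in> members \<F>"
  using assms branches_members[of t] tree_size_branches[of t]
  by (auto simp: forests_def)

lemma fringe_list_append:
  assumes "f \<in> forests \<F> i n" "g \<in> forests \<F> j m"
  shows "fringe_list \<F> (n + m) (f @ g) = fringe_list \<F> n f @ fringe_list \<F> m g"
  using assms
proof (induction n arbitrary: f i)
  case 0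
  then show ?case by (auto simp: forests_0_right split: if_splits)
next
  case (Suc n)
  then obtain t ts where f: "f = t # ts"
    by (cases f) (auto simp: forests_def)
  have "fringe_list \<F> (n + m) ((branches \<F> t @ ts) @ g) =
      fringe_list \<F> n (branches \<F> t @ ts) @ fringe_list \<F> m g"
    using Suc.prems f by (intro Suc.IH[OF peel_in_forests(3)]) auto
  then show ?case by (simp add: f)
qed

text \<open>Splits the pairs of vertices according to whether the first is an ancestor of the second.\<close>

lemma pair_sum_fringe_list:
  assumes "f \<in> forests \<F> j n"
  shows "pair_sum g (fringe_list \<F> n f) = disjoint_pair_sum \<F> g n f +
    (\<Sum>s\<leftarrow>fringe_list \<F> n f. \<Sum>u\<leftarrow>fringe_list \<F> (tree_size \<F> s - 1) (branches \<F> s). g s u)"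
  using assms
proof (induction n arbitrary: f j)
  case (Suc n)
  then obtain t ts where f: "f = t # ts"
    by (cases f) (auto simp: forests_def)
  note peel = peel_in_forests[OF Suc.prems[unfolded f]]
  have "fringe_list \<F> n (branches \<F> t @ ts) =
      fringe_list \<F> (tree_size \<F> t - 1) (branches \<F> t) @ fringe_list \<F> (Suc n - tree_size \<F> t) ts"
    using fringe_list_append[OF peel(1,2)] by (simp only: peel(4))
  then show ?case
    using Suc.IH[OF peel(3)] by (simp add: f)
qed simp

lemma fringe_list_members:
  assumes "f \<in> forests \<F> j n" "s \<in> set (fringe_list \<F> n f)"
  shows "s \<in> members \<F>" "tree_size \<F> s \<le> n"
  using assms
proof (induction n arbitrary: f j)
  case (Suc n)
  {
    case 1
    then obtain t ts where f: "f = t # ts" by (cases f) (auto simp: forests_def)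
    note peel = peel_in_forests[OF 1(1)[unfolded f]]
    show ?case using 1 Suc.IH(1)[OF peel(3)] peel(5) by (auto simp: f)
  next
    case 2
    then obtain t ts where f: "f = t # ts" by (cases f) (auto simp: forests_def)
    note peel = peel_in_forests[OF 2(1)[unfolded f]]
    have "tree_size \<F> t \<le> Suc n" using 2(1) by (auto simp: f forests_def)
    then show ?case using 2 Suc.IH(2)[OF peel(3)] by (auto simp: f)
  }
qed auto

lemma fringe_subtrees_eq:
  "fringe_subtrees \<F> t = insert t (\<Union>u\<in>set (branches \<F> t). fringe_subtrees \<F> u)"
proof (intro equalityI subsetI)
  fix s assume "s \<in> fringe_subtrees \<F> t"
  then show "s \<in> insert t (\<Union>u\<in>set (branches \<F> t). fringe_subtrees \<F> u)"
    by induction (auto intro: fringe_subtrees.intros)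
next
  fix s assume s: "s \<in> insert t (\<Union>u\<in>set (branches \<F> t). fringe_subtrees \<F> u)"
  have "s \<in> fringe_subtrees \<F> t" if "s \<in> fringe_subtrees \<F> u" "u \<in> set (branches \<F> t)" for u
    using that by induction (auto intro: fringe_subtrees.intros)
  then show "s \<in> fringe_subtrees \<F> t" using s by (auto intro: fringe_subtrees.intros)
qed

lemma set_fringe_list:
  assumes "f \<in> forests \<F> j n"
  shows "set (fringe_list \<F> n f) = (\<Union>t\<in>set f. fringe_subtrees \<F> t)"
  using assms
proof (induction n arbitrary: f j)
  case 0
  then show ?case by (auto simp: forests_0_right split: if_splits)
next
  case (Suc n)
  then obtain t ts where f: "f = t # ts" by (cases f) (auto simp: forests_def)
  show ?case
    using Suc.IH[OF peel_in_forests(3)[OF Suc.prems[unfolded f]]] fringe_subtrees_eq[of t]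
    by (auto simp: f)
qed

lemma set_fringe_list_single:
  "t \<in> members_of_size \<F> n \<Longrightarrow> set (fringe_list \<F> n [t]) = fringe_subtrees \<F> t"
  using set_fringe_list[OF single_in_forests] by simp

end

section \<open>Moment formulas for the conditioned Galton-Watson tree\<close>

locale conditioned_gw = sg_family \<phi> \<F> + critical_offspring \<xi> \<sigma>2
  for \<phi> :: "nat \<Rightarrow> real" and \<F> :: "('a, 'm) tree_family_scheme" and \<xi> :: "nat pmf" and \<sigma>2 :: real +
  fixes \<tau> g :: real
  assumes \<tau>_pos: "\<tau> > 0" and g_pos: "g > 0"
    and offspring: "\<And>m. pmf \<xi> m = \<phi> m * \<tau> ^ m / g"
begin

text \<open>Exponential tilting, with g in the role of Phi(\<tau>). For trees s = n - 1, so the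
  factor depends on the size alone and cancels in means over trees of one size.\<close>

lemma coeff_eq: "fps_nth (Abs_fps \<phi> ^ n) s = p n s * (g ^ n / \<tau> ^ s)"
proof (induction n arbitrary: s)
  case 0
  then show ?case by (simp add: walk_prob_0)
next
  case (Suc n)
  have "fps_nth (Abs_fps \<phi> ^ Suc n) s = (\<Sum>i\<le>s. \<phi> i * (p n (s - i) * (g ^ n / \<tau> ^ (s - i))))"
    by (simp add: fps_mult_nth Suc.IH atLeast0AtMost)
  also have "\<dots> = (\<Sum>i\<le>s. pmf \<xi> i * p n (s - i) * (g ^ Suc n / \<tau> ^ s))"
  proof (rule sum.cong[OF refl])
    fix i assume "i \<in> {..s}"
    then have "\<tau> ^ s = \<tau> ^ i * \<tau> ^ (s - i)" by (simp add: power_add[symmetric])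
    then show "\<phi> i * (p n (s - i) * (g ^ n / \<tau> ^ (s - i))) = pmf \<xi> i * p n (s - i) * (g ^ Suc n / \<tau> ^ s)"
      using \<tau>_pos g_pos by (simp add: offspring)
  qed
  finally show ?case by (simp add: walk_prob_Suc sum_distrib_right sum_divide_distrib)
qed

lemma cf_single: "N + a > 0 \<Longrightarrow> cf \<phi> a 1 N = p N (N + a - 1) * (g ^ N / \<tau> ^ (N + a - 1))"
  by (auto simp: cf_def coeff_eq)

lemma total_weight_q:
  assumes "n > 0"
  shows "total_weight \<F> n = q n * (g ^ n / \<tau> ^ (n - 1))"
proof -
  have "real n * total_weight \<F> n = p n (n - 1) * (g ^ n / \<tau> ^ (n - 1))"
    using assms sum_forest_weight[of n 1] sum_forests_single[where n = n and G = "\<lambda>_. 1"]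
      cf_single[of n 0] by (simp add: total_weight_eq)
  then have "real n * total_weight \<F> n / real n = p n (n - 1) * (g ^ n / \<tau> ^ (n - 1)) / real n"
    by simp
  then show ?thesis using assms by (simp add: q_def)
qed

lemma total_weight_posD:
  assumes "total_weight \<F> n > 0"
  shows "n > 0" "q n > 0" "p n (n - 1) > 0" "d dvd n - 1"
proof -
  show n: "n > 0" using assms by (auto simp: total_weight_def intro!: Nat.gr0I)
  then show qn: "q n > 0"
    using assms \<tau>_pos g_pos by (simp add: total_weight_q zero_less_mult_iff zero_less_divide_iff)
  then show "p n (n - 1) > 0" using n by (simp add: q_def zero_less_divide_iff)
  show "d dvd n - 1" using qn q_eq_0[of n] by fastforce
qed

lemma total_weight_eq_0D: "total_weight \<F> k = 0 \<Longrightarrow> q k = 0"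
  using \<tau>_pos g_pos by (cases "k = 0") (auto simp: total_weight_q)

text \<open>
  \<open>R1 n k\<close> is the mean number of fringe subtrees of size \<open>k\<close> of the random tree of size \<open>n\<close>, and
  \<open>R2 n k l\<close> the mean number of pairs of disjoint fringe subtrees of sizes \<open>k\<close> and \<open>l\<close>, the former
  preceding the latter in preorder.
\<close>

definition R1 :: "nat \<Rightarrow> nat \<Rightarrow> real" where
  "R1 n k = n * q k * (p (n - k) (n - k) / p n (n - 1))"

definition R2 :: "nat \<Rightarrow> nat \<Rightarrow> nat \<Rightarrow> real" where
  "R2 n k l = real n * real (n - k - l + 1) / 2 * q k * q l * (p (n - k - l) (n - k - l + 1) / p n (n - 1))"

lemma R1_nonneg: "R1 n k \<ge> 0"
  by (simp add: R1_def q_nonneg walk_prob_nonneg)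

lemma R2_nonneg: "R2 n k l \<ge> 0"
  by (simp add: R2_def q_nonneg walk_prob_nonneg)

text \<open>By \<open>sum_fringe_list\<close>, a fringe subtree is, given its size, a random member
  of that size. The tilting factors of the subtree and of the rest multiply to that of the whole
  tree.\<close>

lemma tree_mean_fringe_sum:
  assumes n: "total_weight \<F> n > 0"
  shows "tree_mean \<F> n (fringe_sum \<F> h n) = (\<Sum>k\<le>n. tree_mean \<F> k h * R1 n k)"
proof -
  note n' = total_weight_posD[OF n]
  have "total_weight \<F> n * tree_mean \<F> n (fringe_sum \<F> h n) =
      (\<Sum>k\<le>n. wsum \<F> k h * cf \<phi> 1 1 (n - k))"
    using sum_fringe_list[where j = 1 and n = n and h = h]
      sum_forests_single[where n = n and G = "\<lambda>f. \<Sum>s\<leftarrow>fringe_list \<F> n f. h s"]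
    by (simp add: wsum_eq[symmetric] fringe_sum_def[abs_def])
  also have "\<dots> = (\<Sum>k\<le>n. total_weight \<F> n * (tree_mean \<F> k h * R1 n k))"
  proof (rule sum.cong[OF refl])
    fix k assume k: "k \<in> {..n}"
    show "wsum \<F> k h * cf \<phi> 1 1 (n - k) = total_weight \<F> n * (tree_mean \<F> k h * R1 n k)"
    proof (cases "k = 0")
      case True
      then show ?thesis by (simp add: R1_def)
    next
      case False
      have 1: "total_weight \<F> k = q k * (g ^ k / \<tau> ^ (k - 1))" using False by (simp add: total_weight_q)
      have 2: "cf \<phi> 1 1 (n - k) = p (n - k) (n - k) * (g ^ (n - k) / \<tau> ^ (n - k))"
        by (subst cf_single) auto
      have 3: "total_weight \<F> n * R1 n k = q k * p (n - k) (n - k) * (g ^ n / \<tau> ^ (n - 1))"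
        using n' by (simp add: total_weight_q R1_def q_def mult_ac)
      have "g ^ k * g ^ (n - k) = g ^ n" "\<tau> ^ (k - 1) * \<tau> ^ (n - k) = \<tau> ^ (n - 1)"
        using False k by (simp_all add: power_add[symmetric])
      then have 4: "(g ^ k / \<tau> ^ (k - 1)) * (g ^ (n - k) / \<tau> ^ (n - k)) = g ^ n / \<tau> ^ (n - 1)"
        by simp
      have "wsum \<F> k h * cf \<phi> 1 1 (n - k) = tree_mean \<F> k h * (q k * p (n - k) (n - k) *
          ((g ^ k / \<tau> ^ (k - 1)) * (g ^ (n - k) / \<tau> ^ (n - k))))"
        unfolding wsum_eq 1 2 by (simp only: mult_ac)
      then show ?thesis unfolding 4 3[symmetric] by (simp only: mult_ac)
    qed
  qed
  finally show ?thesis using n by (simp add: sum_distrib_left[symmetric])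
qed

lemma tree_mean_disjoint_pair_sum:
  assumes n: "total_weight \<F> n > 0"
  shows "tree_mean \<F> n (\<lambda>t. disjoint_pair_sum \<F> h n [t]) =
    (\<Sum>k\<le>n. \<Sum>l\<le>n - k. tree_mean \<F> k (\<lambda>u. tree_mean \<F> l (h u)) * R2 n k l)"
proof -
  note n' = total_weight_posD[OF n]
  have "total_weight \<F> n * tree_mean \<F> n (\<lambda>t. disjoint_pair_sum \<F> h n [t]) =
      (\<Sum>k\<le>n. \<Sum>l\<le>n - k. wsum \<F> k (\<lambda>u. wsum \<F> l (h u)) *
        (real (Suc (n - k - l)) / 2 * cf \<phi> 2 1 (n - k - l)))"
    using sum_disjoint_pair_sum[where j = 1 and n = n and g = h]
      sum_forests_single[where n = n and G = "disjoint_pair_sum \<F> h n"]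
    by (simp add: wsum_eq[of n, symmetric])
  also have "\<dots> = (\<Sum>k\<le>n. \<Sum>l\<le>n - k. total_weight \<F> n *
      (tree_mean \<F> k (\<lambda>u. tree_mean \<F> l (h u)) * R2 n k l))"
  proof (intro sum.cong refl)
    fix k l assume k: "k \<in> {..n}" "l \<in> {..n - k}"
    define N where "N = n - k - l"
    have nN: "n = k + l + N" using k by (simp add: N_def)
    show "wsum \<F> k (\<lambda>u. wsum \<F> l (h u)) * (real (Suc (n - k - l)) / 2 * cf \<phi> 2 1 (n - k - l)) =
        total_weight \<F> n * (tree_mean \<F> k (\<lambda>u. tree_mean \<F> l (h u)) * R2 n k l)"
    \<comment> \<open>The exponents k - 1 and l - 1 of \<open>\<tau>\<close> would be truncated
      here; both sides vanish.\<close>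
    proof (cases "k = 0 \<or> l = 0")
      case True
      then have "wsum \<F> k (\<lambda>u. wsum \<F> l (h u)) = 0" by (auto simp: wsum_def)
      then show ?thesis using True by (auto simp: R2_def)
    next
      case False
      have 1: "total_weight \<F> k = q k * (g ^ k / \<tau> ^ (k - 1))" "total_weight \<F> l = q l * (g ^ l / \<tau> ^ (l - 1))"
        using False by (simp_all add: total_weight_q)
      have 2: "cf \<phi> 2 1 N = p N (N + 1) * (g ^ N / \<tau> ^ (N + 1))"
        by (subst cf_single) auto
      have 3: "total_weight \<F> n * R2 n k l = (N + 1) / 2 * q k * q l * p N (N + 1) * (g ^ n / \<tau> ^ (n - 1))"
        using n' by (simp add: total_weight_q R2_def q_def N_def mult_ac)
      have "n - 1 = (k - 1) + (l - 1) + (N + 1)" using False nN by linarith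
      then have "g ^ k * g ^ l * g ^ N = g ^ n" "\<tau> ^ (k - 1) * \<tau> ^ (l - 1) * \<tau> ^ (N + 1) = \<tau> ^ (n - 1)"
        by (simp_all only: power_add[symmetric] nN[symmetric])
      then have 4: "(g ^ k / \<tau> ^ (k - 1)) * (g ^ l / \<tau> ^ (l - 1)) * (g ^ N / \<tau> ^ (N + 1)) = g ^ n / \<tau> ^ (n - 1)"
        by simp
      have W: "wsum \<F> k (\<lambda>u. wsum \<F> l (h u)) =
          total_weight \<F> k * (total_weight \<F> l * tree_mean \<F> k (\<lambda>u. tree_mean \<F> l (h u)))"
        unfolding wsum_eq[of l] wsum_eq[of k] tree_mean_cmult ..
      have "wsum \<F> k (\<lambda>u. wsum \<F> l (h u)) * ((N + 1) / 2 * cf \<phi> 2 1 N) =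
          tree_mean \<F> k (\<lambda>u. tree_mean \<F> l (h u)) * ((N + 1) / 2 * q k * q l * p N (N + 1) *
          ((g ^ k / \<tau> ^ (k - 1)) * (g ^ l / \<tau> ^ (l - 1)) * (g ^ N / \<tau> ^ (N + 1))))"
        unfolding W 1 2 by (simp only: mult_ac)
      also have "\<dots> = total_weight \<F> n * (tree_mean \<F> k (\<lambda>u. tree_mean \<F> l (h u)) * R2 n k l)"
        unfolding 4 3[symmetric] by (simp only: mult_ac)
      finally show ?thesis by (simp add: N_def)
    qed
  qed
  finally show ?thesis using n by (simp add: sum_distrib_left[symmetric])
qed

lemma hi_le_eventually:
  fixes \<delta> :: real
  assumes "\<delta> > 0"
  shows "\<forall>\<^sub>F n in sequentially. 2 * real (hi n) \<le> \<delta> * n"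
proof -
  have "\<forall>\<^sub>F n::nat in sequentially. 2 * (sqrt n + 1) \<le> \<delta> * n"
    using assms by real_asymp
  then show ?thesis
  proof eventually_elim
    case (elim n)
    have "2 * real (hi n) \<le> 2 * (sqrt n + 1)" using hi_bounds(2)[of n] by simp
    then show ?case using elim by (rule order_trans)
  qed
qed

text \<open>One hole leaves a walk with n - k steps and sum n - k, the case a = 0 of
  \<open>walk_prob_ratio\<close>. For sizes off the residue class 1 modulo d both quantities are
  0.\<close>

lemma R1_eventually:
  assumes "e > 0"
  shows "\<forall>\<^sub>F n in at_infinite_size \<F>. \<forall>k<hi n. k \<le> n \<and> \<bar>R1 n k - n * q k\<bar> \<le> e * (n * q k)"
proof -
  obtain M and \<delta> :: real where \<delta>: "\<delta> > 0" and M: "\<And>n j s. n \<ge> M \<Longrightarrow> d dvd n - 1 \<Longrightarrow> real j \<le> \<delta> * n \<Longrightarrow>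
      int s = int n - int j + 0 \<Longrightarrow> d dvd s \<Longrightarrow> p n (n - 1) > 0 \<and> \<bar>p (n - j) s / p n (n - 1) - 1\<bar> \<le> e"
    using walk_prob_ratio[OF assms, of 0] by blast
  have "\<forall>\<^sub>F n in sequentially. M \<le> n \<and> 2 * real (hi n) \<le> \<delta> * n \<and> 2 * real (hi n) \<le> (1 :: real) * n"
    by (intro eventually_conj eventually_ge_at_top hi_le_eventually \<delta> zero_less_one)
  then show ?thesis
    unfolding eventually_at_infinite_size eventually_sequentially
  proof (elim exE, intro exI allI impI)
    fix M' n k
    assume M': "\<forall>n\<ge>M'. M \<le> n \<and> 2 * real (hi n) \<le> \<delta> * n \<and> 2 * real (hi n) \<le> (1 :: real) * n"
      and n: "M' \<le> n" "total_weight \<F> n > 0" and k: "k < hi n"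
    have nM: "M \<le> n" "2 * real (hi n) \<le> \<delta> * n" "2 * real (hi n) \<le> (1 :: real) * n" using M' n by auto
    then have kn: "k \<le> n" "real k \<le> \<delta> * n" using k by linarith+
    show "k \<le> n \<and> \<bar>R1 n k - n * q k\<bar> \<le> e * (n * q k)"
    proof (cases "k > 0 \<and> d dvd k - 1")
      case False
      then have "q k = 0" using q_eq_0[of k] by auto
      then show ?thesis using kn by (simp add: R1_def)
    next
      case True
      have "d dvd (n - 1) - (k - 1)"
        using True by (intro dvd_diff_nat[OF total_weight_posD(4)[OF n(2)]]) simp
      then have dvd: "d dvd n - k" using True kn by simp
      have "\<bar>p (n - k) (n - k) / p n (n - 1) - 1\<bar> \<le> e"
        using M[OF nM(1) total_weight_posD(4)[OF n(2)] kn(2) _ dvd] kn by (auto simp: of_nat_diff)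
      then have "n * q k * \<bar>p (n - k) (n - k) / p n (n - 1) - 1\<bar> \<le> n * q k * e"
        by (intro mult_left_mono) (auto simp: q_nonneg)
      moreover have "n * q k * \<bar>p (n - k) (n - k) / p n (n - 1) - 1\<bar> = \<bar>R1 n k - n * q k\<bar>"
      proof -
        have "R1 n k - n * q k = n * q k * (p (n - k) (n - k) / p n (n - 1) - 1)"
          by (simp add: R1_def algebra_simps)
        then show ?thesis using q_nonneg[of k] by (simp add: abs_mult)
      qed
      ultimately show ?thesis using kn by (simp add: mult_ac)
    qed
  qed
qed

text \<open>Two holes leave n - k - l steps and a sum larger by one, the case a = 1. Up to the
  factor 1 + e the bound is a product, as if the two sizes were independent; for a second moment the
  upper bound suffices.\<close>

lemma R2_eventually:
  assumes "e > 0"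
  shows "\<forall>\<^sub>F n in at_infinite_size \<F>. \<forall>k<hi n. \<forall>l<hi n.
    k + l \<le> n \<and> R2 n k l \<le> (1 + e) * (real n)\<^sup>2 / 2 * q k * q l"
proof -
  obtain M and \<delta> :: real where \<delta>: "\<delta> > 0" and M: "\<And>n j s. n \<ge> M \<Longrightarrow> d dvd n - 1 \<Longrightarrow> real j \<le> \<delta> * n \<Longrightarrow>
      int s = int n - int j + 1 \<Longrightarrow> d dvd s \<Longrightarrow> p n (n - 1) > 0 \<and> \<bar>p (n - j) s / p n (n - 1) - 1\<bar> \<le> e"
    using walk_prob_ratio[OF assms, of 1] by blast
  have "\<forall>\<^sub>F n in sequentially. M \<le> n \<and> 2 * real (hi n) \<le> \<delta> * n \<and> 2 * real (hi n) \<le> (1 :: real) * n"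
    by (intro eventually_conj eventually_ge_at_top hi_le_eventually \<delta> zero_less_one)
  then show ?thesis
    unfolding eventually_at_infinite_size eventually_sequentially
  proof (elim exE, intro exI allI impI)
    fix M' n k l
    assume M': "\<forall>n\<ge>M'. M \<le> n \<and> 2 * real (hi n) \<le> \<delta> * n \<and> 2 * real (hi n) \<le> (1 :: real) * n"
      and n: "M' \<le> n" "total_weight \<F> n > 0" and k: "k < hi n" "l < hi n"
    have nM: "M \<le> n" "2 * real (hi n) \<le> \<delta> * n" "2 * real (hi n) \<le> (1 :: real) * n" using M' n by auto
    then have kn: "k + l \<le> n" "real (k + l) \<le> \<delta> * n" using k by linarith+
    show "k + l \<le> n \<and> R2 n k l \<le> (1 + e) * (real n)\<^sup>2 / 2 * q k * q l"
    proof (cases "(k > 0 \<and> d dvd k - 1) \<and> (l > 0 \<and> d dvd l - 1)")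
      case False
      then have "q k = 0 \<or> q l = 0" using q_eq_0[of k] q_eq_0[of l] by auto
      then show ?thesis using kn by (auto simp: R2_def)
    next
      case True
      define s where "s = n - k - l + 1"
      have s: "s = (n - 1) - (k - 1) - (l - 1)" "int s = int n - int (k + l) + 1" "s \<le> n"
        using True kn by (auto simp: s_def)
      have dvd: "d dvd s" unfolding s(1) 
        using True dvd_diff_nat[OF dvd_diff_nat[OF total_weight_posD(4)[OF n(2)]]] by blast
      have "\<bar>p (n - (k + l)) s / p n (n - 1) - 1\<bar> \<le> e"
        using M[OF nM(1) total_weight_posD(4)[OF n(2)] kn(2) s(2) dvd] by blast
      then have le: "p (n - k - l) s / p n (n - 1) \<le> 1 + e" by simp
      have "R2 n k l = n * s / 2 * q k * q l * (p (n - k - l) s / p n (n - 1))"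
        by (simp only: R2_def s_def of_nat_mult)
      also have "\<dots> \<le> n * n / 2 * q k * q l * (1 + e)"
        using le mult_left_mono[of "real s" "real n" "real n"] s(3) by (intro mult_mono mult_nonneg_nonneg divide_right_mono q_nonneg divide_nonneg_nonneg walk_prob_nonneg) auto
      finally show ?thesis using kn by (simp add: power2_eq_square mult_ac)
    qed
  qed
qed

text \<open>The factor q k includes the sizes without a random tree, where the mean is 0 by
  convention.\<close>

lemma tree_mean_size:
  "tree_mean \<F> k (\<lambda>s. of_bool (P (tree_size \<F> s)) * c) * q k = of_bool (P k) * c * q k"
proof (cases "total_weight \<F> k = 0")
  case True
  then show ?thesis by (simp add: total_weight_eq_0D)
next
  case False
  then have pos: "total_weight \<F> k > 0" using total_weight_nonneg[of k] by simp
  have "tree_mean \<F> k (\<lambda>s. of_bool (P (tree_size \<F> s)) * c) = tree_mean \<F> k (\<lambda>s. of_bool (P k) * c)"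
    by (rule tree_mean_cong) (simp add: members_of_size_iff)
  then show ?thesis by (simp add: tree_mean_const[OF pos])
qed

lemma tree_mean_size_R1:
  "tree_mean \<F> k (\<lambda>s. of_bool (P (tree_size \<F> s))) * R1 n k = of_bool (P k) * R1 n k"
proof -
  have R1: "R1 n k = q k * (real n * (p (n - k) (n - k) / p n (n - 1)))" by (simp add: R1_def)
  show ?thesis
    using tree_mean_size[of k P 1] unfolding R1 mult.assoc[symmetric] by simp
qed

section \<open>Concentration of the number of fringe subtrees in the band\<close>

definition scale :: "nat \<Rightarrow> real" where
  "scale n = real n / sqrt (ln n)"

lemma eventually_scale_pos: "\<forall>\<^sub>F n in sequentially. scale n > 0"
  using eventually_gt_at_top[of 1] by eventually_elim (simp add: scale_def)

abbreviation in_band :: "real \<Rightarrow> nat \<Rightarrow> 'a \<Rightarrow> bool" where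
  "in_band \<alpha> n s \<equiv> lo \<alpha> n \<le> tree_size \<F> s \<and> tree_size \<F> s < hi n"

definition Y :: "real \<Rightarrow> nat \<Rightarrow> 'a \<Rightarrow> real" where
  "Y \<alpha> n = fringe_sum \<F> (\<lambda>s. of_bool (in_band \<alpha> n s)) n"

definition Z :: "nat \<Rightarrow> 'a \<Rightarrow> real" where
  "Z n = fringe_sum \<F> (\<lambda>s. of_bool (hi n \<le> tree_size \<F> s)) n"

lemma tree_mean_Y:
  assumes "total_weight \<F> n > 0" "hi n \<le> Suc n"
  shows "tree_mean \<F> n (Y \<alpha> n) = (\<Sum>k\<in>{lo \<alpha> n..<hi n}. R1 n k)"
proof -
  have "tree_mean \<F> n (Y \<alpha> n) = (\<Sum>k\<le>n. of_bool (lo \<alpha> n \<le> k \<and> k < hi n) * R1 n k)"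
    unfolding Y_def tree_mean_fringe_sum[OF assms(1)]
    by (intro sum.cong refl tree_mean_size_R1[where P = "\<lambda>k. lo \<alpha> n \<le> k \<and> k < hi n"])
  also have "\<dots> = (\<Sum>k\<in>{lo \<alpha> n..<hi n}. R1 n k)"
    using assms(2) by (intro sum.mono_neutral_cong_right) auto
  finally show ?thesis .
qed

lemma hi_le_Suc: "\<forall>\<^sub>F n in sequentially. hi n \<le> Suc n"
  using hi_le_eventually[OF zero_less_one] by eventually_elim linarith

lemma tree_mean_Y_tendsto:
  assumes \<alpha>: "\<alpha> > 0"
  shows "((\<lambda>n. tree_mean \<F> n (Y \<alpha> n) / scale n) \<longlongrightarrow> kappa / sqrt \<alpha>) (at_infinite_size \<F>)"
proof -
  let ?F = "at_infinite_size \<F>"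
  define S where "S n = sqrt (ln n) * (\<Sum>i\<in>{lo \<alpha> n..<hi n}. q i)" for n :: nat
  have S: "(S \<longlongrightarrow> kappa / sqrt \<alpha>) ?F"
    unfolding S_def[abs_def] by (intro tendsto_at_infinite_sizeI sum_q_tendsto \<alpha>)
  have "((\<lambda>n. tree_mean \<F> n (Y \<alpha> n) / scale n - S n) \<longlongrightarrow> 0) ?F"
  proof (rule tendstoI)
    fix e :: real assume e: "e > 0"
    define e' where "e' = e / (kappa / sqrt \<alpha> + 1)"
    have pos: "kappa / sqrt \<alpha> + 1 > 0" using \<alpha> kappa_pos by (simp add: add_pos_nonneg)
    have e': "e' > 0" using e pos by (simp add: e'_def)
    have "\<forall>\<^sub>F n in ?F. S n < kappa / sqrt \<alpha> + 1"
      using S by (rule order_tendstoD) simp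
    moreover have "\<forall>\<^sub>F n in ?F. total_weight \<F> n > 0"
      by (auto simp: eventually_at_infinite_size)
    ultimately show "\<forall>\<^sub>F n in ?F. dist (tree_mean \<F> n (Y \<alpha> n) / scale n - S n) 0 < e"
      using R1_eventually[OF e'] eventually_at_infinite_sizeI[OF hi_le_Suc]
        eventually_at_infinite_sizeI[OF eventually_gt_at_top[of 1]]
    proof eventually_elim
      case (elim n)
      have sc: "scale n > 0" "real n = scale n * sqrt (ln n)" using elim by (simp_all add: scale_def)
      have "\<bar>tree_mean \<F> n (Y \<alpha> n) - scale n * S n\<bar> =
          \<bar>\<Sum>k\<in>{lo \<alpha> n..<hi n}. R1 n k - n * q k\<bar>"
        using elim by (simp add: tree_mean_Y sum_subtractf sum_distrib_left[symmetric] S_def mult.assoc[symmetric] flip: sc(2))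
      also have "\<dots> \<le> (\<Sum>k\<in>{lo \<alpha> n..<hi n}. e' * (n * q k))"
        using elim by (intro order_trans[OF sum_abs] sum_mono) auto
      also have "\<dots> = e' * (scale n * S n)"
        unfolding S_def mult.assoc[symmetric, of "scale n"] sc(2)[symmetric] by (simp add: sum_distrib_left)
      also have "\<dots> < e' * (scale n * (kappa / sqrt \<alpha> + 1))"
        using elim e' sc by (intro mult_strict_left_mono) auto
      also have "\<dots> = scale n * e" using pos by (simp add: e'_def)
      finally have "\<bar>tree_mean \<F> n (Y \<alpha> n) - scale n * S n\<bar> / scale n < e"
        using sc by (simp add: field_simps)
      moreover have "\<bar>tree_mean \<F> n (Y \<alpha> n) - scale n * S n\<bar> / scale n =
          \<bar>(tree_mean \<F> n (Y \<alpha> n) - scale n * S n) / scale n\<bar>" using sc by simp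
      ultimately show ?case using sc(1) by (simp add: dist_real_def diff_divide_distrib)
    qed
  qed
  from tendsto_add[OF this S] show ?thesis by simp
qed

lemma tree_mean_Z_tendsto:
  "((\<lambda>n. tree_mean \<F> n (Z n) / scale n) \<longlongrightarrow> 0) (at_infinite_size \<F>)"
proof -
  obtain c M where c: "c > 0" and M: "\<And>n. n \<ge> M \<Longrightarrow> d dvd n - 1 \<Longrightarrow>
      (\<Sum>k\<in>{hi n..n}. q k * p (n - k) (n - k) / p n (n - 1)) \<le> c / sqrt (sqrt n)"
    using tail_bound by blast
  have lim: "(\<lambda>n::nat. c * (sqrt (ln n) / sqrt (sqrt n))) \<longlonglongrightarrow> c * 0"
    by (intro tendsto_mult_left) real_asymp
  show ?thesis
  proof (rule tendsto_sandwich[where f = "\<lambda>_. 0"])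
    show "((\<lambda>n. c * (sqrt (ln n) / sqrt (sqrt n))) \<longlongrightarrow> 0) (at_infinite_size \<F>)"
      using tendsto_at_infinite_sizeI[OF lim] by simp
    have ev: "\<forall>\<^sub>F n in at_infinite_size \<F>. total_weight \<F> n > 0 \<and> n \<ge> M \<and> n > 1"
      unfolding eventually_at_infinite_size by (intro exI[of _ "max M 2"]) auto
    show "\<forall>\<^sub>F n in at_infinite_size \<F>. 0 \<le> tree_mean \<F> n (Z n) / scale n"
      using ev
    proof eventually_elim
      case (elim n)
      have "0 \<le> scale n" using elim by (simp add: scale_def)
      then show ?case
        unfolding Z_def by (intro divide_nonneg_nonneg tree_mean_nonneg fringe_sum_nonneg) auto
    qed
    show "\<forall>\<^sub>F n in at_infinite_size \<F>. tree_mean \<F> n (Z n) / scale n \<le> c * (sqrt (ln n) / sqrt (sqrt n))"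
      using ev
    proof eventually_elim
      case (elim n)
      then have sc: "scale n > 0" "n / scale n = sqrt (ln n)" by (simp_all add: scale_def)
      have "tree_mean \<F> n (Z n) = (\<Sum>k\<le>n. of_bool (hi n \<le> k) * R1 n k)"
        unfolding Z_def tree_mean_fringe_sum[OF conjunct1[OF elim]]
        by (intro sum.cong refl tree_mean_size_R1[where P = "\<lambda>k. hi n \<le> k"])
      also have "\<dots> = (\<Sum>k\<in>{hi n..n}. R1 n k)"
        by (intro sum.mono_neutral_cong_right) auto
      also have "\<dots> = n * (\<Sum>k\<in>{hi n..n}. q k * p (n - k) (n - k) / p n (n - 1))"
        by (simp add: R1_def sum_distrib_left mult_ac)
      also have "\<dots> \<le> n * (c / sqrt (sqrt n))"
        using M[of n] elim total_weight_posD(4)[of n] by (intro mult_left_mono) auto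
      finally have "tree_mean \<F> n (Z n) / scale n \<le> n * (c / sqrt (sqrt n)) / scale n"
        using sc by (intro divide_right_mono) auto
      also have "\<dots> = (n / scale n) * (c / sqrt (sqrt n))" by simp
      finally show ?case unfolding sc(2) by (simp add: mult_ac)
    qed
  qed (rule tendsto_const)
qed

text \<open>A subtree in the band has fewer than \<open>hi n\<close> vertices, so the nested pairs
  number at most \<open>hi n\<close> times Y. Only the disjoint pairs need an exact formula.\<close>

lemma Y_square_le:
  assumes "t \<in> members_of_size \<F> n"
  shows "(Y \<alpha> n t)\<^sup>2 \<le> (1 + 2 * hi n) * Y \<alpha> n t +
    2 * disjoint_pair_sum \<F> (\<lambda>x y. of_bool (in_band \<alpha> n x) * of_bool (in_band \<alpha> n y)) n [t]"
proof -
  let ?b = "\<lambda>s. of_bool (in_band \<alpha> n s) :: real"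
  let ?xs = "fringe_list \<F> n [t]"
  have "(Y \<alpha> n t)\<^sup>2 = Y \<alpha> n t + 2 * pair_sum (\<lambda>x y. ?b x * ?b y) ?xs"
    unfolding Y_def fringe_sum_def sum_list_square
    by (intro arg_cong2[of _ _ _ _ "(+)"] arg_cong[of _ _ sum_list] map_cong) auto
  also have "pair_sum (\<lambda>x y. ?b x * ?b y) ?xs = disjoint_pair_sum \<F> (\<lambda>x y. ?b x * ?b y) n [t] +
      (\<Sum>s\<leftarrow>?xs. \<Sum>u\<leftarrow>fringe_list \<F> (tree_size \<F> s - 1) (branches \<F> s). ?b s * ?b u)"
    by (rule pair_sum_fringe_list[OF single_in_forests[OF assms]])
  also have "(\<Sum>s\<leftarrow>?xs. \<Sum>u\<leftarrow>fringe_list \<F> (tree_size \<F> s - 1) (branches \<F> s). ?b s * ?b u) \<le>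
      (\<Sum>s\<leftarrow>?xs. hi n * ?b s)"
  proof (rule sum_list_mono)
    fix s
    let ?ys = "fringe_list \<F> (tree_size \<F> s - 1) (branches \<F> s)"
    show "(\<Sum>u\<leftarrow>?ys. ?b s * ?b u) \<le> hi n * ?b s"
    proof (cases "in_band \<alpha> n s")
      case True
      have "(\<Sum>u\<leftarrow>?ys. ?b s * ?b u) \<le> (\<Sum>u\<leftarrow>?ys. 1)"
        by (rule sum_list_mono) auto
      also have "\<dots> = real (length ?ys)" by (simp add: sum_list_triv)
      also have "\<dots> \<le> hi n"
        using True length_fringe_list_le[of \<F> "tree_size \<F> s - 1" "branches \<F> s"] by linarith
      finally show ?thesis using True by simp
    qed (auto simp: sum_list_0)
  qed
  also have "(\<Sum>s\<leftarrow>?xs. hi n * ?b s) = hi n * Y \<alpha> n t"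
    by (simp add: Y_def fringe_sum_def sum_list_const_mult)
  finally show ?thesis by (simp add: algebra_simps)
qed

text \<open>The mean number of disjoint pairs is asymptotically at most half the square of n times
  the sum of q, that is, half the square of the mean of Y.\<close>

lemma tree_mean_Y_square_eventually:
  assumes e: "e > 0"
  shows "\<forall>\<^sub>F n in at_infinite_size \<F>. tree_mean \<F> n (\<lambda>t. (Y \<alpha> n t)\<^sup>2) \<le>
     (1 + 2 * hi n) * tree_mean \<F> n (Y \<alpha> n) +
     (1 + e) * (real n)\<^sup>2 * (\<Sum>k\<in>{lo \<alpha> n..<hi n}. q k)\<^sup>2"
proof -
  have "\<forall>\<^sub>F n in at_infinite_size \<F>. total_weight \<F> n > 0"
    by (auto simp: eventually_at_infinite_size)
  then show ?thesis
    using R2_eventually[OF e]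
  proof eventually_elim
    case (elim n)
    let ?b = "\<lambda>s. of_bool (in_band \<alpha> n s) :: real"
    let ?c = "\<lambda>k. of_bool (lo \<alpha> n \<le> k \<and> k < hi n) :: real"
    let ?D = "\<lambda>t. disjoint_pair_sum \<F> (\<lambda>x y. ?b x * ?b y) n [t]"
    let ?B = "{lo \<alpha> n..<hi n}"
    \<comment> \<open>Stated with R2, which contains q k * q l, so that sizes without a random tree
      are covered by \<open>tree_mean_size\<close>.\<close>
    have pair: "tree_mean \<F> k (\<lambda>u. tree_mean \<F> l (\<lambda>v. ?b u * ?b v)) * R2 n k l = ?c k * ?c l * R2 n k l" for k l
    proof -
      have "tree_mean \<F> k (\<lambda>u. tree_mean \<F> l (\<lambda>v. ?b u * ?b v)) * (q k * q l) = ?c k * ?c l * (q k * q l)"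
      proof -
        let ?m = "tree_mean \<F> l ?b"
        have "tree_mean \<F> k (\<lambda>u. tree_mean \<F> l (\<lambda>v. ?b u * ?b v)) * (q k * q l) =
            tree_mean \<F> k (\<lambda>u. ?b u * ?m) * q k * q l"
          by (simp only: tree_mean_cmult mult.assoc)
        also have "\<dots> = ?c k * q k * (?m * q l)"
          unfolding tree_mean_size[where P = "\<lambda>k. lo \<alpha> n \<le> k \<and> k < hi n"] by (simp only: mult_ac)
        also have "?m * q l = ?c l * q l"
          using tree_mean_size[of l "\<lambda>k. lo \<alpha> n \<le> k \<and> k < hi n" 1] by (simp only: mult_1_right)
        finally show ?thesis by (simp only: mult_ac)
      qed
      moreover have "R2 n k l = q k * q l *
          (real n * real (n - k - l + 1) / 2 * (p (n - k - l) (n - k - l + 1) / p n (n - 1)))"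
        by (simp add: R2_def)
      ultimately show ?thesis by (simp only: mult.assoc[symmetric])
    qed
    have "tree_mean \<F> n ?D = (\<Sum>k\<le>n. \<Sum>l\<le>n - k. ?c k * ?c l * R2 n k l)"
      using elim(1) by (simp only: tree_mean_disjoint_pair_sum pair)
    also have "\<dots> \<le> (\<Sum>k\<le>n. ?c k * (\<Sum>l\<le>n - k. ?c l * ((1 + e) * (real n)\<^sup>2 / 2 * q k * q l)))"
      unfolding sum_distrib_left mult.assoc[of "?c _"] using elim(2) by (intro sum_mono) auto
    also have "\<dots> \<le> (\<Sum>k\<le>n. ?c k * (\<Sum>l\<in>?B. (1 + e) * (real n)\<^sup>2 / 2 * q k * q l))"
      using e by (intro sum_mono mult_left_mono sum_band_le mult_nonneg_nonneg q_nonneg) auto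
    also have "\<dots> \<le> (\<Sum>k\<in>?B. \<Sum>l\<in>?B. (1 + e) * (real n)\<^sup>2 / 2 * q k * q l)"
      using e by (intro sum_band_le sum_nonneg mult_nonneg_nonneg q_nonneg) auto
    also have "\<dots> = (1 + e) * (real n)\<^sup>2 / 2 * (\<Sum>k\<in>?B. q k)\<^sup>2"
      by (simp add: power2_eq_square sum_product sum_distrib_left mult_ac)
    finally have D: "2 * tree_mean \<F> n ?D \<le> (1 + e) * (real n)\<^sup>2 * (\<Sum>k\<in>?B. q k)\<^sup>2" by simp
    have "tree_mean \<F> n (\<lambda>t. (Y \<alpha> n t)\<^sup>2) \<le> tree_mean \<F> n (\<lambda>t. (1 + 2 * hi n) * Y \<alpha> n t + 2 * ?D t)"
      by (rule tree_mean_mono[OF Y_square_le])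
    also have "\<dots> = (1 + 2 * hi n) * tree_mean \<F> n (Y \<alpha> n) + 2 * tree_mean \<F> n ?D"
      by (simp only: tree_mean_add tree_mean_cmult)
    finally show ?case using D by linarith
  qed
qed

end

section \<open>Counting classes\<close>

text \<open>For an entry in some class C, either a later entry also lies in C, which gives a pair,
  or C is not among the classes hit by later entries and increases their number.\<close>

lemma sum_of_bool_classes_le:
  assumes "finite \<C>"
  shows "(\<Sum>x\<leftarrow>xs. of_bool (x \<in> \<Union>\<C>)) \<le>
    real (card {C \<in> \<C>. C \<inter> set xs \<noteq> {}}) + pair_sum (\<lambda>x y. of_bool (\<exists>C\<in>\<C>. x \<in> C \<and> y \<in> C)) xs"
proof (induction xs)
  case (Cons x xs)
  let ?g = "\<lambda>x y. of_bool (\<exists>C\<in>\<C>. x \<in> C \<and> y \<in> C) :: real"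
  let ?H = "\<lambda>xs. {C \<in> \<C>. C \<inter> set xs \<noteq> {}}"
  have fin: "finite (?H ys)" for ys using assms by simp
  have mono: "card (?H xs) \<le> card (?H (x # xs))" by (rule card_mono[OF fin]) auto
  have nonneg: "0 \<le> (\<Sum>y\<leftarrow>xs. ?g x y)" by (rule sum_list_nonneg) auto
  have "of_bool (x \<in> \<Union>\<C>) + real (card (?H xs)) \<le> real (card (?H (x # xs))) + (\<Sum>y\<leftarrow>xs. ?g x y)"
  proof (cases "x \<in> \<Union>\<C>")
    case False
    then show ?thesis using mono nonneg by simp
  next
    case True
    then obtain C where C: "C \<in> \<C>" "x \<in> C" by blast
    show ?thesis
    proof (cases "C \<in> ?H xs")
      case True
      then obtain y where y: "y \<in> set xs" "y \<in> C" by blast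
      have "?g x y \<le> (\<Sum>y\<leftarrow>xs. ?g x y)" using y(1) by (intro member_le_sum_list) auto
      moreover have "?g x y = 1" using C y by auto
      ultimately show ?thesis using mono \<open>x \<in> \<Union>\<C>\<close> by simp
    next
      case False
      have "Suc (card (?H xs)) = card (insert C (?H xs))" using False fin by simp
      also have "\<dots> \<le> card (?H (x # xs))" using C by (intro card_mono[OF fin]) auto
      finally show ?thesis using nonneg True by simp
    qed
  qed
  then show ?case using Cons.IH by simp
qed simp

text \<open>A diagonal choice: the slack may shrink with n, slowly enough for the probabilities
  still to tend to 1.\<close>

lemma exists_null_sequence:
  fixes f :: "real \<Rightarrow> nat \<Rightarrow> real"
  assumes le: "F \<le> sequentially"
    and nonneg: "\<And>\<eta> n. 0 \<le> f \<eta> n" and le_1: "\<And>\<eta> n. f \<eta> n \<le> 1"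
    and lim: "\<And>\<eta>. \<eta> > 0 \<Longrightarrow> (f \<eta> \<longlongrightarrow> 1) F"
  shows "\<exists>\<epsilon>. (\<epsilon> \<longlongrightarrow> 0) F \<and> ((\<lambda>n. f (\<epsilon> n) n) \<longlongrightarrow> 1) F"
proof -
  \<comment> \<open>Never empty, since it contains 1. Its infimum need not be attained, so
    \<open>\<epsilon> n\<close> is chosen within 1 / (n + 1) of it.\<close>
  define S where "S n = {\<eta>. 0 < \<eta> \<and> 1 - \<eta> \<le> f \<eta> n}" for n
  have bdd: "bdd_below (S n)" for n by (rule bdd_belowI[of _ 0]) (auto simp: S_def)
  have "\<exists>\<eta>\<in>S n. \<eta> < Inf (S n) + 1 / Suc n" for n
  proof -
    have "1 \<in> S n" using nonneg by (simp add: S_def)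
    then show ?thesis
      using cInf_lessD[of "S n" "Inf (S n) + 1 / Suc n"] by auto
  qed
  then obtain \<epsilon> where \<epsilon>: "\<And>n. \<epsilon> n \<in> S n" "\<And>n. \<epsilon> n < Inf (S n) + 1 / Suc n" by metis
  have inv0: "((\<lambda>n. 1 / real (Suc n)) \<longlongrightarrow> 0) F"
    by (rule tendsto_mono[OF le]) real_asymp
  have "(\<epsilon> \<longlongrightarrow> 0) F"
  proof (rule tendstoI)
    fix e :: real assume e: "e > 0"
    have "\<forall>\<^sub>F n in F. 1 - e / 2 < f (e / 2) n" using lim[of "e / 2"] e by (intro order_tendstoD) auto
    moreover have "\<forall>\<^sub>F n in F. 1 / real (Suc n) < e / 2" using inv0 e by (intro order_tendstoD) auto
    ultimately show "\<forall>\<^sub>F n in F. dist (\<epsilon> n) 0 < e"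
    proof eventually_elim
      case (elim n)
      have "e / 2 \<in> S n" using elim e by (simp add: S_def)
      then have "Inf (S n) \<le> e / 2" using bdd by (rule cInf_lower)
      moreover have "0 < \<epsilon> n" using \<epsilon>(1)[of n] by (simp add: S_def)
      ultimately show ?case using \<epsilon>(2)[of n] elim by (simp add: dist_real_def)
    qed
  qed
  moreover have "((\<lambda>n. f (\<epsilon> n) n) \<longlongrightarrow> 1) F"
  proof (rule tendsto_sandwich)
    show "\<forall>\<^sub>F n in F. 1 - \<epsilon> n \<le> f (\<epsilon> n) n" using \<epsilon>(1) by (simp add: S_def)
    show "\<forall>\<^sub>F n in F. f (\<epsilon> n) n \<le> 1" using le_1 by simp
    show "((\<lambda>n. 1 - \<epsilon> n) \<longlongrightarrow> 1) F" using tendsto_diff[OF tendsto_const[of 1] \<open>(\<epsilon> \<longlongrightarrow> 0) F\<close>] by simp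
  qed (rule tendsto_const)
  ultimately show ?thesis by blast
qed

lemma sum_exp_tail_le:
  fixes b :: real
  assumes "b > 0"
  shows "(\<Sum>k\<in>{m..<n}. exp (- b * real k)) \<le> exp (- b * real m) / (1 - exp (- b))"
proof (cases "m \<le> n")
  case True
  have lt: "1 - exp (- b) > 0" using assms by simp
  have "(\<Sum>k\<in>{m..<n}. exp (- b * real k)) * (1 - exp (- b)) =
      (\<Sum>k\<in>{m..<n}. exp (- b * real k) - exp (- b * real (Suc k)))"
    unfolding sum_distrib_right by (intro sum.cong) (simp_all add: algebra_simps exp_add[symmetric])
  also have "\<dots> = exp (- b * real m) - exp (- b * real n)"
    using sum_Suc_diff'[OF True, of "\<lambda>k. - exp (- b * real k)"] by simp
  also have "\<dots> \<le> exp (- b * real m)" by simp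
  finally show ?thesis using lt by (simp add: pos_le_divide_eq)
qed (use assms in simp)

context conditioned_gw
begin

lemma eventually_total_weight_pos: "\<forall>\<^sub>F n in at_infinite_size \<F>. total_weight \<F> n > 0"
  by (auto simp: eventually_at_infinite_size)

text \<open>The deviation is measured from the limit constant c, not from the mean. The limits of
  the terms combine to (1 + e) c^2 - 2 c^2 + c^2 = e c^2, and the contribution of nested pairs
  vanishes because \<open>hi n\<close> is small against \<open>scale n\<close>.\<close>

lemma Y_variance_tendsto:
  assumes \<alpha>: "\<alpha> > 0"
  shows "((\<lambda>n. tree_mean \<F> n (\<lambda>t. (Y \<alpha> n t / scale n - kappa / sqrt \<alpha>)\<^sup>2)) \<longlongrightarrow> 0) (at_infinite_size \<F>)"
proof (rule tendstoI)
  let ?F = "at_infinite_size \<F>"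
  fix \<epsilon> :: real assume \<epsilon>: "\<epsilon> > 0"
  define c where "c = kappa / sqrt \<alpha>"
  define e where "e = \<epsilon> / 2 / (c\<^sup>2 + 1)"
  have c1: "c\<^sup>2 + 1 > 0" by (simp add: add_nonneg_pos)
  have e: "e > 0" using \<epsilon> c1 by (simp add: e_def)
  define S where "S n = sqrt (ln n) * (\<Sum>i\<in>{lo \<alpha> n..<hi n}. q i)" for n :: nat
  define m where "m n = tree_mean \<F> n (Y \<alpha> n) / scale n" for n
  define h where "h n = real (1 + 2 * hi n) / scale n" for n
  have S: "(S \<longlongrightarrow> c) ?F"
    unfolding S_def[abs_def] c_def by (intro tendsto_at_infinite_sizeI sum_q_tendsto \<alpha>)
  have m: "(m \<longlongrightarrow> c) ?F" unfolding m_def[abs_def] c_def by (rule tree_mean_Y_tendsto[OF \<alpha>])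
  have h: "(h \<longlongrightarrow> 0) ?F"
  proof (rule tendsto_at_infinite_sizeI, rule tendsto_sandwich[where f = "\<lambda>_. 0"])
    show "(\<lambda>n::nat. (1 + 2 * (sqrt n + 1)) / (n / sqrt (ln n))) \<longlonglongrightarrow> 0" by real_asymp
    show "\<forall>\<^sub>F n in sequentially. 0 \<le> h n"
      using eventually_scale_pos by eventually_elim (simp add: h_def)
    show "\<forall>\<^sub>F n in sequentially. h n \<le> (1 + 2 * (sqrt n + 1)) / (n / sqrt (ln n))"
      using eventually_scale_pos
    proof eventually_elim
      case (elim n)
      then show ?case using hi_bounds(2)[of n] unfolding h_def scale_def[symmetric]
        by (intro divide_right_mono) auto
    qed
  qed (rule tendsto_const)
  define B where "B n = h n * m n + (1 + e) * (S n)\<^sup>2 - 2 * c * m n + c\<^sup>2" for n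
  have "(B \<longlongrightarrow> 0 * c + (1 + e) * c\<^sup>2 - 2 * c * c + c\<^sup>2) ?F"
    unfolding B_def[abs_def] by (intro tendsto_intros h m S)
  moreover have "0 * c + (1 + e) * c\<^sup>2 - 2 * c * c + c\<^sup>2 < \<epsilon>"
  proof -
    have "0 * c + (1 + e) * c\<^sup>2 - 2 * c * c + c\<^sup>2 = e * c\<^sup>2" by (simp add: algebra_simps power2_eq_square)
    also have "\<dots> \<le> e * (c\<^sup>2 + 1)" using e by (intro mult_left_mono) auto
    also have "\<dots> = \<epsilon> / 2" using c1 e_def by (metis less_irrefl nonzero_eq_divide_eq)
    finally show ?thesis using \<epsilon> by simp
  qed
  ultimately have "\<forall>\<^sub>F n in ?F. B n < \<epsilon>" by (rule order_tendstoD)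
  then show "\<forall>\<^sub>F n in ?F. dist (tree_mean \<F> n (\<lambda>t. (Y \<alpha> n t / scale n - kappa / sqrt \<alpha>)\<^sup>2)) 0 < \<epsilon>"
    using eventually_total_weight_pos tree_mean_Y_square_eventually[OF e, of \<alpha>]
      eventually_at_infinite_sizeI[OF eventually_gt_at_top[of 1]]
  proof eventually_elim
    case (elim n)
    let ?V = "tree_mean \<F> n (\<lambda>t. (Y \<alpha> n t / scale n - c)\<^sup>2)"
    have sc: "scale n > 0" "real n / scale n = sqrt (ln n)" using elim by (simp_all add: scale_def)
    have "?V = tree_mean \<F> n (\<lambda>t. (Y \<alpha> n t)\<^sup>2 / (scale n)\<^sup>2 + (- 2 * c / scale n) * Y \<alpha> n t + c\<^sup>2)"
      by (rule tree_mean_cong) (simp add: power2_diff power_divide)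
    also have "\<dots> = tree_mean \<F> n (\<lambda>t. (Y \<alpha> n t)\<^sup>2) / (scale n)\<^sup>2 - 2 * c * m n + c\<^sup>2"
      unfolding tree_mean_add tree_mean_divide tree_mean_cmult tree_mean_const[OF elim(2)] by (simp add: m_def)
    also have "tree_mean \<F> n (\<lambda>t. (Y \<alpha> n t)\<^sup>2) / (scale n)\<^sup>2 \<le>
        ((1 + 2 * hi n) * tree_mean \<F> n (Y \<alpha> n) +
         (1 + e) * (real n)\<^sup>2 * (\<Sum>k\<in>{lo \<alpha> n..<hi n}. q k)\<^sup>2) / (scale n)\<^sup>2"
      using elim(3) by (intro divide_right_mono) auto
    also have "\<dots> = h n * m n + (1 + e) * (real n / scale n * (\<Sum>k\<in>{lo \<alpha> n..<hi n}. q k))\<^sup>2"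
    proof -
      have "(a * b + c * u\<^sup>2 * v\<^sup>2) / s\<^sup>2 = a / s * (b / s) + c * (u / s * v)\<^sup>2" for a b c u v s :: real
        by (simp add: add_divide_distrib power_mult_distrib power_divide) (simp add: power2_eq_square)
      then show ?thesis unfolding h_def m_def .
    qed
    also have "\<dots> = h n * m n + (1 + e) * (S n)\<^sup>2" unfolding sc(2) S_def ..
    finally have "?V \<le> B n" by (simp add: B_def)
    moreover have "0 \<le> ?V" by (rule tree_mean_nonneg) simp
    ultimately show ?case using elim by (simp add: dist_real_def c_def)
  qed
qed

text \<open>The passage from squares to absolute values is y \<le> e / 2 + y^2 / (e / 2).\<close>

lemma Y_deviation_tendsto:
  assumes \<alpha>: "\<alpha> > 0"
  shows "((\<lambda>n. tree_mean \<F> n (\<lambda>t. \<bar>Y \<alpha> n t / scale n - kappa / sqrt \<alpha>\<bar>)) \<longlongrightarrow> 0) (at_infinite_size \<F>)"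
proof (rule tendstoI)
  fix e :: real assume e: "e > 0"
  let ?x = "\<lambda>n t. Y \<alpha> n t / scale n - kappa / sqrt \<alpha>"
  have "\<forall>\<^sub>F n in at_infinite_size \<F>. tree_mean \<F> n (\<lambda>t. (?x n t)\<^sup>2) < e * (e / 2) / 2"
    using Y_variance_tendsto[OF \<alpha>] by (rule order_tendstoD) (use e in simp)
  then show "\<forall>\<^sub>F n in at_infinite_size \<F>. dist (tree_mean \<F> n (\<lambda>t. \<bar>?x n t\<bar>)) 0 < e"
    using eventually_total_weight_pos
  proof eventually_elim
    case (elim n)
    have "tree_mean \<F> n (\<lambda>t. \<bar>?x n t\<bar>) \<le> tree_mean \<F> n (\<lambda>t. e / 2 + (?x n t)\<^sup>2 / (e / 2))"
    proof (rule tree_mean_mono)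
      fix t
      define y where "y = \<bar>?x n t\<bar>"
      have "0 \<le> (y - e / 2)\<^sup>2 + y * (e / 2)" using e by (intro add_nonneg_nonneg) (auto simp: y_def)
      then have "y * (e / 2) \<le> (e / 2) * (e / 2) + y\<^sup>2"
        by (simp add: power2_eq_square algebra_simps)
      then have "y \<le> ((e / 2) * (e / 2) + y\<^sup>2) / (e / 2)" using e by (simp add: pos_le_divide_eq)
      also have "\<dots> = e / 2 + y\<^sup>2 / (e / 2)" using e by (simp add: add_divide_distrib)
      finally show "\<bar>?x n t\<bar> \<le> e / 2 + (?x n t)\<^sup>2 / (e / 2)" by (simp add: y_def)
    qed
    also have "\<dots> = e / 2 + tree_mean \<F> n (\<lambda>t. (?x n t)\<^sup>2) / (e / 2)"
      unfolding tree_mean_add tree_mean_divide tree_mean_const[OF elim(2)] ..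
    also have "\<dots> < e / 2 + (e * (e / 2) / 2) / (e / 2)"
      using elim(1) e by (intro add_strict_left_mono divide_strict_right_mono) auto
    also have "\<dots> = e" using e by simp
    finally have "tree_mean \<F> n (\<lambda>t. \<bar>?x n t\<bar>) < e" .
    moreover have "0 \<le> tree_mean \<F> n (\<lambda>t. \<bar>?x n t\<bar>)" by (rule tree_mean_nonneg) simp
    ultimately show ?case by (simp add: dist_real_def)
  qed
qed

end

section \<open>Upper and lower deviation bounds for the number of classes\<close>

locale class_counting = conditioned_gw \<phi> \<F> \<xi> \<sigma>2 \<tau> g
  for \<phi> :: "nat \<Rightarrow> real" and \<F> :: "('a, 'm) tree_family_scheme" and \<xi> :: "nat pmf" and \<sigma>2 \<tau> g :: real +
  fixes \<I> :: "nat \<Rightarrow> 'a set set"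
  assumes classes: "\<And>k. partition_on (members_of_size \<F> k) (\<I> k)"
begin

abbreviation "A \<equiv> num_fringe_classes \<F> \<I>"

lemma finite_classes: "finite (\<I> k)"
  using finite_elements[OF finite_members_of_size classes] .

lemma class_subset: "C \<in> \<I> k \<Longrightarrow> C \<subseteq> members_of_size \<F> k"
  using classes[of k] by (auto simp: partition_on_def)

lemma class_unique:
  assumes "C \<in> \<I> k" "C' \<in> \<I> l" "s \<in> C" "s \<in> C'"
  shows "k = l \<and> C = C'"
proof -
  have "s \<in> members_of_size \<F> k" "s \<in> members_of_size \<F> l"
    using assms class_subset by blast+
  then have "k = l" by (simp add: members_of_size_iff)
  moreover have "disjoint (\<I> k)" using classes[of k] by (simp add: partition_on_def)
  ultimately show ?thesis using assms by (auto simp: disjoint_def)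
qed

lemma fringe_size:
  assumes "t \<in> members_of_size \<F> n" "s \<in> fringe_subtrees \<F> t"
  shows "tree_size \<F> s \<le> n"
  using fringe_list_members(2)[OF single_in_forests[OF assms(1)]] assms
  by (simp add: set_fringe_list_single)

lemma finite_hit_classes:
  assumes t: "t \<in> members_of_size \<F> n"
  shows "finite {C. C \<in> (\<Union>k. \<I> k) \<and> C \<inter> fringe_subtrees \<F> t \<noteq> {}}"
proof (rule finite_subset)
  show "{C. C \<in> (\<Union>k. \<I> k) \<and> C \<inter> fringe_subtrees \<F> t \<noteq> {}} \<subseteq> (\<Union>k\<le>n. \<I> k)"
  proof
    fix C assume "C \<in> {C. C \<in> (\<Union>k. \<I> k) \<and> C \<inter> fringe_subtrees \<F> t \<noteq> {}}"
    then obtain k s where "C \<in> \<I> k" "s \<in> C" "s \<in> fringe_subtrees \<F> t" by blast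
    moreover from this have "tree_size \<F> s = k" using class_subset members_of_size_iff by blast
    ultimately show "C \<in> (\<Union>k\<le>n. \<I> k)" using fringe_size[OF t, of s] by auto
  qed
qed (auto simp: finite_classes)

text \<open>All classes of sizes below m are counted as if present; every other class is charged to
  one of the fringe subtrees representing it.\<close>

lemma num_fringe_classes_upper:
  assumes t: "t \<in> members_of_size \<F> n"
  shows "real (A t) \<le> (\<Sum>k<m. real (card (\<I> k))) +
    fringe_sum \<F> (\<lambda>s. of_bool (m \<le> tree_size \<F> s)) n t"
proof -
  define class_of where "class_of s = (SOME C. C \<in> \<I> (tree_size \<F> s) \<and> s \<in> C)" for s
  let ?xs = "filter (\<lambda>s. m \<le> tree_size \<F> s) (fringe_list \<F> n [t])"
  let ?H = "{C. C \<in> (\<Union>k. \<I> k) \<and> C \<inter> fringe_subtrees \<F> t \<noteq> {}}"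
  have "?H \<subseteq> (\<Union>k<m. \<I> k) \<union> class_of ` set ?xs"
  proof
    fix C assume "C \<in> ?H"
    then obtain k s where C: "C \<in> \<I> k" "s \<in> C" "s \<in> fringe_subtrees \<F> t" by blast
    then have k: "tree_size \<F> s = k" using class_subset members_of_size_iff by blast
    show "C \<in> (\<Union>k<m. \<I> k) \<union> class_of ` set ?xs"
    proof (cases "k < m")
      case False
      have "class_of s \<in> \<I> (tree_size \<F> s) \<and> s \<in> class_of s"
        unfolding class_of_def by (rule someI[of _ C]) (use C k in simp)
      then have "C = class_of s" using class_unique C by blast
      moreover have "s \<in> set ?xs" using C k False by (simp add: set_fringe_list_single[OF t])
      ultimately show ?thesis by blast
    qed (use C in auto)
  qed
  then have "card ?H \<le> card ((\<Union>k<m. \<I> k) \<union> class_of ` set ?xs)"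
    by (intro card_mono) (auto simp: finite_classes)
  also have "\<dots> \<le> card (\<Union>k<m. \<I> k) + card (class_of ` set ?xs)" by (rule card_Un_le)
  also have "\<dots> \<le> (\<Sum>k<m. card (\<I> k)) + length ?xs"
  proof (rule add_mono)
    show "card (\<Union>k<m. \<I> k) \<le> (\<Sum>k<m. card (\<I> k))" by (rule card_UN_le) simp
    have "card (class_of ` set ?xs) \<le> card (set ?xs)" by (rule card_image_le) simp
    also have "\<dots> \<le> length ?xs" by (rule card_length)
    finally show "card (class_of ` set ?xs) \<le> length ?xs" .
  qed
  finally have "real (A t) \<le> real ((\<Sum>k<m. card (\<I> k)) + length ?xs)"
    unfolding num_fringe_classes_def of_nat_le_iff .
  also have "real (length ?xs) = fringe_sum \<F> (\<lambda>s. of_bool (m \<le> tree_size \<F> s)) n t"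
  proof -
    have "real (length (filter P xs)) = (\<Sum>s\<leftarrow>xs. of_bool (P s))" for P and xs :: "'a list"
      by (induction xs) auto
    then show ?thesis by (simp add: fringe_sum_def)
  qed
  ultimately show ?thesis by simp
qed

text \<open>D gathers the fluctuation of Y, the number of small classes and the number of large
  subtrees. One variable with vanishing mean serves both parts of the theorem.\<close>

lemma upper_deviation:
  assumes C1: "limsup (\<lambda>k. ereal (ln (real (card (\<I> k))) / real k)) = ereal C1"
    and \<alpha>: "\<alpha> > 0" "\<alpha> * C1 < 1"
  shows "\<exists>D. (\<forall>\<^sub>F n in at_infinite_size \<F>. \<forall>t. 0 \<le> D n t) \<and>
    ((\<lambda>n. tree_mean \<F> n (D n)) \<longlongrightarrow> 0) (at_infinite_size \<F>) \<and>
    (\<forall>\<^sub>F n in at_infinite_size \<F>. \<forall>t\<in>members_of_size \<F> n.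
       real (A t) / scale n \<le> kappa / sqrt \<alpha> + D n t)"
proof -
  let ?F = "at_infinite_size \<F>"
  \<comment> \<open>Room for the limsup: eventually \<open>card (\<I> k)\<close> is below exp
    (\<beta> k), and \<open>\<alpha> * \<beta> < 1\<close> keeps the number of classes of size below
    \<open>lo \<alpha> n\<close> at n^(\<alpha> \<beta>) up to logarithms.\<close>
  obtain \<beta> where \<beta>: "\<beta> > 0" "C1 < \<beta>" "\<alpha> * \<beta> < 1"
  proof -
    have "max 0 C1 < 1 / \<alpha>" using \<alpha> by (simp add: pos_less_divide_eq mult.commute)
    then obtain \<beta> where "max 0 C1 < \<beta>" "\<beta> < 1 / \<alpha>" using dense by blast
    then show ?thesis using \<alpha> by (intro that[of \<beta>]) (auto simp: pos_less_divide_eq mult.commute)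
  qed
  have "\<forall>\<^sub>F k in sequentially. ereal (ln (real (card (\<I> k))) / real k) < ereal \<beta>"
    using C1 \<beta>(2) by (intro Limsup_lessD) simp
  then obtain M where M: "\<And>k. k \<ge> M \<Longrightarrow> ln (real (card (\<I> k))) / real k < \<beta>"
    by (auto simp: eventually_sequentially)
  have card_le: "real (card (\<I> k)) \<le> exp (\<beta> * k)" if "k \<ge> max M 1" for k
  proof (cases "card (\<I> k) = 0")
    case False
    have "ln (real (card (\<I> k))) \<le> \<beta> * k" using M[of k] that by (simp add: pos_divide_less_eq)
    then have "exp (ln (real (card (\<I> k)))) \<le> exp (\<beta> * k)" by (simp only: exp_le_cancel_iff)
    then show ?thesis using False by simp
  qed simp
  define N where "N n = (\<Sum>k<lo \<alpha> n. real (card (\<I> k)))" for n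
  \<comment> \<open>The sizes for which the exponential bound may still fail.\<close>
  define K where "K = (\<Sum>k<max M 1. real (card (\<I> k)))"
  have N_le: "N n \<le> K + real (lo \<alpha> n) * exp (\<beta> * lo \<alpha> n)" for n
  proof -
    have "N n \<le> (\<Sum>k\<in>{..<max M 1} \<union> {max M 1..<lo \<alpha> n}. real (card (\<I> k)))"
      unfolding N_def by (rule sum_mono2) auto
    also have "\<dots> = K + (\<Sum>k\<in>{max M 1..<lo \<alpha> n}. real (card (\<I> k)))"
      unfolding K_def by (rule sum.union_disjoint) auto
    also have "(\<Sum>k\<in>{max M 1..<lo \<alpha> n}. real (card (\<I> k))) \<le>
        (\<Sum>k\<in>{max M 1..<lo \<alpha> n}. exp (\<beta> * lo \<alpha> n))"
      using \<beta>(1) by (intro sum_mono order_trans[OF card_le]) auto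
    also have "\<dots> \<le> real (lo \<alpha> n) * exp (\<beta> * lo \<alpha> n)"
      by (simp add: mult_right_mono)
    finally show ?thesis by simp
  qed
  have N_lim: "(\<lambda>n. N n / scale n) \<longlonglongrightarrow> 0"
  proof (rule tendsto_sandwich[where f = "\<lambda>_. 0"])
    define \<gamma> where "\<gamma> = \<alpha> * \<beta>"
    have \<gamma>: "\<gamma> < 1" using \<beta> by (simp add: \<gamma>_def)
    have "(\<lambda>n::nat. K * (sqrt (ln n) / n) + exp \<beta> * ((\<alpha> * ln n + 1) * (sqrt (ln n) * n powr (\<gamma> - 1)))) \<longlonglongrightarrow> K * 0 + exp \<beta> * 0"
      by (intro tendsto_add tendsto_mult_left) (use \<gamma> in real_asymp)+
    then show "(\<lambda>n::nat. K * (sqrt (ln n) / n) + exp \<beta> * ((\<alpha> * ln n + 1) * (sqrt (ln n) * n powr (\<gamma> - 1)))) \<longlonglongrightarrow> 0"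
      by simp
    show "\<forall>\<^sub>F n in sequentially. 0 \<le> N n / scale n"
      using eventually_scale_pos by eventually_elim (auto simp: N_def intro!: divide_nonneg_nonneg sum_nonneg)
    show "\<forall>\<^sub>F n in sequentially. N n / scale n \<le>
        K * (sqrt (ln n) / n) + exp \<beta> * ((\<alpha> * ln n + 1) * (sqrt (ln n) * n powr (\<gamma> - 1)))"
      using eventually_gt_at_top[of 1] eventually_scale_pos
    proof eventually_elim
      case (elim n)
      have lo: "lo \<alpha> n \<le> \<alpha> * ln n + 1" using elim \<alpha> by (intro lo_bounds) auto
      have "exp (\<beta> * lo \<alpha> n) \<le> exp (\<beta> * (\<alpha> * ln n + 1))" using lo \<beta> by simp
      also have "\<dots> = exp \<beta> * n powr \<gamma>"
        using elim by (simp add: powr_def \<gamma>_def algebra_simps exp_add[symmetric])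
      finally have "real (lo \<alpha> n) * exp (\<beta> * lo \<alpha> n) \<le> (\<alpha> * ln n + 1) * (exp \<beta> * n powr \<gamma>)"
        using lo elim \<alpha> by (intro mult_mono) auto
      then have "N n \<le> K + (\<alpha> * ln n + 1) * (exp \<beta> * n powr \<gamma>)" using N_le[of n] by linarith
      then have "N n / scale n \<le> (K + (\<alpha> * ln n + 1) * (exp \<beta> * n powr \<gamma>)) / scale n"
        using elim by (intro divide_right_mono) auto
      also have "\<dots> = K * (sqrt (ln n) / n) + exp \<beta> * ((\<alpha> * ln n + 1) * (sqrt (ln n) * n powr (\<gamma> - 1)))"
      proof -
        have "(K + X * (E * W)) / (u / l) = K * (l / u) + E * (X * (l * (W / u)))" for X E W u l :: real
          by (simp add: distrib_left distrib_right add_divide_distrib mult_ac)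
        moreover have "n powr (\<gamma> - 1) = n powr \<gamma> / n" using elim by (simp add: powr_diff)
        ultimately show ?thesis unfolding scale_def by metis
      qed
      finally show ?case .
    qed
  qed (rule tendsto_const)
  define D where "D n t = \<bar>Y \<alpha> n t / scale n - kappa / sqrt \<alpha>\<bar> + (N n / scale n + Z n t / scale n)" for n t
  have "((\<lambda>n. tree_mean \<F> n (D n)) \<longlongrightarrow> 0) ?F"
  proof (rule Lim_transform_eventually)
    show "((\<lambda>n. tree_mean \<F> n (\<lambda>t. \<bar>Y \<alpha> n t / scale n - kappa / sqrt \<alpha>\<bar>) +
        (N n / scale n + tree_mean \<F> n (Z n) / scale n)) \<longlongrightarrow> 0) ?F"
      using tendsto_add[OF Y_deviation_tendsto[OF \<alpha>(1)]
        tendsto_add[OF tendsto_at_infinite_sizeI[OF N_lim] tree_mean_Z_tendsto]] by simp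
    show "\<forall>\<^sub>F n in ?F. tree_mean \<F> n (\<lambda>t. \<bar>Y \<alpha> n t / scale n - kappa / sqrt \<alpha>\<bar>) +
        (N n / scale n + tree_mean \<F> n (Z n) / scale n) = tree_mean \<F> n (D n)"
      using eventually_total_weight_pos
      by eventually_elim (simp add: D_def[abs_def] tree_mean_add tree_mean_divide tree_mean_const)
  qed
  moreover have "\<forall>\<^sub>F n in ?F. \<forall>t. 0 \<le> D n t"
    using eventually_at_infinite_sizeI[OF eventually_scale_pos]
    by eventually_elim
      (auto simp: D_def N_def Z_def intro!: add_nonneg_nonneg divide_nonneg_nonneg sum_nonneg fringe_sum_nonneg)
  moreover have "\<forall>\<^sub>F n in ?F. \<forall>t\<in>members_of_size \<F> n. real (A t) / scale n \<le> kappa / sqrt \<alpha> + D n t"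
    using eventually_at_infinite_sizeI[OF eventually_scale_pos]
  proof eventually_elim
    case (elim n)
    show ?case
    proof
      fix t assume t: "t \<in> members_of_size \<F> n"
      have "real (A t) \<le> N n + fringe_sum \<F> (\<lambda>s. of_bool (lo \<alpha> n \<le> tree_size \<F> s)) n t"
        unfolding N_def by (rule num_fringe_classes_upper[OF t])
      also have "fringe_sum \<F> (\<lambda>s. of_bool (lo \<alpha> n \<le> tree_size \<F> s)) n t \<le> Y \<alpha> n t + Z n t"
        unfolding Y_def Z_def fringe_sum_add[symmetric] unfolding fringe_sum_def
        by (rule sum_list_mono) auto
      finally have "real (A t) / scale n \<le> (N n + (Y \<alpha> n t + Z n t)) / scale n"
        using elim by (intro divide_right_mono) auto
      then show "real (A t) / scale n \<le> kappa / sqrt \<alpha> + D n t"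
        unfolding D_def add_divide_distrib by linarith
    qed
  qed
  ultimately show ?thesis by blast
qed

text \<open>Y exceeds the number of classes by at most B, the subtrees in the band that belong to no
  class of \<open>\<J>\<close>, plus P, the pairs in a common class of \<open>\<J>\<close>. The
  former are rare by \<open>C2a\<close>, the latter by \<open>C2b\<close>.\<close>

lemma lower_deviation:
  fixes \<J> :: "nat \<Rightarrow> 'a set set" and r :: "nat \<Rightarrow> real"
  assumes subclasses: "\<And>k. \<J> k \<subseteq> \<I> k"
    and C2a: "((\<lambda>k. measure_pmf.prob (random_tree \<F> k) (\<Union>(\<J> k))) \<longlongrightarrow> 1) (at_infinite_size \<F>)"
    and r: "r \<in> o(\<lambda>k. real k)"
    and C2b: "\<And>k I. total_weight \<F> k > 0 \<Longrightarrow> I \<in> \<J> k \<Longrightarrow>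
                measure_pmf.prob (random_tree \<F> k) I \<le> exp (- C2 * real k + r k)"
    and \<alpha>: "\<alpha> > 0" "\<alpha> * C2 > 1"
  shows "\<exists>D. (\<forall>\<^sub>F n in at_infinite_size \<F>. \<forall>t. 0 \<le> D n t) \<and>
    ((\<lambda>n. tree_mean \<F> n (D n)) \<longlongrightarrow> 0) (at_infinite_size \<F>) \<and>
    (\<forall>\<^sub>F n in at_infinite_size \<F>. \<forall>t\<in>members_of_size \<F> n.
       kappa / sqrt \<alpha> \<le> real (A t) / scale n + D n t)"
proof -
  let ?F = "at_infinite_size \<F>"
  define \<C> where "\<C> n = (\<Union>k\<in>{lo \<alpha> n..<hi n}. \<J> k)" for n
  define w :: "nat \<Rightarrow> 'a \<Rightarrow> 'a \<Rightarrow> real" where "w n x y = of_bool (\<exists>C\<in>\<C> n. x \<in> C \<and> y \<in> C)" for n x y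
  define B where "B n = fringe_sum \<F> (\<lambda>s. of_bool (in_band \<alpha> n s \<and> s \<notin> \<Union>(\<C> n))) n" for n
  define P where "P n t = disjoint_pair_sum \<F> (w n) n [t]" for n t
  have finite_\<C>: "finite (\<C> n)" for n
    unfolding \<C>_def using finite_subset[OF subclasses finite_classes] by auto
  have \<C>_D: "\<exists>k\<in>{lo \<alpha> n..<hi n}. C \<in> \<J> k \<and> C \<in> \<I> k \<and> C \<subseteq> members_of_size \<F> k"
    if C: "C \<in> \<C> n" for C n
  proof -
    obtain k where k: "k \<in> {lo \<alpha> n..<hi n}" "C \<in> \<J> k" using C by (auto simp: \<C>_def)
    have "C \<in> \<I> k" using k(2) subclasses[of k] by (rule subsetD[rotated])
    with k class_subset[OF this] show ?thesis by blast
  qed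

  \<comment> \<open>Nested subtrees have different sizes and never share a class, so only disjoint
    pairs remain.\<close>
  have P_eq: "pair_sum (w n) (fringe_list \<F> n [t]) = P n t" if t: "t \<in> members_of_size \<F> n" for n t
  proof -
    have zero: "w n s u = 0" if s: "s \<in> set (fringe_list \<F> n [t])"
      and u: "u \<in> set (fringe_list \<F> (tree_size \<F> s - 1) (branches \<F> s))" for s u
    proof -
      have sm: "s \<in> members \<F>" using fringe_list_members(1)[OF single_in_forests[OF t] s] .
      have "[s] \<in> forests \<F> 1 (Suc (tree_size \<F> s - 1))"
        using sm tree_size_pos[of \<F> s] by (auto simp: forests_def)
      then have "tree_size \<F> u \<le> tree_size \<F> s - 1"
        by (rule fringe_list_members(2)[OF peel_in_forests(1) u])
      then have "tree_size \<F> u \<noteq> tree_size \<F> s" using tree_size_pos[of \<F> s] by linarith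
      moreover have "tree_size \<F> s = tree_size \<F> u" if C: "C \<in> \<C> n" "s \<in> C" "u \<in> C" for C
      proof -
        obtain k where "C \<subseteq> members_of_size \<F> k" using \<C>_D[OF C(1)] by blast
        then have "s \<in> members_of_size \<F> k" "u \<in> members_of_size \<F> k" using C(2,3) by auto
        then show ?thesis by (simp add: members_of_size_iff)
      qed
      ultimately show ?thesis by (auto simp: w_def)
    qed
    have "(\<Sum>s\<leftarrow>fringe_list \<F> n [t]. \<Sum>u\<leftarrow>fringe_list \<F> (tree_size \<F> s - 1) (branches \<F> s). w n s u) =
        (\<Sum>s\<leftarrow>fringe_list \<F> n [t]. \<Sum>u\<leftarrow>fringe_list \<F> (tree_size \<F> s - 1) (branches \<F> s). 0)"
      using zero by (intro arg_cong[of _ _ sum_list] map_cong refl) auto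
    then show ?thesis
      unfolding pair_sum_fringe_list[OF single_in_forests[OF t]] P_def by (simp add: sum_list_0)
  qed

  have lower: "Y \<alpha> n t \<le> real (A t) + B n t + P n t" if t: "t \<in> members_of_size \<F> n" for n t
  proof -
    let ?xs = "fringe_list \<F> n [t]"
    have "Y \<alpha> n t \<le> (\<Sum>s\<leftarrow>?xs. of_bool (s \<in> \<Union>(\<C> n))) + B n t"
      unfolding Y_def B_def fringe_sum_def sum_list_addf[symmetric]
      by (rule sum_list_mono) auto
    also have "(\<Sum>s\<leftarrow>?xs. of_bool (s \<in> \<Union>(\<C> n))) \<le>
        real (card {C \<in> \<C> n. C \<inter> set ?xs \<noteq> {}}) + pair_sum (w n) ?xs"
      unfolding w_def by (rule sum_of_bool_classes_le[OF finite_\<C>])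
    also have "card {C \<in> \<C> n. C \<inter> set ?xs \<noteq> {}} \<le> A t"
      unfolding num_fringe_classes_def set_fringe_list_single[OF t]
      by (rule card_mono[OF finite_hit_classes[OF t]]) (use \<C>_D in blast)
    finally show ?thesis by (simp add: P_eq[OF t])
  qed

  have B_lim: "((\<lambda>n. tree_mean \<F> n (B n) / scale n) \<longlongrightarrow> 0) ?F"
  proof (rule tendstoI)
    fix \<epsilon> :: real assume \<epsilon>: "\<epsilon> > 0"
    define c where "c = kappa / sqrt \<alpha> + 1"
    define e where "e = \<epsilon> / c"
    have c: "c > 0" using kappa_pos \<alpha> by (simp add: c_def add_pos_nonneg)
    have e: "e > 0" using \<epsilon> c by (simp add: e_def)
    have "\<forall>\<^sub>F k in ?F. 1 - e < measure_pmf.prob (random_tree \<F> k) (\<Union>(\<J> k))"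
      using C2a e by (intro order_tendstoD) auto
    \<comment> \<open>Since \<open>lo \<alpha> n\<close> eventually exceeds M, this covers all sizes
      in the band at once.\<close>
    then obtain M where M: "\<And>k. k \<ge> M \<Longrightarrow> total_weight \<F> k > 0 \<Longrightarrow>
        1 - e < measure_pmf.prob (random_tree \<F> k) (\<Union>(\<J> k))"
      by (auto simp: eventually_at_infinite_size)
    have "\<forall>\<^sub>F n in ?F. tree_mean \<F> n (Y \<alpha> n) / scale n < c"
      using tree_mean_Y_tendsto[OF \<alpha>(1)] by (rule order_tendstoD) (simp add: c_def)
    then show "\<forall>\<^sub>F n in ?F. dist (tree_mean \<F> n (B n) / scale n) 0 < \<epsilon>"
      using eventually_total_weight_pos eventually_at_infinite_sizeI[OF eventually_scale_pos]
        eventually_at_infinite_sizeI[OF hi_le_Suc] eventually_at_infinite_sizeI[OF eventually_lo_hi[OF \<alpha>(1), of M]]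
    proof eventually_elim
      case (elim n)
      have "tree_mean \<F> n (B n) =
          (\<Sum>k\<le>n. tree_mean \<F> k (\<lambda>s. of_bool (in_band \<alpha> n s \<and> s \<notin> \<Union>(\<C> n))) * R1 n k)"
        unfolding B_def by (rule tree_mean_fringe_sum[OF elim(2)])
      also have "\<dots> \<le> (\<Sum>k\<le>n. of_bool (lo \<alpha> n \<le> k \<and> k < hi n) * (e * R1 n k))"
      proof (rule sum_mono)
        fix k
        let ?m = "tree_mean \<F> k (\<lambda>s. of_bool (in_band \<alpha> n s \<and> s \<notin> \<Union>(\<C> n)))"
        show "?m * R1 n k \<le> of_bool (lo \<alpha> n \<le> k \<and> k < hi n) * (e * R1 n k)"
        proof (cases "total_weight \<F> k > 0")
          case False
          then have "R1 n k = 0" using total_weight_nonneg[of k] total_weight_eq_0D[of k] by (simp add: R1_def)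
          then show ?thesis by simp
        next
          case pos: True
          have "?m \<le> of_bool (lo \<alpha> n \<le> k \<and> k < hi n) * e"
          proof (cases "lo \<alpha> n \<le> k \<and> k < hi n")
            case True
            have "\<J> k \<subseteq> \<C> n" unfolding \<C>_def by (rule UN_upper) (use True in simp)
            then have "\<Union>(\<J> k) \<subseteq> \<Union>(\<C> n)" by (rule Union_mono)
            then have "?m \<le> tree_mean \<F> k (\<lambda>s. 1 + - 1 * of_bool (s \<in> \<Union>(\<J> k)))"
              by (intro tree_mean_mono) auto
            also have "\<dots> = 1 - measure_pmf.prob (random_tree \<F> k) (\<Union>(\<J> k))"
              unfolding tree_mean_add tree_mean_cmult tree_mean_const[OF pos] prob_random_tree[OF pos] by simp
            also have "\<dots> \<le> e" using M[of k] pos True elim(5) by simp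
            finally show ?thesis using True by simp
          next
            case False
            then have "?m = 0" by (intro tree_mean_zero) (auto simp: members_of_size_iff)
            then show ?thesis using e by simp
          qed
          then have "?m * R1 n k \<le> (of_bool (lo \<alpha> n \<le> k \<and> k < hi n) * e) * R1 n k"
            by (rule mult_right_mono[OF _ R1_nonneg])
          then show ?thesis by (simp only: mult.assoc)
        qed
      qed
      also have "\<dots> \<le> (\<Sum>k\<in>{lo \<alpha> n..<hi n}. e * R1 n k)"
        using e R1_nonneg by (intro sum_band_le) simp
      also have "\<dots> = e * tree_mean \<F> n (Y \<alpha> n)"
        using elim by (simp add: tree_mean_Y sum_distrib_left)
      finally have "tree_mean \<F> n (B n) / scale n \<le> e * (tree_mean \<F> n (Y \<alpha> n) / scale n)"
        using elim by (simp add: divide_right_mono)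
      also have "\<dots> < e * c" using elim e by (intro mult_strict_left_mono) auto
      also have "\<dots> = \<epsilon>" using c by (simp add: e_def)
      finally have "tree_mean \<F> n (B n) / scale n < \<epsilon>" .
      moreover have "0 \<le> tree_mean \<F> n (B n) / scale n"
        using elim unfolding B_def
        by (intro divide_nonneg_nonneg tree_mean_nonneg fringe_sum_nonneg) auto
      ultimately show ?case by (simp add: dist_real_def)
    qed
  qed

  have w_nonneg: "0 \<le> disjoint_pair_sum \<F> (w n) m f" for n m f
    by (induction m arbitrary: f) (auto split: list.splits intro!: add_nonneg_nonneg sum_list_nonneg simp: w_def)

  \<comment> \<open>In a disjoint pair the partner of u is averaged independently of u. As classes
    are disjoint, u determines the one class that the partner has to hit, and \<open>C2b\<close>
    bounds the probability of that.\<close>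
  have w_mean: "tree_mean \<F> k (\<lambda>u. tree_mean \<F> l (w n u)) \<le>
      of_bool (l = k) * (of_bool (lo \<alpha> n \<le> k \<and> k < hi n) * exp (- C2 * real k + r k))"
    if pos: "total_weight \<F> k > 0" for n k l
  proof -
    let ?b = "of_bool (l = k) * (of_bool (lo \<alpha> n \<le> k \<and> k < hi n) * exp (- C2 * real k + r k))"
    have "tree_mean \<F> l (w n u) \<le> ?b" if u: "u \<in> members_of_size \<F> k" for u
    proof (cases "\<exists>C\<in>\<C> n. u \<in> C \<and> (\<exists>v\<in>members_of_size \<F> l. v \<in> C)")
      case False
      then have "tree_mean \<F> l (w n u) = 0" by (intro tree_mean_zero) (auto simp: w_def)
      then show ?thesis by simp
    next
      case True
      then obtain C v where C: "C \<in> \<C> n" "u \<in> C" "v \<in> members_of_size \<F> l" "v \<in> C" by blast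
      obtain k' where k': "k' \<in> {lo \<alpha> n..<hi n}" "C \<in> \<J> k'" "C \<in> \<I> k'" "C \<subseteq> members_of_size \<F> k'"
        using \<C>_D[OF C(1)] by blast
      have "u \<in> members_of_size \<F> k'" "v \<in> members_of_size \<F> k'" using C(2,4) k'(4) by auto
      then have kl: "k' = k" "l = k" using C(3) u by (simp_all add: members_of_size_iff)
      have "tree_mean \<F> k (w n u) \<le> tree_mean \<F> k (\<lambda>v. of_bool (v \<in> C))"
      proof (rule tree_mean_mono)
        fix v
        show "w n u v \<le> of_bool (v \<in> C)"
        proof (cases "\<exists>C'\<in>\<C> n. u \<in> C' \<and> v \<in> C'")
          case True
          then obtain C' where C': "C' \<in> \<C> n" "u \<in> C'" "v \<in> C'" by blast
          obtain k'' where "C' \<in> \<I> k''" using \<C>_D[OF C'(1)] by blast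
          then have "C = C'" using class_unique[OF k'(3) _ C(2) C'(2)] by simp
          then show ?thesis using C'(3) by (simp add: w_def)
        next
          case False
          then have "w n u v = 0" unfolding w_def by (simp only: of_bool_eq simp_thms if_False)
          then show ?thesis by simp
        qed
      qed
      also have "\<dots> \<le> exp (- C2 * real k + r k)"
        using C2b[OF pos, of C] k'(2) kl unfolding prob_random_tree[OF pos] by simp
      finally show ?thesis using kl k'(1) by simp
    qed
    then have "tree_mean \<F> k (\<lambda>u. tree_mean \<F> l (w n u)) \<le> tree_mean \<F> k (\<lambda>_. ?b)"
      by (rule tree_mean_mono)
    then show ?thesis by (simp only: tree_mean_const[OF pos])
  qed

  have P_lim: "((\<lambda>n. tree_mean \<F> n (P n) / scale n) \<longlongrightarrow> 0) ?F"
  proof -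
    \<comment> \<open>\<open>\<beta> < C2\<close> absorbs the term r k;
      \<open>\<alpha> * \<beta> > 1\<close> makes n^2 exp (- \<beta> * lo \<alpha> n) at most n^(2 -
      \<alpha> \<beta>), which is o(n / sqrt (log n)).\<close>
    obtain \<beta> where \<beta>: "\<beta> > 0" "\<beta> < C2" "\<alpha> * \<beta> > 1"
    proof -
      have "1 / \<alpha> < C2" using \<alpha> by (simp add: pos_divide_less_eq mult.commute)
      then obtain \<beta> where "1 / \<alpha> < \<beta>" "\<beta> < C2" using dense by blast
      moreover from this have "0 < \<beta>" using \<alpha> by (meson order_less_trans zero_less_divide_1_iff)
      ultimately show ?thesis
        using \<alpha> by (intro that[of \<beta>]) (auto simp: pos_divide_less_eq mult.commute)
    qed
    have "\<forall>\<^sub>F k in sequentially. norm (r k) \<le> (C2 - \<beta>) * norm (real k)"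
      using landau_o.smallD[OF r, of "C2 - \<beta>"] \<beta> by simp
    then obtain M where M: "\<And>k. k \<ge> M \<Longrightarrow> \<bar>r k\<bar> \<le> (C2 - \<beta>) * real k"
      by (auto simp: eventually_sequentially)
    define \<gamma> where "\<gamma> = \<alpha> * \<beta>"
    have \<gamma>: "\<gamma> > 1" using \<beta> by (simp add: \<gamma>_def)
    define G where "G = 1 / (1 - exp (- \<beta>))"
    have lim: "(\<lambda>n::nat. G * (n powr (1 - \<gamma>) * sqrt (ln n))) \<longlonglongrightarrow> G * 0"
      using \<gamma> by (intro tendsto_mult_left) real_asymp
    show ?thesis
    proof (rule tendsto_sandwich[where f = "\<lambda>_. 0"])
      show "((\<lambda>n::nat. G * (n powr (1 - \<gamma>) * sqrt (ln n))) \<longlongrightarrow> 0) ?F"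
        using tendsto_at_infinite_sizeI[OF lim] by simp
      show "\<forall>\<^sub>F n in ?F. 0 \<le> tree_mean \<F> n (P n) / scale n"
        using eventually_at_infinite_sizeI[OF eventually_scale_pos] unfolding P_def
        by eventually_elim (intro divide_nonneg_nonneg tree_mean_nonneg w_nonneg, simp)
      show "\<forall>\<^sub>F n in ?F. tree_mean \<F> n (P n) / scale n \<le> G * (n powr (1 - \<gamma>) * sqrt (ln n))"
        using eventually_total_weight_pos eventually_at_infinite_sizeI[OF eventually_gt_at_top[of 1]]
          R2_eventually[OF zero_less_one] eventually_at_infinite_sizeI[OF eventually_lo_hi[OF \<alpha>(1), of M]]
      proof eventually_elim
        case (elim n)
        have sc: "scale n > 0" "(real n)\<^sup>2 / scale n = n * sqrt (ln n)"
          using elim by (simp_all add: scale_def power2_eq_square)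
        let ?m = "\<lambda>k l. tree_mean \<F> k (\<lambda>u. tree_mean \<F> l (w n u))"
        have "tree_mean \<F> n (P n) = (\<Sum>k\<le>n. \<Sum>l\<le>n - k. ?m k l * R2 n k l)"
          unfolding P_def by (rule tree_mean_disjoint_pair_sum[OF elim(1)])
        also have "\<dots> \<le> (\<Sum>k\<le>n. \<Sum>l\<le>n - k. of_bool (l = k) *
            (of_bool (lo \<alpha> n \<le> k \<and> k < hi n) * (exp (- \<beta> * real k) * (real n)\<^sup>2)))"
        proof (intro sum_mono)
          fix k l
          show "?m k l * R2 n k l \<le> of_bool (l = k) *
            (of_bool (lo \<alpha> n \<le> k \<and> k < hi n) * (exp (- \<beta> * real k) * (real n)\<^sup>2))"
          proof (cases "total_weight \<F> k > 0")
            case False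
            then have "R2 n k l = 0" using total_weight_nonneg[of k] total_weight_eq_0D[of k] by (simp add: R2_def)
            then show ?thesis by simp
          next
            case True
            note m = w_mean[OF True, of l n]
            show ?thesis
            proof (cases "l = k \<and> lo \<alpha> n \<le> k \<and> k < hi n")
              case False
              then have "?m k l \<le> 0" using m by auto
              then have "?m k l * R2 n k l \<le> 0" using R2_nonneg by (rule mult_nonpos_nonneg)
              also have "0 \<le> of_bool (l = k) * (of_bool (lo \<alpha> n \<le> k \<and> k < hi n) * (exp (- \<beta> * real k) * (real n)\<^sup>2))"
                by simp
              finally show ?thesis .
            next
              case in_band: True
              \<comment> \<open>A crude bound is enough here: the gain comes from the exponential
                factor alone.\<close>
              have "q k \<le> 1"
                using walk_prob_le_1[of k "k - 1"] by (cases "k = 0") (auto simp: q_def divide_le_eq_1)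
              then have "q k * q k \<le> 1 * 1" by (intro mult_mono q_nonneg) auto
              then have "(real n)\<^sup>2 * (q k * q k) \<le> (real n)\<^sup>2 * 1" by (intro mult_left_mono) auto
              moreover have "R2 n k k \<le> (1 + 1) * (real n)\<^sup>2 / 2 * q k * q k" using elim(3) in_band by blast
              ultimately have R2: "R2 n k l \<le> (real n)\<^sup>2" using in_band by (simp add: mult.assoc)
              have "- C2 * real k + r k \<le> - \<beta> * real k"
                using M[of k] in_band elim(4) by (simp add: algebra_simps abs_le_iff)
              then have "exp (- C2 * real k + r k) \<le> exp (- \<beta> * real k)" by (simp only: exp_le_cancel_iff)
              moreover have "?m k l \<le> exp (- C2 * real k + r k)" using m in_band by simp
              ultimately have "?m k l \<le> exp (- \<beta> * real k)" by (rule order_trans[rotated])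
              then have "?m k l * R2 n k l \<le> exp (- \<beta> * real k) * (real n)\<^sup>2"
                using R2 by (intro mult_mono R2_nonneg) auto
              then show ?thesis using in_band by simp
            qed
          qed
        qed
        also have "\<dots> \<le> (\<Sum>k\<le>n. of_bool (lo \<alpha> n \<le> k \<and> k < hi n) * (exp (- \<beta> * real k) * (real n)\<^sup>2))"
        proof (rule sum_mono)
          fix k
          have delta: "(\<Sum>l\<le>n - k. of_bool (l = k) * x) = (if k \<le> n - k then x else 0)" for x :: real
          proof -
            have "(\<Sum>l\<le>n - k. of_bool (l = k) * x) = (\<Sum>l\<le>n - k. if l = k then x else 0)"
              by (intro sum.cong) auto
            then show ?thesis by simp
          qed
          show "(\<Sum>l\<le>n - k. of_bool (l = k) *
              (of_bool (lo \<alpha> n \<le> k \<and> k < hi n) * (exp (- \<beta> * real k) * (real n)\<^sup>2))) \<le>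
              of_bool (lo \<alpha> n \<le> k \<and> k < hi n) * (exp (- \<beta> * real k) * (real n)\<^sup>2)"
            unfolding delta by simp
        qed
        also have "\<dots> \<le> (\<Sum>k\<in>{lo \<alpha> n..<hi n}. exp (- \<beta> * real k) * (real n)\<^sup>2)"
          by (rule sum_band_le) simp
        also have "\<dots> = (\<Sum>k\<in>{lo \<alpha> n..<hi n}. exp (- \<beta> * real k)) * (real n)\<^sup>2"
          by (simp add: sum_distrib_right)
        also have "\<dots> \<le> (exp (- \<beta> * lo \<alpha> n) / (1 - exp (- \<beta>))) * (real n)\<^sup>2"
          using sum_exp_tail_le[OF \<beta>(1)] by (intro mult_right_mono) auto
        also have "\<dots> \<le> (n powr (- \<gamma>) / (1 - exp (- \<beta>))) * (real n)\<^sup>2"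
        proof (intro mult_right_mono divide_right_mono)
          have "\<alpha> * ln n \<le> lo \<alpha> n" using elim \<alpha> by (intro lo_bounds) auto
          then have "\<beta> * (\<alpha> * ln n) \<le> \<beta> * lo \<alpha> n" using \<beta> by (intro mult_left_mono) auto
          then show "exp (- \<beta> * lo \<alpha> n) \<le> n powr (- \<gamma>)"
            using elim by (simp add: powr_def \<gamma>_def mult_ac)
        qed (use \<beta> in auto)
        finally have "tree_mean \<F> n (P n) / scale n \<le>
            (n powr (- \<gamma>) / (1 - exp (- \<beta>))) * (real n)\<^sup>2 / scale n"
          using sc by (intro divide_right_mono) auto
        also have "\<dots> = G * (n powr (- \<gamma>) * ((real n)\<^sup>2 / scale n))" by (simp add: G_def)
        also have "\<dots> = G * (n powr (1 - \<gamma>) * sqrt (ln n))"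
        proof -
          have "real n powr (1 - \<gamma>) = n * n powr (- \<gamma>)"
            using elim powr_add[of n 1 "- \<gamma>"] by simp
          then show ?thesis unfolding sc(2) by (simp only: mult_ac)
        qed
        finally show ?case .
      qed
    qed (rule tendsto_const)
  qed

  define D where "D n t = \<bar>Y \<alpha> n t / scale n - kappa / sqrt \<alpha>\<bar> + (B n t / scale n + P n t / scale n)" for n t
  have "((\<lambda>n. tree_mean \<F> n (D n)) \<longlongrightarrow> 0) ?F"
    using tendsto_add[OF Y_deviation_tendsto[OF \<alpha>(1)] tendsto_add[OF B_lim P_lim]]
    by (simp add: D_def[abs_def] tree_mean_add tree_mean_divide)
  moreover have "\<forall>\<^sub>F n in ?F. \<forall>t. 0 \<le> D n t"
    using eventually_at_infinite_sizeI[OF eventually_scale_pos]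
  proof eventually_elim
    case (elim n)
    show ?case using elim w_nonneg
      by (auto simp: D_def B_def P_def intro!: add_nonneg_nonneg divide_nonneg_nonneg fringe_sum_nonneg)
  qed
  moreover have "\<forall>\<^sub>F n in ?F. \<forall>t\<in>members_of_size \<F> n. kappa / sqrt \<alpha> \<le> real (A t) / scale n + D n t"
    using eventually_at_infinite_sizeI[OF eventually_scale_pos]
  proof eventually_elim
    case (elim n)
    show ?case
    proof
      fix t assume t: "t \<in> members_of_size \<F> n"
      have "Y \<alpha> n t / scale n \<le> (real (A t) + B n t + P n t) / scale n"
        using elim lower[OF t] by (intro divide_right_mono) auto
      then show "kappa / sqrt \<alpha> \<le> real (A t) / scale n + D n t"
        unfolding D_def add_divide_distrib by linarith
    qed
  qed
  ultimately show ?thesis by blast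
qed

end

text \<open>Every finite tree has a leaf, which contributes the factor \<open>\<phi> 0 = 0\<close>.
  In the theorem this rules out variance 0.\<close>

lemma (in sg_family) total_weight_eq_0_degenerate:
  assumes "\<And>m. m \<noteq> 1 \<Longrightarrow> \<phi> m = 0"
  shows "total_weight \<F> n = 0"
proof (cases "n = 0")
  case True
  then show ?thesis by (simp add: total_weight_def)
next
  case False
  have "Abs_fps \<phi> = fps_const (\<phi> 1) * fps_X"
    using assms by (intro fps_ext) (auto simp: fps_X_def)
  then have "Abs_fps \<phi> ^ n = fps_const (\<phi> 1 ^ n) * fps_X ^ n"
    by (simp add: power_mult_distrib fps_const_power)
  then have "fps_nth (Abs_fps \<phi> ^ n) (n - 1) = 0" using False by (simp add: fps_X_power_nth)
  then have "cf \<phi> 0 1 n = 0" using False by (simp add: cf_def)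
  then show ?thesis
    using sum_forest_weight[of n 1] sum_forests_single[where n = n and G = "\<lambda>_. 1"] False
    by (simp add: total_weight_eq)
qed

lemma at_infinite_size_eq_bot: "(\<And>n. total_weight \<F> n = 0) \<Longrightarrow> at_infinite_size \<F> = bot"
  by (simp add: at_infinite_size_def)

section \<open>The theorem\<close>

text \<open>Turns bounds with an arbitrary fixed slack \<open>\<eta>\<close> into the form (1 +
  o(1)) and combines the upper with the lower estimate.\<close>

lemma (in class_counting) expectation_and_probability:
  fixes c1 c2 :: real
  assumes nontrivial: "at_infinite_size \<F> \<noteq> bot" and c2: "c2 > 0"
    and upper: "\<And>\<eta>. \<eta> > 0 \<Longrightarrow> \<exists>D. (\<forall>\<^sub>F n in at_infinite_size \<F>. \<forall>t. 0 \<le> D n t) \<and>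
      ((\<lambda>n. tree_mean \<F> n (D n)) \<longlongrightarrow> 0) (at_infinite_size \<F>) \<and>
      (\<forall>\<^sub>F n in at_infinite_size \<F>. \<forall>t\<in>members_of_size \<F> n. real (A t) / scale n \<le> c1 + \<eta> + D n t)"
    and lower: "\<And>\<eta>. 0 < \<eta> \<Longrightarrow> \<eta> < c2 \<Longrightarrow> \<exists>D. (\<forall>\<^sub>F n in at_infinite_size \<F>. \<forall>t. 0 \<le> D n t) \<and>
      ((\<lambda>n. tree_mean \<F> n (D n)) \<longlongrightarrow> 0) (at_infinite_size \<F>) \<and>
      (\<forall>\<^sub>F n in at_infinite_size \<F>. \<forall>t\<in>members_of_size \<F> n. c2 - \<eta> \<le> real (A t) / scale n + D n t)"
  shows "(\<exists>\<epsilon> \<delta>. (\<epsilon> \<longlongrightarrow> 0) (at_infinite_size \<F>) \<and> (\<delta> \<longlongrightarrow> 0) (at_infinite_size \<F>) \<and>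
       (\<forall>\<^sub>F n in at_infinite_size \<F>.
          c2 * scale n * (1 + \<epsilon> n) \<le> measure_pmf.expectation (random_tree \<F> n) (\<lambda>t. real (A t)) \<and>
          measure_pmf.expectation (random_tree \<F> n) (\<lambda>t. real (A t)) \<le> c1 * scale n * (1 + \<delta> n)))
     \<and>
     (\<exists>\<epsilon> \<delta>. (\<epsilon> \<longlongrightarrow> 0) (at_infinite_size \<F>) \<and> (\<delta> \<longlongrightarrow> 0) (at_infinite_size \<F>) \<and>
       ((\<lambda>n. measure_pmf.prob (random_tree \<F> n)
          {t. c2 * scale n * (1 + \<epsilon> n) \<le> real (A t) \<and> real (A t) \<le> c1 * scale n * (1 + \<delta> n)})
        \<longlongrightarrow> 1) (at_infinite_size \<F>))"
proof -
  let ?F = "at_infinite_size \<F>"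
  define m where "m n = tree_mean \<F> n (\<lambda>t. real (A t)) / scale n" for n
  have up_mean: "\<forall>\<^sub>F n in ?F. m n \<le> c1 + \<eta>" if \<eta>: "\<eta> > 0" for \<eta>
  proof -
    obtain D where D: "((\<lambda>n. tree_mean \<F> n (D n)) \<longlongrightarrow> 0) ?F"
      "\<forall>\<^sub>F n in ?F. \<forall>t\<in>members_of_size \<F> n. real (A t) / scale n \<le> c1 + \<eta> / 2 + D n t"
      using upper[of "\<eta> / 2"] \<eta> by auto
    have "\<forall>\<^sub>F n in ?F. tree_mean \<F> n (D n) < \<eta> / 2" using D(1) \<eta> by (intro order_tendstoD) auto
    then show ?thesis using D(2) eventually_total_weight_pos
    proof eventually_elim
      case (elim n)
      have "m n = tree_mean \<F> n (\<lambda>t. real (A t) / scale n)" by (simp add: m_def tree_mean_divide)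
      also have "\<dots> \<le> tree_mean \<F> n (\<lambda>t. (c1 + \<eta> / 2) + D n t)"
        using elim(2) by (intro tree_mean_mono) blast
      also have "\<dots> = (c1 + \<eta> / 2) + tree_mean \<F> n (D n)"
        unfolding tree_mean_add tree_mean_const[OF elim(3)] ..
      finally show ?case using elim(1) by simp
    qed
  qed
  have low_mean: "\<forall>\<^sub>F n in ?F. c2 - \<eta> \<le> m n" if \<eta>: "\<eta> > 0" for \<eta>
  proof -
    define \<eta>' where "\<eta>' = min (\<eta> / 2) (c2 / 2)"
    have \<eta>': "0 < \<eta>'" "\<eta>' < c2" "\<eta>' \<le> \<eta> / 2" using \<eta> c2 by (auto simp: \<eta>'_def)
    obtain D where D: "((\<lambda>n. tree_mean \<F> n (D n)) \<longlongrightarrow> 0) ?F"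
      "\<forall>\<^sub>F n in ?F. \<forall>t\<in>members_of_size \<F> n. c2 - \<eta>' \<le> real (A t) / scale n + D n t"
      using lower[OF \<eta>'(1,2)] by auto
    have "\<forall>\<^sub>F n in ?F. tree_mean \<F> n (D n) < \<eta> / 2" using D(1) \<eta> by (intro order_tendstoD) auto
    then show ?thesis using D(2) eventually_total_weight_pos
    proof eventually_elim
      case (elim n)
      have "c2 - \<eta>' = tree_mean \<F> n (\<lambda>t. c2 - \<eta>')" using tree_mean_const[OF elim(3)] by simp
      also have "\<dots> \<le> tree_mean \<F> n (\<lambda>t. real (A t) / scale n + D n t)"
        using elim(2) by (intro tree_mean_mono) blast
      also have "\<dots> = m n + tree_mean \<F> n (D n)"
        unfolding tree_mean_add tree_mean_divide m_def ..
      finally show ?case using elim(1) \<eta>' by simp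
    qed
  qed
  \<comment> \<open>The filter is nontrivial, so both bounds hold at a common size. Through c2 > 0
    this yields c1 > 0, and relative errors with respect to c1 make sense.\<close>
  have c12: "c2 \<le> c1"
  proof (rule field_le_epsilon)
    fix e :: real assume "e > 0"
    then have "\<forall>\<^sub>F n in ?F. c2 - e / 2 \<le> m n \<and> m n \<le> c1 + e / 2"
      using low_mean[of "e / 2"] up_mean[of "e / 2"] by (simp add: eventually_conj)
    then obtain n where "c2 - e / 2 \<le> m n \<and> m n \<le> c1 + e / 2"
      using eventually_happens'[OF nontrivial] by blast
    then show "c2 \<le> c1 + e" by linarith
  qed
  then have c1: "c1 > 0" using c2 by simp
  have part1: "\<exists>\<epsilon> \<delta>. (\<epsilon> \<longlongrightarrow> 0) ?F \<and> (\<delta> \<longlongrightarrow> 0) ?F \<and>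
       (\<forall>\<^sub>F n in ?F.
          c2 * scale n * (1 + \<epsilon> n) \<le> measure_pmf.expectation (random_tree \<F> n) (\<lambda>t. real (A t)) \<and>
          measure_pmf.expectation (random_tree \<F> n) (\<lambda>t. real (A t)) \<le> c1 * scale n * (1 + \<delta> n))"
  proof (intro exI conjI)
    \<comment> \<open>The exact relative deviation, cut off at 0 so that the one-sided bound
      \<open>low_mean\<close> forces it to vanish.\<close>
    show "((\<lambda>n. min 0 (m n / c2 - 1)) \<longlongrightarrow> 0) ?F"
    proof (rule tendstoI)
      fix e :: real assume e: "e > 0"
      then have "\<forall>\<^sub>F n in ?F. c2 - c2 * e / 2 \<le> m n" using c2 by (intro low_mean) simp
      then show "\<forall>\<^sub>F n in ?F. dist (min 0 (m n / c2 - 1)) 0 < e"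
      proof eventually_elim
        case (elim n)
        then have "1 - e / 2 \<le> m n / c2" using c2 by (simp add: field_simps)
        then show ?case using e by (auto simp: dist_real_def min_def)
      qed
    qed
    show "((\<lambda>n. max 0 (m n / c1 - 1)) \<longlongrightarrow> 0) ?F"
    proof (rule tendstoI)
      fix e :: real assume e: "e > 0"
      then have "\<forall>\<^sub>F n in ?F. m n \<le> c1 + c1 * e / 2" using c1 by (intro up_mean) simp
      then show "\<forall>\<^sub>F n in ?F. dist (max 0 (m n / c1 - 1)) 0 < e"
      proof eventually_elim
        case (elim n)
        then have "m n / c1 \<le> 1 + e / 2" using c1 by (simp add: field_simps)
        then show ?case using e by (auto simp: dist_real_def max_def)
      qed
    qed
    show "\<forall>\<^sub>F n in ?F.
        c2 * scale n * (1 + min 0 (m n / c2 - 1)) \<le> measure_pmf.expectation (random_tree \<F> n) (\<lambda>t. real (A t)) \<and>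
        measure_pmf.expectation (random_tree \<F> n) (\<lambda>t. real (A t)) \<le> c1 * scale n * (1 + max 0 (m n / c1 - 1))"
      using eventually_total_weight_pos eventually_at_infinite_sizeI[OF eventually_scale_pos]
    proof eventually_elim
      case (elim n)
      have E: "measure_pmf.expectation (random_tree \<F> n) (\<lambda>t. real (A t)) = scale n * m n"
        using elim by (simp add: expectation_random_tree m_def)
      have "c2 * scale n * (1 + min 0 (m n / c2 - 1)) \<le> c2 * scale n * (m n / c2)"
        using elim c2 by (intro mult_left_mono) auto
      moreover have "c1 * scale n * (m n / c1) \<le> c1 * scale n * (1 + max 0 (m n / c1 - 1))"
        using elim c1 by (intro mult_left_mono) auto
      ultimately show ?case unfolding E using c1 c2 by (simp add: mult.commute)
    qed
  qed
  define good where "good \<eta> n =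
    {t. c2 * scale n * (1 + - \<eta>) \<le> real (A t) \<and> real (A t) \<le> c1 * scale n * (1 + \<eta>)}" for \<eta> n
  have "((\<lambda>n. measure_pmf.prob (random_tree \<F> n) (good \<eta> n)) \<longlongrightarrow> 1) ?F" if \<eta>: "\<eta> > 0" for \<eta>
  proof -
    define e1 where "e1 = c1 * \<eta> / 2"
    define e2 where "e2 = min (c2 * \<eta> / 2) (c2 / 2)"
    have e1: "e1 > 0" using c1 \<eta> by (simp add: e1_def)
    have e2: "e2 > 0" "e2 < c2" "e2 \<le> c2 * \<eta> / 2" using c2 \<eta> by (auto simp: e2_def)
    obtain D1 where D1: "\<forall>\<^sub>F n in ?F. \<forall>t. 0 \<le> D1 n t" "((\<lambda>n. tree_mean \<F> n (D1 n)) \<longlongrightarrow> 0) ?F"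
      "\<forall>\<^sub>F n in ?F. \<forall>t\<in>members_of_size \<F> n. real (A t) / scale n \<le> c1 + e1 + D1 n t"
      using upper[OF e1] by blast
    obtain D2 where D2: "\<forall>\<^sub>F n in ?F. \<forall>t. 0 \<le> D2 n t" "((\<lambda>n. tree_mean \<F> n (D2 n)) \<longlongrightarrow> 0) ?F"
      "\<forall>\<^sub>F n in ?F. \<forall>t\<in>members_of_size \<F> n. c2 - e2 \<le> real (A t) / scale n + D2 n t"
      using lower[OF e2(1,2)] by blast
    show ?thesis
    proof (rule tendsto_sandwich)
      have "((\<lambda>n. 1 - (tree_mean \<F> n (D1 n) / e1 + tree_mean \<F> n (D2 n) / e2)) \<longlongrightarrow> 1 - (0 / e1 + 0 / e2)) ?F"
        by (intro tendsto_intros D1 D2) (use e1 e2 in auto)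
      then show "((\<lambda>n. 1 - (tree_mean \<F> n (D1 n) / e1 + tree_mean \<F> n (D2 n) / e2)) \<longlongrightarrow> 1) ?F" by simp
      show "\<forall>\<^sub>F n in ?F. 1 - (tree_mean \<F> n (D1 n) / e1 + tree_mean \<F> n (D2 n) / e2) \<le>
          measure_pmf.prob (random_tree \<F> n) (good \<eta> n)"
        using D1(1,3) D2(1,3) eventually_total_weight_pos eventually_at_infinite_sizeI[OF eventually_scale_pos]
      proof eventually_elim
        case (elim n)
        have "1 - (tree_mean \<F> n (D1 n) / e1 + tree_mean \<F> n (D2 n) / e2) =
            tree_mean \<F> n (\<lambda>t. 1 + - 1 * (D1 n t / e1 + D2 n t / e2))"
          unfolding tree_mean_add tree_mean_cmult tree_mean_divide tree_mean_const[OF elim(5)] by simp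
        also have "\<dots> \<le> tree_mean \<F> n (\<lambda>t. of_bool (t \<in> good \<eta> n))"
        proof (rule tree_mean_mono)
          fix t assume t: "t \<in> members_of_size \<F> n"
          have nonneg: "0 \<le> D1 n t / e1" "0 \<le> D2 n t / e2" using elim(1,3) e1 e2 by auto
          show "1 + - 1 * (D1 n t / e1 + D2 n t / e2) \<le> of_bool (t \<in> good \<eta> n)"
          \<comment> \<open>Markov's inequality in pointwise form: where an error exceeds its bound,
            the left-hand side is at most 0.\<close>
          proof (cases "D1 n t \<le> e1 \<and> D2 n t \<le> e2")
            case False
            then have "1 \<le> D1 n t / e1 \<or> 1 \<le> D2 n t / e2" using e1 e2 by auto
            then have "1 + - 1 * (D1 n t / e1 + D2 n t / e2) \<le> 0" using nonneg by auto
            also have "0 \<le> (of_bool (t \<in> good \<eta> n) :: real)" by simp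
            finally show ?thesis .
          next
            case True
            have "real (A t) / scale n \<le> c1 * (1 + \<eta>)"
              using elim(2) t True unfolding e1_def by (force simp: algebra_simps)
            then have "real (A t) \<le> c1 * scale n * (1 + \<eta>)"
              using elim(6) by (simp add: pos_divide_le_eq mult_ac)
            moreover have "c2 * (1 + - \<eta>) \<le> real (A t) / scale n"
            proof -
              have "c2 - e2 \<le> real (A t) / scale n + D2 n t" using elim(4) t by blast
              then have "c2 - c2 * \<eta> \<le> real (A t) / scale n" using True e2(3) by linarith
              then show ?thesis by (simp add: algebra_simps)
            qed
            then have "c2 * scale n * (1 + - \<eta>) \<le> real (A t)"
              using elim(6) by (simp add: pos_le_divide_eq mult_ac)
            ultimately show ?thesis using nonneg by (simp add: good_def)
          qed
        qed
        finally show ?case unfolding prob_random_tree[OF elim(5)] .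
      qed
      show "\<forall>\<^sub>F n in ?F. measure_pmf.prob (random_tree \<F> n) (good \<eta> n) \<le> 1" by simp
    qed (rule tendsto_const)
  qed
  then obtain \<epsilon> where \<epsilon>: "(\<epsilon> \<longlongrightarrow> 0) ?F"
    "((\<lambda>n. measure_pmf.prob (random_tree \<F> n) (good (\<epsilon> n) n)) \<longlongrightarrow> 1) ?F"
    using exists_null_sequence[OF at_infinite_size_le, of "\<lambda>\<eta> n. measure_pmf.prob (random_tree \<F> n) (good \<eta> n)"]
    by auto
  show ?thesis
  proof (rule conjI[OF part1], intro exI conjI)
    show "((\<lambda>n. - \<epsilon> n) \<longlongrightarrow> 0) ?F" using tendsto_minus[OF \<epsilon>(1)] by simp
    show "((\<lambda>n. measure_pmf.prob (random_tree \<F> n)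
        {t. c2 * scale n * (1 + - \<epsilon> n) \<le> real (A t) \<and> real (A t) \<le> c1 * scale n * (1 + \<epsilon> n)})
        \<longlongrightarrow> 1) ?F"
      using \<epsilon>(2) unfolding good_def .
  qed (rule \<epsilon>(1))
qed

theorem theorem1:
  fixes \<phi> :: "nat \<Rightarrow> real" and \<F> :: "'a tree_family" and \<tau> \<sigma> \<kappa> C1 C2 :: real
    and \<xi> :: "nat pmf" and \<I> \<J> :: "nat \<Rightarrow> 'a set set" and r :: "nat \<Rightarrow> real" and A :: "'a \<Rightarrow> nat"
  assumes family: "simply_generated \<phi> \<F>"
    and critical: "is_critical \<phi> \<tau>"
    and offspring: "\<And>m. pmf \<xi> m = \<phi> m * \<tau> ^ m / gen_fun \<phi> \<tau>"
    and mean: "measure_pmf.expectation \<xi> real = 1"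
    and finite_variance: "integrable (measure_pmf \<xi>) (\<lambda>m. (real m)\<^sup>2)"
    and variance: "measure_pmf.variance \<xi> real = \<sigma>\<^sup>2"
    and classes: "\<And>k. partition_on (members_of_size \<F> k) (\<I> k)"
    and C1: "limsup (\<lambda>k. ereal (ln (real (card (\<I> k))) / real k)) = ereal C1"
    and "C2 > 0"
    and subclasses: "\<And>k. \<J> k \<subseteq> \<I> k"
    and C2a: "((\<lambda>k. measure_pmf.prob (random_tree \<F> k) (\<Union>(\<J> k))) \<longlongrightarrow> 1) (at_infinite_size \<F>)"
    and r: "r \<in> o(\<lambda>k. real k)"
    and C2b: "\<And>k I. total_weight \<F> k > 0 \<Longrightarrow> I \<in> \<J> k \<Longrightarrow>
                measure_pmf.prob (random_tree \<F> k) I \<le> exp (- C2 * real k + r k)"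
    and \<kappa>: "\<kappa> = sqrt (2 / (pi * \<sigma>\<^sup>2))"
    and A: "A = num_fringe_classes \<F> \<I>"
  shows
    "(\<exists>\<epsilon> \<delta>. (\<epsilon> \<longlongrightarrow> 0) (at_infinite_size \<F>) \<and> (\<delta> \<longlongrightarrow> 0) (at_infinite_size \<F>) \<and>
       (\<forall>\<^sub>F n in at_infinite_size \<F>.
          \<kappa> * sqrt C2 * real n / sqrt (ln (real n)) * (1 + \<epsilon> n)
            \<le> measure_pmf.expectation (random_tree \<F> n) (\<lambda>t. real (A t)) \<and>
          measure_pmf.expectation (random_tree \<F> n) (\<lambda>t. real (A t))
            \<le> \<kappa> * sqrt C1 * real n / sqrt (ln (real n)) * (1 + \<delta> n)))
     \<and>
     (\<exists>\<epsilon> \<delta>. (\<epsilon> \<longlongrightarrow> 0) (at_infinite_size \<F>) \<and> (\<delta> \<longlongrightarrow> 0) (at_infinite_size \<F>) \<and>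
       ((\<lambda>n. measure_pmf.prob (random_tree \<F> n)
          {t. \<kappa> * sqrt C2 * real n / sqrt (ln (real n)) * (1 + \<epsilon> n) \<le> real (A t) \<and>
              real (A t) \<le> \<kappa> * sqrt C1 * real n / sqrt (ln (real n)) * (1 + \<delta> n)})
        \<longlongrightarrow> 1) (at_infinite_size \<F>))"
proof (cases "at_infinite_size \<F> = bot")
  \<comment> \<open>No arbitrarily large size admits a random tree, and every limit along the
    trivial filter holds.\<close>
  case True
  then show ?thesis by simp
next
  case nontrivial: False
  interpret sg_family \<phi> \<F> by unfold_locales (rule family)
  have \<tau>: "\<tau> > 0" using critical by (simp add: is_critical_def)
  \<comment> \<open>If this value were not positive, no offspring number could have positive
    probability.\<close>
  have g: "gen_fun \<phi> \<tau> > 0"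
  proof -
    obtain m where "m \<in> set_pmf \<xi>" using set_pmf_not_empty[of \<xi>] by blast
    then have "pmf \<xi> m > 0" by (rule pmf_positive)
    moreover have "\<phi> m * \<tau> ^ m \<ge> 0" using \<tau> phi_nonneg by simp
    ultimately show ?thesis unfolding offspring by (auto simp: zero_less_divide_iff)
  qed
  have "\<sigma>\<^sup>2 > 0"
  \<comment> \<open>Variance 0 and mean 1 force exactly one child per vertex, so there would be no
    finite trees of positive weight.\<close>
  proof (rule ccontr)
    assume "\<not> \<sigma>\<^sup>2 > 0"
    then have "measure_pmf.expectation \<xi> (\<lambda>m. (real m - 1)\<^sup>2) = 0"
      using variance mean by simp
    moreover have "integrable (measure_pmf \<xi>) real"
      by (rule measure_pmf.square_integrable_imp_integrable[OF _ finite_variance]) simp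
    then have "integrable (measure_pmf \<xi>) (\<lambda>m. (real m - 1)\<^sup>2)"
      using finite_variance by (simp add: power2_diff)
    ultimately have "AE m in measure_pmf \<xi>. (real m - 1)\<^sup>2 = 0"
      by (subst integral_nonneg_eq_0_iff_AE[symmetric]) auto
    then have "\<phi> m = 0" if "m \<noteq> 1" for m
      using that \<tau> g offspring[of m] by (auto simp: AE_measure_pmf_iff set_pmf_iff)
    then have "total_weight \<F> n = 0" for n by (rule total_weight_eq_0_degenerate)
    then show False using nontrivial at_infinite_size_eq_bot by blast
  qed
  interpret class_counting \<phi> \<F> \<xi> "\<sigma>\<^sup>2" \<tau> "gen_fun \<phi> \<tau>" \<I>
    by unfold_locales (use mean finite_variance variance \<open>\<sigma>\<^sup>2 > 0\<close> \<tau> g offspring classes in auto)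
  have kappa: "\<kappa> = kappa" by (simp add: \<kappa> kappa_def)
  have C1_nonneg: "C1 \<ge> 0"
  proof -
    \<comment> \<open>For sizes without classes the convention \<open>ln 0 = 0\<close>
      applies.\<close>
    have "0 \<le> ln (real (card (\<I> k))) / real k" for k
      by (cases "card (\<I> k) = 0") auto
    then have "0 \<le> limsup (\<lambda>k. ereal (ln (real (card (\<I> k))) / real k))"
      by (intro le_Limsup) auto
    then show ?thesis unfolding C1 by simp
  qed
  have upper: "\<exists>D. (\<forall>\<^sub>F n in at_infinite_size \<F>. \<forall>t. 0 \<le> D n t) \<and>
      ((\<lambda>n. tree_mean \<F> n (D n)) \<longlongrightarrow> 0) (at_infinite_size \<F>) \<and>
      (\<forall>\<^sub>F n in at_infinite_size \<F>. \<forall>t\<in>members_of_size \<F> n.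
         real (num_fringe_classes \<F> \<I> t) / scale n \<le> kappa * sqrt C1 + \<eta> + D n t)" if \<eta>: "\<eta> > 0" for \<eta>
  proof -
    \<comment> \<open>The slack is moved into the threshold: \<open>\<alpha> = 1 / s\<^sup>2\<close>
      satisfies \<open>\<alpha> * C1 < 1\<close>, and kappa / sqrt \<alpha> = kappa * s is exactly
      the required bound.\<close>
    define s where "s = sqrt C1 + \<eta> / kappa"
    have s: "s > 0" "kappa * s = kappa * sqrt C1 + \<eta>" "sqrt C1 < s"
      using \<eta> kappa_pos C1_nonneg by (auto simp: s_def distrib_left intro: add_nonneg_pos)
    have "(sqrt C1)\<^sup>2 < s\<^sup>2" using s C1_nonneg by (intro power_strict_mono) auto
    then have "(1 / s\<^sup>2) * C1 < 1" using s(1) C1_nonneg by simp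
    moreover have "kappa / sqrt (1 / s\<^sup>2) = kappa * s" using s(1) by (simp add: real_sqrt_divide)
    ultimately show ?thesis using upper_deviation[OF C1, of "1 / s\<^sup>2"] s by simp
  qed
  have lower: "\<exists>D. (\<forall>\<^sub>F n in at_infinite_size \<F>. \<forall>t. 0 \<le> D n t) \<and>
      ((\<lambda>n. tree_mean \<F> n (D n)) \<longlongrightarrow> 0) (at_infinite_size \<F>) \<and>
      (\<forall>\<^sub>F n in at_infinite_size \<F>. \<forall>t\<in>members_of_size \<F> n.
         kappa * sqrt C2 - \<eta> \<le> real (num_fringe_classes \<F> \<I> t) / scale n + D n t)"
    if \<eta>: "0 < \<eta>" "\<eta> < kappa * sqrt C2" for \<eta>
  proof -
    \<comment> \<open>Here \<open>\<eta> < kappa * sqrt C2\<close> makes s positive, and s < sqrt C2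
      gives \<open>\<alpha> * C2 > 1\<close> for \<open>\<alpha> = 1 / s\<^sup>2\<close>.\<close>
    define s where "s = sqrt C2 - \<eta> / kappa"
    have s: "s > 0" "kappa * s = kappa * sqrt C2 - \<eta>" "s < sqrt C2"
      using \<eta> kappa_pos by (auto simp: s_def right_diff_distrib pos_divide_less_eq mult.commute)
    have "s\<^sup>2 < (sqrt C2)\<^sup>2" using s by (intro power_strict_mono) auto
    then have "(1 / s\<^sup>2) * C2 > 1" using s(1) \<open>C2 > 0\<close> by simp
    moreover have "kappa / sqrt (1 / s\<^sup>2) = kappa * s" using s(1) by (simp add: real_sqrt_divide)
    ultimately show ?thesis using lower_deviation[OF subclasses C2a r C2b, of "1 / s\<^sup>2"] s by simp
  qed
  have eq: "x * real n / sqrt (ln (real n)) = x * scale n" for x n by (simp add: scale_def)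
  show ?thesis
    unfolding A kappa eq
    using \<open>C2 > 0\<close> kappa_pos
    by (intro expectation_and_probability[OF nontrivial _ upper lower]) auto
qed

end
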